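(* Let $\Omega\subset\mathbb C$ be a bounded domain whose boundary $\partial\Omega$ is given by a finite number of piecewise smooth curves. Let $m\ge 1$ and $\varphi\in C^m(\overline\Omega)$. Let $z\in\Omega$, and let $r>0$ be small enough so that $D_r=\{\zeta:|\zeta-z|<r\}\subset\Omega$. Then for every integer $n$ with $1\le n\le m+1$, $$\frac{1}{(n-1)!}\,\partial^{n-1}\varphi(z)=\frac{1}{2\pi i}\int_{\partial\Omega}\frac{\varphi(\zeta)}{(\zeta-z)^n}\,d\zeta+\frac{1}{2\pi i}\int_{\Omega\setminus D_r}\frac{\overline\partial\varphi(\zeta)}{(\zeta-z)^n}\,d\zeta\wedge d\overline\zeta-\sum_{1\le k\le (m+1-n)/2}\frac{\partial^{n-1+k}\,\overline\partial^{k}\varphi(z)}{(n-1+k)!\,k!}\,r^{2k}+o(r^{m+1-n})$$ as $r\to 0$.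
   Context: $C^m(\overline\Omega)$ denotes complex-valued functions with continuous partial derivatives (in the real variables) up to order $m$ on $\overline\Omega$. With $\zeta=\xi+i\eta$, the Wirtinger operators are $\partial=\frac12\left(\frac{\partial}{\partial\xi}-i\frac{\partial}{\partial\eta}\right)$ and $\overline\partial=\frac12\left(\frac{\partial}{\partial\xi}+i\frac{\partial}{\partial\eta}\right)$, and $d\zeta\wedge d\overline\zeta=-2i\,d\xi\,d\eta$. The boundary $\partial\Omega$ is positively oriented. *)

theory Defs
  imports "HOL-Complex_Analysis.Complex_Analysis" "HOL-Library.Landau_Symbols"
begin

text \<open>Unlike \<^const>\<open>valid_path\<close>, which puts no condition on the derivative near a break point
  (so that the path need not even be rectifiable), each piece has to be \<open>C\<^sup>1\<close> on a closed
  interval, with one-sided derivatives at its end points.\<close>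

definition piecewise_smooth_path :: "(real \<Rightarrow> complex) \<Rightarrow> bool" where
  "piecewise_smooth_path \<gamma> \<longleftrightarrow> path \<gamma> \<and>
     (\<exists>ts. ts \<noteq> [] \<and> sorted_wrt (<) ts \<and> hd ts = 0 \<and> last ts = 1 \<and>
       (\<forall>i. Suc i < length ts \<longrightarrow>
         (\<exists>\<gamma>'. continuous_on {ts ! i..ts ! Suc i} \<gamma>' \<and>
            (\<forall>t\<in>{ts ! i..ts ! Suc i}.
               (\<gamma> has_vector_derivative \<gamma>' t) (at t within {ts ! i..ts ! Suc i})))))"

text \<open>The cycle formed by the closed curves in \<open>\<Gamma>\<close> is the positively oriented boundary of \<open>\<Omega>\<close>, in
  the usual sense of complex analysis (Ahlfors): it runs through the topological boundary, winding
  once around every point of \<open>\<Omega>\<close> and not at all around the points outside the closure of \<open>\<Omega>\<close>.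
  Hence outer boundary curves are counterclockwise and inner ones clockwise.\<close>

definition positively_oriented_boundary :: "complex set \<Rightarrow> (real \<Rightarrow> complex) set \<Rightarrow> bool" where
  "positively_oriented_boundary \<Omega> \<Gamma> \<longleftrightarrow>
     finite \<Gamma> \<and>
     (\<forall>\<gamma>\<in>\<Gamma>. piecewise_smooth_path \<gamma> \<and> pathfinish \<gamma> = pathstart \<gamma>) \<and>
     (\<Union>\<gamma>\<in>\<Gamma>. path_image \<gamma>) = frontier \<Omega> \<and>
     (\<forall>w\<in>\<Omega>. (\<Sum>\<gamma>\<in>\<Gamma>. winding_number \<gamma> w) = 1) \<and>
     (\<forall>w. w \<notin> closure \<Omega> \<longrightarrow> (\<Sum>\<gamma>\<in>\<Gamma>. winding_number \<gamma> w) = 0)"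

definition boundary_integral :: "(real \<Rightarrow> complex) set \<Rightarrow> (complex \<Rightarrow> complex) \<Rightarrow> complex" where
  "boundary_integral \<Gamma> f = (\<Sum>\<gamma>\<in>\<Gamma>. contour_integral \<gamma> f)"

text \<open>Integral of the 2-form \<open>f d\<zeta> \<and> d\<zeta>\<^sup>*\<close> (\<open>\<zeta>\<^sup>*\<close> the conjugate of \<open>\<zeta>\<close>), which is
  \<open>-2\<i> f d\<xi> d\<eta>\<close>.\<close>

definition wedge_integral :: "complex set \<Rightarrow> (complex \<Rightarrow> complex) \<Rightarrow> complex" where
  "wedge_integral A f = - 2 * \<i> * (LINT \<zeta>:A|lborel. f \<zeta>)"

definition partial_xi :: "(complex \<Rightarrow> complex) \<Rightarrow> complex \<Rightarrow> complex" where
  "partial_xi f \<zeta> = vector_derivative (\<lambda>t::real. f (\<zeta> + of_real t)) (at 0)"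

definition partial_eta :: "(complex \<Rightarrow> complex) \<Rightarrow> complex \<Rightarrow> complex" where
  "partial_eta f \<zeta> = vector_derivative (\<lambda>t::real. f (\<zeta> + \<i> * of_real t)) (at 0)"

definition wirtinger :: "(complex \<Rightarrow> complex) \<Rightarrow> complex \<Rightarrow> complex" where
  "wirtinger f \<zeta> = (partial_xi f \<zeta> - \<i> * partial_eta f \<zeta>) / 2"

definition wirtinger_bar :: "(complex \<Rightarrow> complex) \<Rightarrow> complex \<Rightarrow> complex" where
  "wirtinger_bar f \<zeta> = (partial_xi f \<zeta> + \<i> * partial_eta f \<zeta>) / 2"

text \<open>Functions of class \<open>C\<^sup>m\<close> on the closure of the open set \<open>\<Omega>\<close>: every iterated real partial
  derivative of order at most \<open>m\<close> exists in \<open>\<Omega>\<close> and extends continuously to the closure. The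
  functions \<open>g\<close> and \<open>h\<close> below are the extensions of the two first-order partial derivatives.\<close>

primrec C_on_closure :: "nat \<Rightarrow> complex set \<Rightarrow> (complex \<Rightarrow> complex) \<Rightarrow> bool" where
  "C_on_closure 0 \<Omega> f \<longleftrightarrow> continuous_on (closure \<Omega>) f"
| "C_on_closure (Suc m) \<Omega> f \<longleftrightarrow>
     continuous_on (closure \<Omega>) f \<and>
     (\<exists>g h. C_on_closure m \<Omega> g \<and> C_on_closure m \<Omega> h \<and>
       (\<forall>\<zeta>\<in>\<Omega>.
          ((\<lambda>t::real. f (\<zeta> + of_real t)) has_vector_derivative g \<zeta>) (at 0) \<and>
          ((\<lambda>t::real. f (\<zeta> + \<i> * of_real t)) has_vector_derivative h \<zeta>) (at 0)))"

end

theory Submission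
  imports Defs
begin

text \<open>Cut a closed disc \<open>D\<close> of radius \<open>r\<close> around \<open>z\<close> out of \<open>\<Omega>\<close> and apply Green's formula to
  \<open>\<phi>(\<zeta>) / (\<zeta> - z)\<^sup>n\<close> on the rest: the boundary and the area integral together equal the integral of
  this function over the circle. Taylor's formula for \<open>\<phi>\<close> in powers of \<open>w = \<zeta> - z\<close> and its
  conjugate turns the circle integral into the asserted expansion, since there the conjugate of
  \<open>w\<close> is \<open>r\<^sup>2 / w\<close> and only the terms with exponent \<open>-1\<close> survive.

  As \<open>\<phi>\<close> need not extend to a \<open>C\<^sup>1\<close> function near \<open>\<partial>\<Omega>\<close>, Green's formula is proved as follows. Extend
  the integrand continuously to \<open>F\<close> with compact support. By Fubini's theorem for the Cauchy kernel
  and the winding numbers of \<open>\<Gamma>\<close> and of circles, the boundary integral of the mean of \<open>F\<close> over discs of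
  radius \<open>\<epsilon>\<close> is an integral over \<open>\<Omega>\<close> of integrals of \<open>F\<close> along circles of radius \<open>\<epsilon>\<close>. Now let
  \<open>\<epsilon>\<close> tend to \<open>0\<close>.\<close>

section \<open>The Cauchy kernel\<close>

text \<open>The boundary is known only through finitely many curves and their winding numbers, so no
  local graph or flattening of it is at hand. What replaces this is one double integral. Let V(p) be
  the integral of F(w) / (w - p) over the plane, and integrate V(\<gamma>(t) + q(s)) along the
  boundary cycle in t and along the circle q of radius \<epsilon> about 0 in s. Integrating in s
  first, the winding number of the circle leaves the integral of F over the disc around \<gamma>(t).
  Integrating in t first, the winding numbers of the cycle leave the integral of F(\<eta> + q(s))
  over the enclosed \<eta>. Both sides carry the factor -2 pi i, and the resulting identity is exact
  for every \<epsilon> and free of derivatives. Division by the disc area pi \<epsilon>^2 makes the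
  circle integral a difference quotient for 2 i times the conjugate Wirtinger derivative. The order
  of the error in the theorem is that of a Peano remainder o(|w|^m), divided by |w|^n and integrated
  over a circle of length 2 pi r.\<close>

lemma emeasure_cball_complex:
  fixes p :: complex
  assumes "r \<ge> 0"
  shows "emeasure lborel (cball p r) = ennreal (pi * r\<^sup>2)"
  using emeasure_cball[OF assms, of p] unit_ball_vol_even[of 1] by simp

lemma ball_cball_measurable [measurable]:
  fixes p :: complex
  shows "ball p r \<in> sets borel" "cball p r \<in> sets borel"
  by (auto intro: borel_open borel_closed)

text \<open>The singularity is summed over dyadic discs. Within distance 1 of \<open>p\<close> the
  kernel is at most \<open>2 ^ Suc k\<close> for some \<open>k\<close> whose disc of radius
  \<open>(1/2) ^ k\<close> contains \<open>w\<close>; these discs contribute 2 pi (1/2)^k each, in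
  total 4 pi. Farther away the kernel is at most 1. A bound independent of \<open>p\<close> is what
  permits Fubini along an arbitrary path.\<close>

lemma nn_integral_inverse_norm_le:
  fixes p :: complex
  assumes "R \<ge> 0"
  shows "(\<integral>\<^sup>+w. ennreal (indicator (cball 0 R) w * inverse (norm (w - p))) \<partial>lborel)
           \<le> ennreal (4 * pi + pi * R\<^sup>2)"
proof -
  define c where "c k w = ennreal (2 ^ Suc k) * indicator (cball p ((1/2) ^ k)) w"
    for k :: nat and w :: complex
  have c_meas [measurable]: "c k \<in> borel_measurable lborel" for k
    unfolding c_def by measurable
  have pointwise: "ennreal (indicator (cball 0 R) w * inverse (norm (w - p)))
      \<le> (\<Sum>k. c k w) + indicator (cball 0 R) w" for w
  proof (cases "0 < norm (w - p) \<and> norm (w - p) < 1")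
    case True
    define u where "u = norm (w - p)"
    obtain j where j: "(1/2) ^ j < u"
      using True real_arch_pow_inv[of u "1/2"] by (auto simp: u_def)
    \<comment> \<open>Minimality of \<open>l\<close> puts \<open>w\<close> into the disc of the
      preceding exponent \<open>k\<close>, while \<open>l\<close> itself yields the bound
      \<open>2 ^ Suc k\<close>. A preceding exponent exists because \<open>u < 1\<close>.\<close>
    define l where "l = (LEAST j. (1/2) ^ j < u)"
    have l: "(1/2) ^ l < u" unfolding l_def using j by (rule LeastI)
    have "l \<noteq> 0"
    proof
      assume "l = 0"
      with l True show False by (simp add: u_def)
    qed
    then obtain k where k: "l = Suc k" by (cases l) auto
    have uk: "u \<le> (1/2) ^ k"
      using not_less_Least[of k "\<lambda>j. (1/2) ^ j < u"] k by (auto simp: l_def)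
    have "inverse u \<le> 2 ^ Suc k"
      using l True unfolding k u_def
      by (simp add: field_simps power_divide)
    then have "ennreal (inverse u) \<le> ennreal (2 ^ Suc k)" by (rule ennreal_leI)
    also have "\<dots> = c k w"
      using uk by (simp add: c_def u_def dist_norm norm_minus_commute)
    also have "\<dots> \<le> (\<Sum>k. c k w)"
      using sum_le_suminf[of "\<lambda>k. c k w" "{k}"] by simp
    finally have "ennreal (inverse (norm (w - p))) \<le> (\<Sum>k. c k w)" by (simp add: u_def)
    then show ?thesis by (auto simp: indicator_def intro: add_increasing2)
  next
    case False
    \<comment> \<open>This case includes \<open>w = p\<close>, where
      \<open>inverse 0 = 0\<close>.\<close>
    then have "inverse (norm (w - p)) \<le> 1"
      by (cases "w = p") (auto simp: inverse_le_1_iff)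
    then have "ennreal (indicator (cball 0 R) w * inverse (norm (w - p))) \<le> indicator (cball 0 R) w"
      by (auto simp: indicator_def simp flip: ennreal_1 intro!: ennreal_leI)
    then show ?thesis by (auto intro: add_increasing)
  qed
  have "(\<integral>\<^sup>+w. ennreal (indicator (cball 0 R) w * inverse (norm (w - p))) \<partial>lborel)
      \<le> (\<integral>\<^sup>+w. (\<Sum>k. c k w) + indicator (cball 0 R) w \<partial>lborel)"
    using pointwise by (intro nn_integral_mono) auto
  also have "\<dots> = (\<Sum>k. \<integral>\<^sup>+w. c k w \<partial>lborel) + emeasure lborel (cball (0::complex) R)"
    by (subst nn_integral_add) (auto simp: nn_integral_suminf)
  also have "(\<lambda>k. \<integral>\<^sup>+w. c k w \<partial>lborel) = (\<lambda>k. ennreal (2 * pi * (1/2) ^ k))"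
  proof
    fix k
    have "(\<integral>\<^sup>+w. c k w \<partial>lborel) = ennreal (2 ^ Suc k) * ennreal (pi * ((1/2) ^ k)\<^sup>2)"
      by (simp add: c_def nn_integral_cmult emeasure_cball_complex)
    also have "\<dots> = ennreal (2 ^ Suc k * (pi * ((1/2) ^ k)\<^sup>2))"
      by (rule ennreal_mult[symmetric]) auto
    also have "2 ^ Suc k * (pi * ((1/2) ^ k)\<^sup>2) = 2 * pi * (1/2) ^ k"
      by (simp add: power2_eq_square power_divide)
    finally show "(\<integral>\<^sup>+w. c k w \<partial>lborel) = ennreal (2 * pi * (1/2) ^ k)" .
  qed
  also have "(\<Sum>k. ennreal (2 * pi * (1/2) ^ k)) = ennreal (4 * pi)"
  proof (rule suminf_ennreal_eq)
    show "(\<lambda>k. 2 * pi * (1/2) ^ k) sums (4 * pi)"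
      using sums_mult[OF geometric_sums[of "1/2::real"], of "2 * pi"] by simp
  qed auto
  also have "ennreal (4 * pi) + emeasure lborel (cball (0::complex) R) = ennreal (4 * pi + pi * R\<^sup>2)"
    using assms by (simp add: emeasure_cball_complex ennreal_plus)
  finally show ?thesis .
qed

text \<open>Up to the factor -pi this is the usual solution of the inhomogeneous Cauchy-Riemann
  equation with right side \<open>F\<close>. It is never differentiated; only its integrals along
  paths are used.\<close>

definition cauchy_transform :: "(complex \<Rightarrow> complex) \<Rightarrow> complex \<Rightarrow> complex" where
  "cauchy_transform F p = (LINT w|lborel. F w / (w - p))"

context
  fixes F :: "complex \<Rightarrow> complex" and B R :: real
  assumes F_meas [measurable]: "F \<in> borel_measurable borel"
    and F_bound: "\<And>w. norm (F w) \<le> B"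
    and F_supp: "\<And>w. norm w > R \<Longrightarrow> F w = 0"
    and R_pos: "R \<ge> 0"
begin

lemma nn_integral_cauchy_kernel_le:
  "(\<integral>\<^sup>+w. ennreal (norm (F w / (w - p))) \<partial>lborel) \<le> ennreal (B * (4 * pi + pi * R\<^sup>2))"
proof -
  have B: "B \<ge> 0" using F_bound[of 0] norm_ge_zero order_trans by blast
  have "norm (F w / (w - p)) \<le> B * (indicator (cball 0 R) w * inverse (norm (w - p)))" for w
  proof (cases "norm w \<le> R")
    case True
    then show ?thesis using F_bound[of w] 
      by (auto simp: norm_divide field_simps intro!: divide_right_mono)
  qed (use F_supp[of w] in auto)
  then have "(\<integral>\<^sup>+w. ennreal (norm (F w / (w - p))) \<partial>lborel)
     \<le> (\<integral>\<^sup>+w. ennreal B * ennreal (indicator (cball 0 R) w * inverse (norm (w - p))) \<partial>lborel)"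
    using B by (intro nn_integral_mono) (auto simp flip: ennreal_mult intro!: ennreal_leI)
  also have "\<dots> = ennreal B * (\<integral>\<^sup>+w. ennreal (indicator (cball 0 R) w * inverse (norm (w - p))) \<partial>lborel)"
    by (rule nn_integral_cmult) simp
  also have "\<dots> \<le> ennreal B * ennreal (4 * pi + pi * R\<^sup>2)"
    by (intro mult_left_mono nn_integral_inverse_norm_le R_pos) auto
  also have "\<dots> = ennreal (B * (4 * pi + pi * R\<^sup>2))" using B by (simp add: ennreal_mult)
  finally show ?thesis .
qed

lemma norm_cauchy_transform_le: "norm (cauchy_transform F p) \<le> B * (4 * pi + pi * R\<^sup>2)"
proof -
  have B: "B \<ge> 0" using F_bound[of 0] norm_ge_zero order_trans by blast
  have int: "integrable lborel (\<lambda>w. F w / (w - p))"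
  proof (rule integrableI_bounded)
    show "(\<integral>\<^sup>+w. ennreal (norm (F w / (w - p))) \<partial>lborel) < \<infinity>"
      by (rule le_less_trans[OF nn_integral_cauchy_kernel_le]) auto
  qed measurable
  have "ennreal (norm (cauchy_transform F p)) \<le> ennreal (B * (4 * pi + pi * R\<^sup>2))"
    unfolding cauchy_transform_def
    using integral_norm_bound_ennreal[OF int] nn_integral_cauchy_kernel_le order_trans by blast
  then show ?thesis using B by (subst (asm) ennreal_le_iff) auto
qed

lemma measurable_cauchy_transform [measurable]: "cauchy_transform F \<in> borel_measurable borel"
proof -
  have "cauchy_transform F = (\<lambda>p. LINT w|lborel. F w / (w - p))"
    by (auto simp: cauchy_transform_def)
  then show ?thesis by simp
qed

text \<open>With \<open>k\<close> the velocity of a path and \<open>p\<close> a translate of the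
  path, the left side is a contour integral of the Cauchy transform. Absolute integrability follows
  from the uniform kernel bound in \<open>w\<close> and from \<open>k\<close> being bounded and
  carried by the unit interval, even where the path crosses the support of \<open>F\<close>.\<close>

lemma cauchy_transform_Fubini:
  fixes k p :: "real \<Rightarrow> complex"
  assumes [measurable]: "k \<in> borel_measurable borel" "p \<in> borel_measurable borel"
    and k_bound: "\<And>t. norm (k t) \<le> C" and k_supp: "\<And>t. t \<notin> {0..1} \<Longrightarrow> k t = 0"
  shows "(LINT t|lborel. k t * cauchy_transform F (p t))
       = (LINT w|lborel. F w * (LINT t|lborel. k t / (w - p t)))"
    and "integrable lborel (\<lambda>w. F w * (LINT t|lborel. k t / (w - p t)))"
proof -
  let ?B = "B * (4 * pi + pi * R\<^sup>2)"
  have B: "?B \<ge> 0"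
    using order_trans[OF norm_ge_zero F_bound[of 0]] by auto
  have C: "C \<ge> 0" using order_trans[OF norm_ge_zero k_bound[of 0]] by auto
  define f where "f w t = k t * (F w / (w - p t))" for w t
  have f_meas [measurable]: "case_prod f \<in> borel_measurable (lborel \<Otimes>\<^sub>M lborel)"
    unfolding f_def by measurable
  have norm_meas: "(\<lambda>x. ennreal (norm (case_prod f x))) \<in> borel_measurable (lborel \<Otimes>\<^sub>M lborel)"
    by measurable
  have int: "integrable (lborel \<Otimes>\<^sub>M lborel) (case_prod f)"
  proof (rule integrableI_bounded[OF f_meas])
    have "(\<integral>\<^sup>+x. ennreal (norm (case_prod f x)) \<partial>(lborel \<Otimes>\<^sub>M lborel))
        = (\<integral>\<^sup>+t. (\<integral>\<^sup>+w. ennreal (norm (f w t)) \<partial>lborel) \<partial>lborel)"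
      using lborel_pair.nn_integral_snd[OF norm_meas] by simp
    also have "\<dots> \<le> (\<integral>\<^sup>+t. ennreal (C * ?B) * indicator {0..1} (t::real) \<partial>lborel)"
    proof (rule nn_integral_mono)
      fix t :: real
      have "(\<integral>\<^sup>+w. ennreal (norm (f w t)) \<partial>lborel)
          = ennreal (norm (k t)) * (\<integral>\<^sup>+w. ennreal (norm (F w / (w - p t))) \<partial>lborel)"
        by (subst nn_integral_cmult[symmetric]) (auto simp: f_def norm_mult norm_divide simp flip: ennreal_mult)
      also have "\<dots> \<le> ennreal (norm (k t)) * ennreal ?B"
        by (intro mult_left_mono nn_integral_cauchy_kernel_le) auto
      also have "\<dots> = ennreal (norm (k t) * ?B)" using B by (simp add: ennreal_mult)
      also have "\<dots> \<le> ennreal (C * ?B) * indicator {0..1} t"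
        using k_bound[of t] k_supp[of t] B C
        by (cases "t \<in> {0..1}") (auto intro!: ennreal_leI mult_right_mono)
      finally show "(\<integral>\<^sup>+w. ennreal (norm (f w t)) \<partial>lborel) \<le> ennreal (C * ?B) * indicator {0..1} t" .
    qed
    also have "\<dots> < \<infinity>" by (simp add: nn_integral_cmult)
    finally show "(\<integral>\<^sup>+x. ennreal (norm (case_prod f x)) \<partial>(lborel \<Otimes>\<^sub>M lborel)) < \<infinity>" .
  qed
  have f_w: "(\<lambda>w. LINT t|lborel. f w t) = (\<lambda>w. F w * (LINT t|lborel. k t / (w - p t)))"
  proof
    fix w
    have "(LINT t|lborel. f w t) = (LINT t|lborel. F w * (k t / (w - p t)))"
      unfolding f_def by (simp add: mult.commute)
    then show "(LINT t|lborel. f w t) = F w * (LINT t|lborel. k t / (w - p t))"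
      by (simp del: times_divide_eq_right)
  qed
  show "integrable lborel (\<lambda>w. F w * (LINT t|lborel. k t / (w - p t)))"
    using lborel_pair.integrable_fst[OF int] unfolding f_w .
  have "(LINT t|lborel. k t * cauchy_transform F (p t)) = (LINT t|lborel. LINT w|lborel. f w t)"
    unfolding f_def cauchy_transform_def by (simp del: times_divide_eq_right)
  also have "\<dots> = (LINT w|lborel. LINT t|lborel. f w t)"
    by (rule lborel_pair.Fubini_integral[OF int])
  finally show "(LINT t|lborel. k t * cauchy_transform F (p t))
       = (LINT w|lborel. F w * (LINT t|lborel. k t / (w - p t)))"
    unfolding f_w .
qed

end

section \<open>Velocities of piecewise smooth paths\<close>

text \<open>The velocity is a bounded Borel function on the whole line that vanishes outside the
  unit interval, so contour integrals become Lebesgue integrals and can enter Fubini's theorem. The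
  bound \<open>C\<close> makes \<open>\<gamma>\<close> Lipschitz, which controls the area of its
  neighbourhoods.\<close>

definition has_velocity :: "(real \<Rightarrow> complex) \<Rightarrow> (real \<Rightarrow> complex) \<Rightarrow> real \<Rightarrow> bool" where
  "has_velocity \<gamma> d C \<longleftrightarrow> continuous_on {0..1} \<gamma> \<and> d \<in> borel_measurable borel \<and>
     (\<forall>t. norm (d t) \<le> C) \<and> (\<forall>t. t \<notin> {0..1} \<longrightarrow> d t = 0) \<and>
     (\<exists>S. finite S \<and> (\<forall>t\<in>{0<..<1} - S. (\<gamma> has_vector_derivative d t) (at t)) \<and>
        continuous_on ({0<..<1} - S) d)"

text \<open>The first element above \<open>t\<close> has a predecessor below \<open>t\<close>.
  Applied to the break points, this covers the other parameters by finitely many open gaps.\<close>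

lemma exists_consecutive_list_elements:
  fixes ts :: "'a::linorder list"
  assumes "ts \<noteq> []" "hd ts \<le> t" "t \<le> last ts" "t \<notin> set ts"
  shows "\<exists>i. Suc i < length ts \<and> ts ! i < t \<and> t < ts ! Suc i"
  using assms
proof (induction ts rule: induct_list012)
  case (3 a b l)
  show ?case
  proof (cases "t < b")
    case True
    with 3 show ?thesis by (intro exI[of _ 0]) auto
  next
    case False
    with 3 have "\<exists>i. Suc i < length (b # l) \<and> (b # l) ! i < t \<and> t < (b # l) ! Suc i" by auto
    then obtain i where "Suc i < length (b # l) \<and> (b # l) ! i < t \<and> t < (b # l) ! Suc i" ..
    then show ?thesis by (intro exI[of _ "Suc i"]) auto
  qed
qed auto

text \<open>Off the break points the two-sided derivative agrees with the derivative functions of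
  the closed pieces. These are continuous on compact intervals, which supplies the uniform
  bound.\<close>

lemma piecewise_smooth_path_has_velocity:
  assumes "piecewise_smooth_path \<gamma>"
  obtains d C where "has_velocity \<gamma> d C"
proof -
  from assms obtain ts where cont: "continuous_on {0..1} \<gamma>"
    and ts: "ts \<noteq> []" "hd ts = 0" "last ts = 1"
    and "\<forall>i. Suc i < length ts \<longrightarrow>
         (\<exists>\<gamma>'. continuous_on {ts ! i..ts ! Suc i} \<gamma>' \<and>
            (\<forall>t\<in>{ts ! i..ts ! Suc i}.
               (\<gamma> has_vector_derivative \<gamma>' t) (at t within {ts ! i..ts ! Suc i})))"
    unfolding piecewise_smooth_path_def path_def by blast
  then obtain g where g: "\<And>i. Suc i < length ts \<Longrightarrow> continuous_on {ts ! i..ts ! Suc i} (g i)"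
    "\<And>i t. Suc i < length ts \<Longrightarrow> t \<in> {ts ! i..ts ! Suc i} \<Longrightarrow>
         (\<gamma> has_vector_derivative g i t) (at t within {ts ! i..ts ! Suc i})"
    by metis
  define I where "I = {i. Suc i < length ts}"
  have "finite I" unfolding I_def by (rule finite_subset[of _ "{..<length ts}"]) auto
  define A where "A i = {ts ! i<..<ts ! Suc i} \<inter> ({0<..<1} - set ts)" for i
  have A_open: "open (A i)" for i
    unfolding A_def by (intro open_Int open_Diff finite_imp_closed) auto
  have A_cover: "{0<..<1} - set ts = (\<Union>i\<in>I. A i)"
  proof (intro equalityI subsetI)
    fix t assume t: "t \<in> {0<..<1} - set ts"
    then have "\<exists>i. Suc i < length ts \<and> ts ! i < t \<and> t < ts ! Suc i"
      using ts by (intro exists_consecutive_list_elements) auto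
    with t show "t \<in> (\<Union>i\<in>I. A i)" by (auto simp: A_def I_def)
  qed (auto simp: A_def)
  \<comment> \<open>Cut off at the break points, where \<open>vector_derivative\<close> may be
    arbitrary. What remains is an open set on which \<open>d\<close> is continuous, hence
    \<open>d\<close> is Borel.\<close>
  define d where "d t = indicator ({0<..<1} - set ts) t *\<^sub>R vector_derivative \<gamma> (at t)" for t
  have g_deriv: "(\<gamma> has_vector_derivative g i t) (at t)" if "i \<in> I" "t \<in> A i" for i t
    using g(2)[of i t] that by (auto simp: I_def A_def at_within_Icc_at)
  have d_g: "d t = g i t" if "i \<in> I" "t \<in> A i" for i t
  proof -
    have "t \<in> {0<..<1} - set ts" using that A_cover by blast
    then show ?thesis using g_deriv[OF that] by (simp add: d_def vector_derivative_at)
  qed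
  have deriv: "(\<gamma> has_vector_derivative d t) (at t)" if "t \<in> {0<..<1} - set ts" for t
    using that g_deriv d_g unfolding A_cover by force
  have "continuous_on (A i) d" if "i \<in> I" for i
  proof -
    have "continuous_on (A i) (g i)"
      using that by (intro continuous_on_subset[OF g(1)]) (auto simp: A_def I_def)
    then show ?thesis by (rule continuous_on_eq) (simp add: d_g[OF that])
  qed
  then have d_cont: "continuous_on ({0<..<1} - set ts) d"
    unfolding A_cover using A_open by (intro continuous_on_open_UN) auto
  have "d = (\<lambda>t. indicator ({0<..<1} - set ts) t *\<^sub>R d t)"
    by (auto simp: d_def indicator_def)
  moreover have "(\<lambda>t. indicator ({0<..<1} - set ts) t *\<^sub>R d t) \<in> borel_measurable borel"
    using d_cont by (intro borel_measurable_continuous_on_indicator) 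
      (auto intro!: borel_open open_Diff finite_imp_closed)
  ultimately have d_meas: "d \<in> borel_measurable borel" by simp
  have "bounded (\<Union>i\<in>I. g i ` {ts ! i..ts ! Suc i})"
    using \<open>finite I\<close> g(1)
    by (auto intro!: bounded_UN compact_imp_bounded compact_continuous_image simp: I_def)
  then obtain C where C: "\<And>x. x \<in> (\<Union>i\<in>I. g i ` {ts ! i..ts ! Suc i}) \<Longrightarrow> norm x \<le> C"
    unfolding bounded_iff by blast
  have d_bound: "norm (d t) \<le> max C 0" for t
  proof (cases "t \<in> {0<..<1} - set ts")
    case True
    then obtain i where i: "i \<in> I" "t \<in> A i" unfolding A_cover by blast
    then have "norm (g i t) \<le> C" by (intro C UN_I[of i] imageI) (auto simp: A_def)
    with d_g[OF i] show ?thesis by simp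
  qed (auto simp: d_def)
  have "has_velocity \<gamma> d (max C 0)"
    unfolding has_velocity_def
    using cont d_meas d_bound deriv d_cont
    by (auto intro!: exI[of _ "set ts"]) (auto simp: d_def)
  then show thesis ..
qed

lemma has_velocityD:
  assumes "has_velocity \<gamma> d C"
  shows "continuous_on {0..1} \<gamma>" "d \<in> borel_measurable borel" "norm (d t) \<le> C"
    "t \<notin> {0..1} \<Longrightarrow> d t = 0"
  using assms unfolding has_velocity_def by auto

lemma has_velocity_imp_valid_path:
  assumes "has_velocity \<gamma> d C"
  shows "valid_path \<gamma>"
proof -
  obtain S where S: "finite S" "\<And>t. t\<in>{0<..<1} - S \<Longrightarrow> (\<gamma> has_vector_derivative d t) (at t)"
    "continuous_on ({0<..<1} - S) d"
    using assms unfolding has_velocity_def by blast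
  have *: "{0..1} - insert 0 (insert 1 S) = {0<..<1} - S" by auto
  have "\<gamma> C1_differentiable_on ({0..1} - insert 0 (insert 1 S))"
    unfolding C1_differentiable_on_def * using S by blast
  then show ?thesis
    unfolding valid_path_def piecewise_C1_differentiable_on_def
    using has_velocityD(1)[OF assms] S(1) by (meson finite_insert)
qed

lemma has_velocity_contour_integral:
  assumes "has_velocity \<gamma> d C" and f: "continuous_on (path_image \<gamma>) f"
  shows "contour_integral \<gamma> f = (LINT t|lborel. d t * f (\<gamma> t))"
    and "integrable lborel (\<lambda>t. d t * f (\<gamma> t))"
proof -
  note v = has_velocityD[OF assms(1)]
  obtain S where S: "finite S" "\<And>t. t\<in>{0<..<1} - S \<Longrightarrow> (\<gamma> has_vector_derivative d t) (at t)"
    using assms(1) unfolding has_velocity_def by blast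
  have f\<gamma>: "continuous_on {0..1} (\<lambda>t. f (\<gamma> t))"
    using continuous_on_compose2[OF f v(1)] by (auto simp: path_image_def)
  then have "bounded ((\<lambda>t. f (\<gamma> t)) ` {0..1})"
    by (intro compact_imp_bounded compact_continuous_image) auto
  then obtain K where K: "\<And>t. t \<in> {0..1} \<Longrightarrow> norm (f (\<gamma> t)) \<le> K" unfolding bounded_iff by blast
  have eq: "d t * f (\<gamma> t) = d t * (indicator {0..1} t *\<^sub>R f (\<gamma> t))" for t
    using v(4)[of t] by (auto simp: indicator_def)
  have meas: "(\<lambda>t. d t * f (\<gamma> t)) \<in> borel_measurable borel"
    unfolding eq using v(2) f\<gamma>
    by (intro borel_measurable_times borel_measurable_continuous_on_indicator) auto
  show int: "integrable lborel (\<lambda>t. d t * f (\<gamma> t))"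
  proof (rule integrableI_bounded_set[of "{0..1}" _ _ "C * K"])
    show "AE t in lborel. t \<in> {0..1} \<longrightarrow> norm (d t * f (\<gamma> t)) \<le> C * K"
      using v(3) K order_trans[OF norm_ge_zero v(3)]
      by (intro AE_I2) (auto simp: norm_mult intro!: mult_mono)
  qed (use meas v(4) in auto)
  have "((\<lambda>t. if t \<in> {0..1} then d t * f (\<gamma> t) else 0) has_integral
      (LINT t|lborel. d t * f (\<gamma> t))) UNIV"
    by (rule has_integral_eq[OF _ has_integral_integral_lborel[OF int]]) (use v(4) in auto)
  then have "((\<lambda>t. d t * f (\<gamma> t)) has_integral (LINT t|lborel. d t * f (\<gamma> t))) {0..1}"
    by (simp only: has_integral_restrict_UNIV)
  then have "((\<lambda>t. f (\<gamma> t) * vector_derivative \<gamma> (at t)) has_integral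
      (LINT t|lborel. d t * f (\<gamma> t))) {0..1}"
  proof (rule has_integral_spike_finite[rotated 2])
    show "finite (insert 0 (insert 1 S))" using S(1) by simp
    show "f (\<gamma> t) * vector_derivative \<gamma> (at t) = d t * f (\<gamma> t)"
      if "t \<in> {0..1} - insert 0 (insert 1 S)" for t
      using that S(2)[of t] by (auto simp: at_within_Icc_at vector_derivative_at)
  qed
  then show "contour_integral \<gamma> f = (LINT t|lborel. d t * f (\<gamma> t))"
    unfolding contour_integral_integral by (rule integral_unique)
qed

text \<open>The minus sign comes from the kernel \<open>w - \<gamma> t\<close> in place of
  \<open>\<gamma> t - w\<close>.\<close>

lemma has_velocity_winding_number:
  assumes "has_velocity \<gamma> d C" and "w \<notin> path_image \<gamma>"
  shows "(LINT t|lborel. d t / (w - \<gamma> t)) = - (2 * of_real pi * \<i> * winding_number \<gamma> w)"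
proof -
  have "winding_number \<gamma> w = 1 / (2 * pi * \<i>) * contour_integral \<gamma> (\<lambda>\<zeta>. 1 / (\<zeta> - w))"
    using has_velocity_imp_valid_path[OF assms(1)] assms(2) by (rule winding_number_valid_path)
  also have "contour_integral \<gamma> (\<lambda>\<zeta>. 1 / (\<zeta> - w)) = (LINT t|lborel. d t * (1 / (\<gamma> t - w)))"
    using assms(2) by (intro has_velocity_contour_integral[OF assms(1)] continuous_intros) auto
  also have "(\<lambda>t. d t * (1 / (\<gamma> t - w))) = (\<lambda>t. - (d t / (w - \<gamma> t)))"
    by (auto simp: minus_divide_right)
  finally show ?thesis by simp
qed

section \<open>Area of thin neighbourhoods of a path\<close>

lemma has_velocity_lipschitz:
  assumes "has_velocity \<gamma> d C" "0 \<le> a" "a \<le> b" "b \<le> 1"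
  shows "norm (\<gamma> b - \<gamma> a) \<le> C * (b - a)"
proof -
  obtain S where S: "finite S" "\<And>t. t\<in>{0<..<1} - S \<Longrightarrow> (\<gamma> has_vector_derivative d t) (at t)"
    using assms(1) unfolding has_velocity_def by blast
  have "(d has_integral (\<gamma> b - \<gamma> a)) {a..b}"
    using assms S(2)
    by (intro fundamental_theorem_of_calculus_interior_strong[OF S(1)]
         continuous_on_subset[OF has_velocityD(1)[OF assms(1)]]) auto
  then have "(d has_integral (\<gamma> b - \<gamma> a)) (cbox a b)" by simp
  from has_integral_bound[OF _ this, of C] show ?thesis
    using has_velocityD(3)[OF assms(1)] order_trans[OF norm_ge_zero has_velocityD(3)[OF assms(1)]]
    assms(3) by auto
qed

text \<open>Sample the path at about \<open>1 / \<epsilon>\<close> equally spaced parameters. By the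
  Lipschitz bound every point of the path is within \<open>C * \<epsilon>\<close> of a sample, so at
  most \<open>3 / \<epsilon>\<close> discs of radius \<open>(C + 1) * \<epsilon>\<close> cover the
  tube. Green's formula depends on the area being linear in \<open>\<epsilon>\<close>.\<close>

lemma emeasure_tube_le:
  assumes "has_velocity \<gamma> d C" "0 < \<epsilon>" "\<epsilon> \<le> 1"
  shows "emeasure lborel {w. infdist w (path_image \<gamma>) \<le> \<epsilon>} \<le> ennreal (3 * pi * (C + 1)\<^sup>2 * \<epsilon>)"
proof -
  have C: "C \<ge> 0" using order_trans[OF norm_ge_zero has_velocityD(3)[OF assms(1)]] .
  \<comment> \<open>Rounding up makes the mesh \<open>1 / N\<close> at most
    \<open>\<epsilon>\<close>. The \<open>N + 1\<close> samples number at most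
    \<open>1 / \<epsilon> + 2\<close>, hence at most \<open>3 / \<epsilon>\<close> because
    \<open>\<epsilon> \<le> 1\<close>.\<close>
  define N where "N = nat \<lceil>1 / \<epsilon>\<rceil>"
  have N: "1 / \<epsilon> \<le> real N" "real N \<le> 1 / \<epsilon> + 1" "N > 0"
    using assms by (auto simp: N_def)
  define x where "x i = \<gamma> (real i / real N)" for i
  have sub: "{w. infdist w (path_image \<gamma>) \<le> \<epsilon>} \<subseteq> (\<Union>i\<in>{..N}. cball (x i) ((C + 1) * \<epsilon>))"
  proof
    fix w assume w: "w \<in> {w. infdist w (path_image \<gamma>) \<le> \<epsilon>}"
    have "path \<gamma>" using has_velocityD(1)[OF assms(1)] by (simp add: path_def)
    then have "closed (path_image \<gamma>)" "path_image \<gamma> \<noteq> {}" by (auto intro: closed_path_image)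
    then obtain y where y: "y \<in> path_image \<gamma>" "infdist w (path_image \<gamma>) = dist w y"
      by (rule infdist_attains_inf)
    then obtain t where t: "t \<in> {0..1}" "y = \<gamma> t" by (auto simp: path_image_def)
    define i where "i = nat \<lfloor>t * N\<rfloor>"
    have i: "real i \<le> t * N" "t * N \<le> real i + 1" using t by (auto simp: i_def)
    have "t * real N \<le> 1 * real N" using t by (intro mult_right_mono) auto
    with i have iN: "i \<le> N" by simp
    have "norm (\<gamma> t - \<gamma> (real i / N)) \<le> C * (t - real i / N)"
      using t i N by (intro has_velocity_lipschitz[OF assms(1)]) (auto simp: field_simps)
    also have "\<dots> \<le> C * \<epsilon>"
    proof (intro mult_left_mono C)
      have "t - real i / N = (t * N - real i) / N" using N by (simp add: diff_divide_distrib)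
      also have "\<dots> \<le> 1 / N" using i by (intro divide_right_mono) auto
      also have "\<dots> \<le> \<epsilon>" using N assms by (simp add: field_simps)
      finally show "t - real i / N \<le> \<epsilon>" .
    qed
    finally have "dist (x i) y \<le> C * \<epsilon>" by (simp add: x_def t dist_norm norm_minus_commute)
    moreover have "dist w y \<le> \<epsilon>" using w y by simp
    ultimately have "dist (x i) w \<le> (C + 1) * \<epsilon>"
      using dist_triangle2[of "x i" w y] by (simp add: algebra_simps dist_commute)
    with iN show "w \<in> (\<Union>i\<in>{..N}. cball (x i) ((C + 1) * \<epsilon>))" by auto
  qed
  have "emeasure lborel {w. infdist w (path_image \<gamma>) \<le> \<epsilon>}
      \<le> emeasure lborel (\<Union>i\<in>{..N}. cball (x i) ((C + 1) * \<epsilon>))"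
    by (rule emeasure_mono[OF sub]) auto
  also have "\<dots> \<le> (\<Sum>i\<in>{..N}. emeasure lborel (cball (x i) ((C + 1) * \<epsilon>)))"
    by (rule emeasure_subadditive_finite) auto
  also have "\<dots> = (\<Sum>i\<in>{..N}. ennreal (pi * ((C + 1) * \<epsilon>)\<^sup>2))"
    using C assms by (simp add: emeasure_cball_complex)
  also have "\<dots> = ennreal (real (N + 1) * (pi * ((C + 1) * \<epsilon>)\<^sup>2))"
    by (simp add: ennreal_mult ennreal_of_nat_eq_real_of_nat del: of_nat_Suc of_nat_add)
  also have "\<dots> \<le> ennreal (3 * pi * (C + 1)\<^sup>2 * \<epsilon>)"
  proof (rule ennreal_leI)
    have "real (N + 1) \<le> 3 / \<epsilon>"
    proof -
      have "1 \<le> 1 / \<epsilon>" using assms by simp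
      then show ?thesis using N by simp
    qed
    then have "real (N + 1) * (pi * ((C + 1) * \<epsilon>)\<^sup>2) \<le> 3 / \<epsilon> * (pi * ((C + 1) * \<epsilon>)\<^sup>2)"
      by (intro mult_right_mono) auto
    also have "\<dots> = 3 * pi * (C + 1)\<^sup>2 * \<epsilon>" using assms by (simp add: power2_eq_square field_simps)
    finally show "real (N + 1) * (pi * ((C + 1) * \<epsilon>)\<^sup>2) \<le> 3 * pi * (C + 1)\<^sup>2 * \<epsilon>" .
  qed
  finally show ?thesis .
qed

text \<open>The image lies in every tube around it, and the area bound of the tube tends to 0 with
  its width.\<close>

lemma path_image_null_set:
  assumes "has_velocity \<gamma> d C"
  shows "path_image \<gamma> \<in> null_sets lborel"
proof -
  have "path \<gamma>" using has_velocityD(1)[OF assms] by (simp add: path_def)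
  then have "closed (path_image \<gamma>)" by (auto intro: closed_path_image)
  moreover have "emeasure lborel (path_image \<gamma>) = 0"
  proof (rule ccontr)
    assume "emeasure lborel (path_image \<gamma>) \<noteq> 0"
    define K where "K = 3 * pi * (C + 1)\<^sup>2"
    have le: "emeasure lborel (path_image \<gamma>) \<le> ennreal (K * \<epsilon>)" if "0 < \<epsilon>" "\<epsilon> \<le> 1" for \<epsilon>
    proof -
      have "emeasure lborel (path_image \<gamma>) \<le> emeasure lborel {w. infdist w (path_image \<gamma>) \<le> \<epsilon>}"
        using that by (intro emeasure_mono) (auto intro!: borel_closed closed_Collect_le continuous_intros)
      also have "\<dots> \<le> ennreal (K * \<epsilon>)"
        unfolding K_def using emeasure_tube_le[OF assms that] by simp
      finally show ?thesis .
    qed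
    have "((\<lambda>\<epsilon>. ennreal (K * \<epsilon>)) \<longlongrightarrow> ennreal (K * 0)) (at_right 0)"
      by (intro tendsto_intros)
    moreover have "\<forall>\<^sub>F \<epsilon> in at_right 0. emeasure lborel (path_image \<gamma>) \<le> ennreal (K * \<epsilon>)"
      using eventually_at_right_less[of 0] eventually_at_right[of 0 1]
      by (intro eventually_mono[OF eventually_at_rightI[of 0 1 "\<lambda>\<epsilon>. 0 < \<epsilon> \<and> \<epsilon> \<le> 1"]]) (auto intro: le)
    ultimately have "emeasure lborel (path_image \<gamma>) \<le> ennreal (K * 0)"
      by (intro tendsto_lowerbound) auto
    with \<open>emeasure lborel (path_image \<gamma>) \<noteq> 0\<close> show False by simp
  qed
  ultimately show ?thesis by (auto intro!: null_setsI borel_closed)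
qed

text \<open>Up to the factor \<open>- 2 * pi * \<i>\<close> this is the winding number, but it is measurable in \<open>w\<close>
  also on the image of the path, where \<^const>\<open>winding_number\<close> is arbitrary.\<close>

definition index_integral :: "(real \<Rightarrow> complex) \<Rightarrow> (real \<Rightarrow> complex) \<Rightarrow> complex \<Rightarrow> complex" where
  "index_integral \<gamma> d w = (LINT t|lborel. d t / (w - \<gamma> t))"

text \<open>Outside the unit interval \<open>\<gamma>\<close> is arbitrary and perhaps not
  measurable. Since the velocity vanishes there, \<open>\<gamma>\<close> may be replaced by this
  cut-off version under every integral.\<close>

lemma has_velocity_measurable_restrict:
  assumes "has_velocity \<gamma> d C"
  shows "(\<lambda>t. indicator {0..1} t *\<^sub>R \<gamma> t) \<in> borel_measurable borel"
  using has_velocityD(1)[OF assms] by (intro borel_measurable_continuous_on_indicator) auto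

lemma index_integral_restrict:
  assumes "has_velocity \<gamma> d C"
  shows "index_integral \<gamma> d w = (LINT t|lborel. d t / (w - indicator {0..1} t *\<^sub>R \<gamma> t))"
  unfolding index_integral_def using has_velocityD(4)[OF assms]
  by (intro Bochner_Integration.integral_cong) (auto simp: indicator_def)

lemma measurable_index_integral:
  assumes "has_velocity \<gamma> d C"
  shows "index_integral \<gamma> d \<in> borel_measurable borel"
proof -
  note [measurable] = has_velocity_measurable_restrict[OF assms] has_velocityD(2)[OF assms]
  have "index_integral \<gamma> d = (\<lambda>w. LINT t|lborel. d t / (w - indicator {0..1} t *\<^sub>R \<gamma> t))"
    using index_integral_restrict[OF assms] by auto
  also have "\<dots> \<in> borel_measurable borel" by measurable
  finally show ?thesis .
qed

lemma Fubini_bounded: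
  fixes f :: "'a::euclidean_space \<Rightarrow> 'b::euclidean_space \<Rightarrow> complex"
  assumes [measurable]: "case_prod f \<in> borel_measurable (borel \<Otimes>\<^sub>M borel)" "S \<in> sets borel" "T \<in> sets borel"
    and bound: "\<And>x y. norm (f x y) \<le> K"
    and supp: "\<And>x y. x \<notin> S \<or> y \<notin> T \<Longrightarrow> f x y = 0"
    and fin: "emeasure lborel S < \<infinity>" "emeasure lborel T < \<infinity>"
  shows "(LINT y|lborel. LINT x|lborel. f x y) = (LINT x|lborel. LINT y|lborel. f x y)"
    and "integrable lborel (\<lambda>x. LINT y|lborel. f x y)"
proof -
  have int: "integrable (lborel \<Otimes>\<^sub>M lborel) (case_prod f)"
  proof (rule integrableI_bounded_set[of "S \<times> T" _ _ K])
    show "emeasure (lborel \<Otimes>\<^sub>M lborel) (S \<times> T) < \<infinity>"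
      using fin by (subst lborel.emeasure_pair_measure_Times) (auto simp: ennreal_mult_less_top)
    show "AE z in lborel \<Otimes>\<^sub>M lborel. z \<in> S \<times> T \<longrightarrow> norm (case_prod f z) \<le> K"
      by (rule AE_I2) (use bound in auto)
    show "AE z in lborel \<Otimes>\<^sub>M lborel. z \<notin> S \<times> T \<longrightarrow> case_prod f z = 0"
      by (rule AE_I2) (use supp in auto)
  qed auto
  show "(LINT y|lborel. LINT x|lborel. f x y) = (LINT x|lborel. LINT y|lborel. f x y)"
    by (rule lborel_pair.Fubini_integral[OF int])
  show "integrable lborel (\<lambda>x. LINT y|lborel. f x y)"
    using lborel_pair.integrable_fst[OF int] .
qed

lemma piecewise_smooth_path_circlepath: "piecewise_smooth_path (circlepath z r)"
proof -
  define \<gamma>' where "\<gamma>' t = 2 * pi * \<i> * r * exp (2 * of_real pi * \<i> * of_real t)" for t :: real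
  have "continuous_on {0..1} \<gamma>'" unfolding \<gamma>'_def by (intro continuous_intros)
  moreover have "(circlepath z r has_vector_derivative \<gamma>' t) (at t within {0..1})" for t
    unfolding \<gamma>'_def by (rule has_vector_derivative_circlepath)
  ultimately have "\<exists>\<gamma>'. continuous_on {0..1} \<gamma>' \<and>
     (\<forall>t\<in>{0..1}. (circlepath z r has_vector_derivative \<gamma>' t) (at t within {0..1}))" by blast
  then show ?thesis
    unfolding piecewise_smooth_path_def
    by (intro conjI exI[of _ "[0, 1]"]) (auto simp: less_Suc_eq valid_path_imp_path)
qed

lemma winding_number_circlepath_off_sphere:
  assumes "r > 0" "dist w z \<noteq> r"
  shows "winding_number (circlepath z r) w = (if dist w z < r then 1 else 0)"
proof (cases "dist w z < r")
  case True
  then show ?thesis using winding_number_circlepath[of w z r] by (simp add: dist_norm)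
next
  case False
  have "winding_number (circlepath z r) w = 0"
    by (rule winding_number_zero_outside[of _ "cball z r"])
       (use assms False in \<open>auto simp: valid_path_imp_path dist_commute\<close>)
  with False show ?thesis by simp
qed

lemma index_integral_circlepath:
  assumes "has_velocity (circlepath 0 \<epsilon>) q' C" "\<epsilon> > 0" "norm w \<noteq> \<epsilon>"
  shows "index_integral (circlepath 0 \<epsilon>) q' w = - (2 * of_real pi * \<i>) * indicator (ball 0 \<epsilon>) w"
proof -
  have notin: "w \<notin> path_image (circlepath 0 \<epsilon>)" using assms by auto
  have "winding_number (circlepath 0 \<epsilon>) w = indicator (ball 0 \<epsilon>) w"
    using winding_number_circlepath_off_sphere[of \<epsilon> w 0] assms(2,3) by simp
  with has_velocity_winding_number[OF assms(1) notin] show ?thesis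
    by (simp add: index_integral_def)
qed

section \<open>Green's formula averaged over small discs\<close>

context
  fixes F :: "complex \<Rightarrow> complex" and B R :: real
  assumes F_meas [measurable]: "F \<in> borel_measurable borel"
    and F_bound: "\<And>w. norm (F w) \<le> B"
    and F_supp: "\<And>w. norm w > R \<Longrightarrow> F w = 0"
    and R_pos: "R \<ge> 0"
begin

text \<open>Fubini leaves the integral of the velocity against the kernel, which is the index of the
  path. The translation \<open>a\<close> is kept because it will run through minus the points of a
  small circle.\<close>

lemma cauchy_transform_path:
  assumes "has_velocity \<gamma> d C"
  shows "(LINT t|lborel. d t * cauchy_transform F (\<gamma> t - a))
       = (LINT w|lborel. F w * index_integral \<gamma> d (w + a))"
    and "integrable lborel (\<lambda>w. F w * index_integral \<gamma> d (w + a))"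
proof -
  note v = has_velocityD[OF assms]
  note [measurable] = has_velocity_measurable_restrict[OF assms]
  define p where "p t = indicator {0..1} t *\<^sub>R \<gamma> t - a" for t
  have p_meas: "p \<in> borel_measurable borel"
    unfolding p_def by measurable
  have "(LINT t|lborel. d t * cauchy_transform F (\<gamma> t - a)) = (LINT t|lborel. d t * cauchy_transform F (p t))"
    using v(4) by (intro Bochner_Integration.integral_cong) (auto simp: p_def indicator_def)
  also have "\<dots> = (LINT w|lborel. F w * (LINT t|lborel. d t / (w - p t)))"
    by (rule cauchy_transform_Fubini(1)[OF F_meas F_bound F_supp R_pos v(2) p_meas v(3,4)]) auto
  also have index: "(\<lambda>w. LINT t|lborel. d t / (w - p t)) = (\<lambda>w. index_integral \<gamma> d (w + a))"
    unfolding index_integral_restrict[OF assms] p_def by (simp add: algebra_simps)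
  finally show "(LINT t|lborel. d t * cauchy_transform F (\<gamma> t - a))
       = (LINT w|lborel. F w * index_integral \<gamma> d (w + a))" .
  have "integrable lborel (\<lambda>w. F w * (LINT t|lborel. d t / (w - p t)))"
    by (rule cauchy_transform_Fubini(2)[OF F_meas F_bound F_supp R_pos v(2) p_meas v(3,4)]) auto
  then show "integrable lborel (\<lambda>w. F w * index_integral \<gamma> d (w + a))"
    by (simp only: fun_cong[OF index])
qed

text \<open>Off the circle, which is a null set, the index of the circle is a multiple of the
  indicator of its disc. This amounts to Green's formula for the Cauchy transform on a disc,
  obtained without differentiating the transform.\<close>

lemma cauchy_transform_circle:
  assumes "has_velocity (circlepath 0 \<epsilon>) q' C" "\<epsilon> > 0"
  shows "(LINT s|lborel. q' s * cauchy_transform F (circlepath 0 \<epsilon> s + \<zeta>))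
       = - (2 * of_real pi * \<i>) * (LINT w:ball \<zeta> \<epsilon>|lborel. F w)"
proof -
  note [measurable] = measurable_index_integral[OF assms(1)]
  have "sphere \<zeta> \<epsilon> = (+) \<zeta> ` path_image (circlepath 0 \<epsilon>)"
    using assms(2) by (simp flip: sphere_translation)
  also have "\<dots> = {x. x - \<zeta> \<in> path_image (circlepath 0 \<epsilon>)}" by force
  also have "\<dots> \<in> null_sets lborel"
    by (intro null_sets_translation path_image_null_set[OF assms(1)])
  finally have null: "sphere \<zeta> \<epsilon> \<in> null_sets lborel" .
  have "(LINT s|lborel. q' s * cauchy_transform F (circlepath 0 \<epsilon> s + \<zeta>))
      = (LINT w|lborel. F w * index_integral (circlepath 0 \<epsilon>) q' (w - \<zeta>))"
    using cauchy_transform_path(1)[OF assms(1), of "- \<zeta>"] by simp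
  also have "\<dots> = (LINT w|lborel. - (2 * of_real pi * \<i>) * (indicator (ball \<zeta> \<epsilon>) w *\<^sub>R F w))"
  proof (rule integral_cong_AE)
    show "AE w in lborel. F w * index_integral (circlepath 0 \<epsilon>) q' (w - \<zeta>)
        = - (2 * of_real pi * \<i>) * (indicator (ball \<zeta> \<epsilon>) w *\<^sub>R F w)"
    proof (rule AE_I'[OF null], safe, rule ccontr)
      fix w assume *: "F w * index_integral (circlepath 0 \<epsilon>) q' (w - \<zeta>)
        \<noteq> - (2 * of_real pi * \<i>) * (indicator (ball \<zeta> \<epsilon>) w *\<^sub>R F w)" and "w \<notin> sphere \<zeta> \<epsilon>"
      then have "norm (w - \<zeta>) \<noteq> \<epsilon>" by (auto simp: dist_norm norm_minus_commute)
      from index_integral_circlepath[OF assms this] * show False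
        by (cases "dist \<zeta> w < \<epsilon>") (auto simp: dist_norm norm_minus_commute)
    qed
  qed measurable
  also have "\<dots> = - (2 * of_real pi * \<i>) * (LINT w:ball \<zeta> \<epsilon>|lborel. F w)"
    unfolding set_lebesgue_integral_def by (rule integral_mult_right_zero)
  finally show ?thesis .
qed

text \<open>The function \<open>f\<close> below, a product of both velocities and the Cauchy
  transform at \<open>circlepath 0 \<epsilon> s + \<gamma> t\<close>, is integrated in both orders:
  \<open>s\<close> first gives disc integrals of \<open>F\<close>, \<open>t\<close> first gives
  translated indices of \<open>\<gamma>\<close>. It is bounded and carried by a square, so the order
  is immaterial.\<close>

lemma path_integral_ball_average:
  assumes "has_velocity \<gamma> d C" "has_velocity (circlepath 0 \<epsilon>) q' D" "\<epsilon> > 0"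
  shows "- (2 * of_real pi * \<i>) * (LINT t|lborel. d t * (LINT w:ball (\<gamma> t) \<epsilon>|lborel. F w))
       = (LINT s|lborel. q' s * (LINT w|lborel. F w * index_integral \<gamma> d (w - circlepath 0 \<epsilon> s)))"
    and "integrable lborel
       (\<lambda>s. q' s * (LINT w|lborel. F w * index_integral \<gamma> d (w - circlepath 0 \<epsilon> s)))"
proof -
  let ?V = "cauchy_transform F"
  note [measurable] = has_velocity_measurable_restrict[OF assms(1)] has_velocityD(2)[OF assms(1)]
    has_velocity_measurable_restrict[OF assms(2)] has_velocityD(2)[OF assms(2)]
    measurable_cauchy_transform[OF F_meas F_bound F_supp R_pos]
  define f where "f s t = d t * (q' s * ?V (circlepath 0 \<epsilon> s + \<gamma> t))" for s t
  have f_eq: "f s t = d t * (q' s * ?V (indicator {0..1} s *\<^sub>R circlepath 0 \<epsilon> s + indicator {0..1} t *\<^sub>R \<gamma> t))"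
    for s t
    using has_velocityD(4)[OF assms(1), of t] has_velocityD(4)[OF assms(2), of s]
    by (auto simp: f_def indicator_def)
  have C: "C \<ge> 0" "D \<ge> 0"
    using order_trans[OF norm_ge_zero has_velocityD(3)] assms by blast+
  have f_meas: "case_prod f \<in> borel_measurable (borel \<Otimes>\<^sub>M borel)" unfolding f_eq by measurable
  have f_bound: "norm (f s t) \<le> C * (D * (B * (4 * pi + pi * R\<^sup>2)))" for s t
    unfolding f_def norm_mult
    using norm_cauchy_transform_le[OF F_meas F_bound F_supp R_pos] has_velocityD(3)[OF assms(1)]
       has_velocityD(3)[OF assms(2)] C
    by (intro mult_mono) auto
  have f_supp: "f s t = 0" if "s \<notin> {0..1} \<or> t \<notin> {0..1}" for s t
    using that has_velocityD(4)[OF assms(1), of t] has_velocityD(4)[OF assms(2), of s]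
    by (auto simp: f_def)
  note Fub = Fubini_bounded[OF f_meas _ _ f_bound f_supp, of "{0..1}" "{0..1}"]
  have f_t: "(LINT t|lborel. f s t)
      = q' s * (LINT w|lborel. F w * index_integral \<gamma> d (w - circlepath 0 \<epsilon> s))" for s
  proof -
    have "(LINT t|lborel. f s t) = q' s * (LINT t|lborel. d t * ?V (\<gamma> t - (- circlepath 0 \<epsilon> s)))"
      unfolding f_def
      by (subst integral_mult_right_zero[symmetric]) (simp add: mult_ac add.commute)
    then show ?thesis unfolding cauchy_transform_path(1)[OF assms(1)] by simp
  qed
  have "- (2 * of_real pi * \<i>) * (LINT t|lborel. d t * (LINT w:ball (\<gamma> t) \<epsilon>|lborel. F w))
      = (LINT t|lborel. d t * (- (2 * of_real pi * \<i>) * (LINT w:ball (\<gamma> t) \<epsilon>|lborel. F w)))"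
    by (subst integral_mult_right_zero[symmetric]) (simp add: mult_ac)
  also have "\<dots> = (LINT t|lborel. LINT s|lborel. f s t)"
    unfolding f_def cauchy_transform_circle[OF assms(2,3), symmetric] by simp
  also have "\<dots> = (LINT s|lborel. LINT t|lborel. f s t)"
    by (rule Fub(1)) auto
  finally show "- (2 * of_real pi * \<i>) * (LINT t|lborel. d t * (LINT w:ball (\<gamma> t) \<epsilon>|lborel. F w))
       = (LINT s|lborel. q' s * (LINT w|lborel. F w * index_integral \<gamma> d (w - circlepath 0 \<epsilon> s)))"
    unfolding f_t .
  have "integrable lborel (\<lambda>s. LINT t|lborel. f s t)"
    by (rule Fub(2)) auto
  then show "integrable lborel
       (\<lambda>s. q' s * (LINT w|lborel. F w * index_integral \<gamma> d (w - circlepath 0 \<epsilon> s)))"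
    unfolding f_t .
qed

text \<open>Summed over the cycle, the indices become a multiple of the indicator of
  \<open>U\<close>, and the common factor -2 pi i cancels. The left side, divided by the area of the
  disc, tends to the boundary integral of a continuous \<open>F\<close>; the right side then becomes
  an area integral of difference quotients.\<close>

lemma cycle_integral_ball_average:
  assumes "finite \<Gamma>" and vel: "\<And>\<gamma>. \<gamma> \<in> \<Gamma> \<Longrightarrow> has_velocity \<gamma> (d \<gamma>) (C \<gamma>)"
    and circ: "has_velocity (circlepath 0 \<epsilon>) q' D" and "\<epsilon> > 0"
    and U [measurable]: "U \<in> sets borel" and U_fin: "emeasure lborel U < \<infinity>"
    and index: "AE w in lborel. (\<Sum>\<gamma>\<in>\<Gamma>. index_integral \<gamma> (d \<gamma>) w) = - (2 * of_real pi * \<i>) * indicator U w"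
  shows "(\<Sum>\<gamma>\<in>\<Gamma>. LINT t|lborel. d \<gamma> t * (LINT w:ball (\<gamma> t) \<epsilon>|lborel. F w))
       = (LINT \<eta>:U|lborel. LINT s|lborel. q' s * F (\<eta> + circlepath 0 \<epsilon> s))"
proof -
  let ?c = "- (2 * of_real pi * \<i>) :: complex"
  let ?q = "circlepath 0 \<epsilon>"
  let ?I = "\<lambda>\<gamma>. index_integral \<gamma> (d \<gamma>)"
  note [measurable] = has_velocity_measurable_restrict[OF circ] has_velocityD(2)[OF circ]
  have I_meas [measurable]: "(\<lambda>w. \<Sum>\<gamma>\<in>\<Gamma>. ?I \<gamma> w) \<in> borel_measurable borel"
    using measurable_index_integral[OF vel] by (intro borel_measurable_sum) auto
  have shift: "(LINT w|lborel. g w) = (LINT w|lborel. g (a + w))"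
    if [measurable]: "g \<in> borel_measurable borel" for g :: "complex \<Rightarrow> complex" and a
  proof -
    have "(LINT w|lborel. g w) = (LINT w|distr lborel borel ((+) a). g w)"
      by (simp add: lborel_distr_plus)
    also have "\<dots> = (LINT w|lborel. g (a + w))" by (rule integral_distr) auto
    finally show ?thesis .
  qed
  define f where "f s \<eta> = q' s * (indicator U \<eta> *\<^sub>R F (\<eta> + ?q s))" for s \<eta>
  have f_eq: "f s \<eta> = q' s * (indicator U \<eta> *\<^sub>R F (\<eta> + indicator {0..1} s *\<^sub>R ?q s))" for s \<eta>
    using has_velocityD(4)[OF circ, of s] by (auto simp: f_def indicator_def)
  \<comment> \<open>Substituting \<open>a + w\<close> for \<open>w\<close> moves the translation
    from the index to \<open>F\<close>. The sum stands inside the integral because only the total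
    index of the cycle is known.\<close>
  have inner: "(LINT w|lborel. F w * (\<Sum>\<gamma>\<in>\<Gamma>. ?I \<gamma> (w - a)))
      = ?c * (LINT \<eta>|lborel. indicator U \<eta> *\<^sub>R F (\<eta> + a))" for a
  proof -
    have "(LINT w|lborel. F w * (\<Sum>\<gamma>\<in>\<Gamma>. ?I \<gamma> (w - a)))
        = (LINT w|lborel. F (a + w) * (\<Sum>\<gamma>\<in>\<Gamma>. ?I \<gamma> (a + w - a)))"
      by (rule shift) measurable
    also have "\<dots> = (LINT w|lborel. ?c * (indicator U w *\<^sub>R F (w + a)))"
    proof (rule integral_cong_AE)
      show "AE w in lborel. F (a + w) * (\<Sum>\<gamma>\<in>\<Gamma>. ?I \<gamma> (a + w - a)) = ?c * (indicator U w *\<^sub>R F (w + a))"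
        using index by eventually_elim (auto simp: indicator_def add.commute)
    qed (simp, measurable)
    also have "\<dots> = ?c * (LINT \<eta>|lborel. indicator U \<eta> *\<^sub>R F (\<eta> + a))"
      by (rule integral_mult_right_zero)
    finally show ?thesis .
  qed
  have "?c * (\<Sum>\<gamma>\<in>\<Gamma>. LINT t|lborel. d \<gamma> t * (LINT w:ball (\<gamma> t) \<epsilon>|lborel. F w))
      = (\<Sum>\<gamma>\<in>\<Gamma>. LINT s|lborel. q' s * (LINT w|lborel. F w * ?I \<gamma> (w - ?q s)))"
    unfolding sum_distrib_left
    by (intro sum.cong refl path_integral_ball_average(1)[OF vel circ \<open>\<epsilon> > 0\<close>])
  also have "\<dots> = (LINT s|lborel. (\<Sum>\<gamma>\<in>\<Gamma>. q' s * (LINT w|lborel. F w * ?I \<gamma> (w - ?q s))))"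
    by (intro Bochner_Integration.integral_sum[symmetric] path_integral_ball_average(2)[OF vel circ \<open>\<epsilon> > 0\<close>])
  also have "\<dots> = (LINT s|lborel. q' s * (LINT w|lborel. F w * (\<Sum>\<gamma>\<in>\<Gamma>. ?I \<gamma> (w - ?q s))))"
  proof (intro Bochner_Integration.integral_cong refl)
    fix s
    have "(LINT w|lborel. F w * (\<Sum>\<gamma>\<in>\<Gamma>. ?I \<gamma> (w - ?q s)))
        = (\<Sum>\<gamma>\<in>\<Gamma>. LINT w|lborel. F w * ?I \<gamma> (w - ?q s))"
      unfolding sum_distrib_left
      using cauchy_transform_path(2)[OF vel, of _ "- ?q s"]
      by (intro Bochner_Integration.integral_sum) auto
    then show "(\<Sum>\<gamma>\<in>\<Gamma>. q' s * (LINT w|lborel. F w * ?I \<gamma> (w - ?q s)))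
        = q' s * (LINT w|lborel. F w * (\<Sum>\<gamma>\<in>\<Gamma>. ?I \<gamma> (w - ?q s)))"
      by (simp add: sum_distrib_left)
  qed
  also have "\<dots> = (LINT s|lborel. ?c * (LINT \<eta>|lborel. f s \<eta>))"
    unfolding inner f_def by (subst integral_mult_right_zero) (simp only: mult.left_commute)
  also have "\<dots> = ?c * (LINT s|lborel. LINT \<eta>|lborel. f s \<eta>)"
    by (rule integral_mult_right_zero)
  \<comment> \<open>A second exchange, over the unit interval and \<open>U\<close>. The integrand is
    merely bounded, so finiteness of the area of \<open>U\<close> enters here.\<close>
  also have "(LINT s|lborel. LINT \<eta>|lborel. f s \<eta>) = (LINT \<eta>|lborel. LINT s|lborel. f s \<eta>)"
  proof (rule Fubini_bounded(1)[symmetric, of _ "{0..1}" U "D * B"])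
    show "case_prod f \<in> borel_measurable (borel \<Otimes>\<^sub>M borel)" unfolding f_eq by measurable
    have "0 \<le> D" "0 \<le> B"
      using order_trans[OF norm_ge_zero has_velocityD(3)[OF circ]] order_trans[OF norm_ge_zero F_bound] .
    then show "norm (f s \<eta>) \<le> D * B" for s \<eta>
      unfolding f_def norm_mult using has_velocityD(3)[OF circ] F_bound
      by (intro mult_mono) (auto simp: indicator_def)
    show "f s \<eta> = 0" if "s \<notin> {0..1} \<or> \<eta> \<notin> U" for s \<eta>
      using that has_velocityD(4)[OF circ, of s] by (auto simp: f_def)
  qed (use U_fin in auto)
  also have "(LINT \<eta>|lborel. LINT s|lborel. f s \<eta>)
      = (LINT \<eta>:U|lborel. LINT s|lborel. q' s * F (\<eta> + ?q s))"
    unfolding set_lebesgue_integral_def f_def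
    by (intro Bochner_Integration.integral_cong) (auto simp: indicator_def)
  finally show ?thesis by simp
qed

end

section \<open>Green's formula\<close>

lemma has_contour_integral_circle_powi:
  assumes "r > 0"
  shows "((\<lambda>w. w powi m) has_contour_integral (if m = -1 then 2 * of_real pi * \<i> else 0)) (circlepath 0 r)"
proof (cases "m = -1")
  case True
  have "((\<lambda>w. 1 / (w - 0)) has_contour_integral 2 * of_real pi * \<i>) (circlepath 0 r)"
    using contour_integral_circlepath[OF assms, of 0] has_contour_integral_integral[of "\<lambda>w. 1 / (w - 0)" "circlepath 0 r"]
      contour_integrable_continuous_circlepath[of 0 r "\<lambda>w. 1 / (w - 0)"] assms
    by (force intro!: continuous_intros)
  with True show ?thesis by (simp add: divide_inverse power_int_minus)
next
  case False
  have "((\<lambda>w. w powi m) has_contour_integral 0) (circlepath 0 r)"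
  proof (rule Cauchy_theorem_primitive)
    fix w :: complex assume "w \<in> - {0}"
    have nz: "(of_int (m + 1) :: complex) \<noteq> 0"
      using False by (simp only: of_int_eq_0_iff)
    show "((\<lambda>w. w powi (m + 1) / of_int (m + 1)) has_field_derivative w powi m) (at w within - {0})"
      using \<open>w \<in> - {0}\<close> nz by (auto intro!: derivative_eq_intros simp del: of_int_add)
  qed (use assms in auto)
  with False show ?thesis by simp
qed

lemma has_contour_integral_circle_monomial:
  assumes "r > 0"
  shows "((\<lambda>w. w ^ j * cnj w ^ k / w ^ n) has_contour_integral
     (if j + 1 = k + n then 2 * of_real pi * \<i> * of_real r ^ (2 * k) else 0)) (circlepath 0 r)"
proof -
  have "((\<lambda>w. of_real r ^ (2 * k) * w powi (int j - int k - int n)) has_contour_integral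
      of_real r ^ (2 * k) * (if int j - int k - int n = -1 then 2 * of_real pi * \<i> else 0)) (circlepath 0 r)"
    by (intro has_contour_integral_lmul has_contour_integral_circle_powi assms)
  then have "((\<lambda>w. w ^ j * cnj w ^ k / w ^ n) has_contour_integral
      of_real r ^ (2 * k) * (if int j - int k - int n = -1 then 2 * of_real pi * \<i> else 0)) (circlepath 0 r)"
  proof (rule has_contour_integral_eq)
    fix w assume "w \<in> path_image (circlepath 0 r)"
    then have w: "norm w = r" "w \<noteq> 0" using assms by auto
    then have "cnj w = of_real r ^ 2 / w"
      using complex_norm_square[of w] by (simp add: field_simps)
    then show "of_real r ^ (2 * k) * w powi (int j - int k - int n) = w ^ j * cnj w ^ k / w ^ n"
      using w by (simp add: power_int_diff power_divide power_mult)
  qed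
  then show ?thesis by (rule back_subst[where P = "\<lambda>x. (_ has_contour_integral x) _"]) auto
qed

text \<open>A constant integrates to 0 over a closed circle, so only the deviation of
  \<open>G\<close> from \<open>c\<close> counts.\<close>

lemma norm_circle_integral_le:
  assumes "continuous_on (sphere 0 r) G" "r > 0" "\<And>q. norm q = r \<Longrightarrow> norm (G q - c) \<le> \<delta>"
  shows "norm (contour_integral (circlepath 0 r) G) \<le> 2 * pi * r * \<delta>"
proof -
  have \<delta>: "\<delta> \<ge> 0" using assms(3)[of "of_real r"] assms(2) order_trans[OF norm_ge_zero] by force
  have "G contour_integrable_on circlepath 0 r"
    using assms by (intro contour_integrable_continuous_circlepath) auto
  \<comment> \<open>The constant is written as the power with exponent 0 so that the formula for
    powers applies.\<close>
  then have "((\<lambda>q. G q - c * q powi 0) has_contour_integral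
     contour_integral (circlepath 0 r) G - c * 0) (circlepath 0 r)"
    using has_contour_integral_circle_powi[OF assms(2), of 0]
    by (intro has_contour_integral_diff has_contour_integral_integral has_contour_integral_lmul) auto
  from has_contour_integral_bound_circlepath[OF this \<delta> assms(2)] assms(3)
  show ?thesis by (simp add: mult_ac)
qed

text \<open>The linear part \<open>a * q + b * cnj q\<close> integrates to 2 pi i r^2 b, and the
  remainder is at most \<open>\<delta> * r\<close> on a circle of length 2 pi r. The true derivative
  for \<open>a\<close>, \<open>b\<close> gives the pointwise limit; \<open>a = b = 0\<close> gives
  bounds by the oscillation of \<open>F\<close>.\<close>

lemma circle_integral_derivative_bound:
  assumes F: "continuous_on UNIV F" and "r > 0"
    and "\<And>q. norm q = r \<Longrightarrow> norm (F (\<eta> + q) - c - (a * q + b * cnj q)) \<le> \<delta> * r"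
  shows "norm (contour_integral (circlepath 0 r) (\<lambda>q. F (\<eta> + q)) / (of_real pi * of_real r ^ 2) - 2 * \<i> * b)
       \<le> 2 * \<delta>"
proof -
  let ?\<Phi> = "contour_integral (circlepath 0 r) (\<lambda>q. F (\<eta> + q))"
  have Fq: "continuous_on (sphere 0 r) (\<lambda>q. F (\<eta> + q))"
    by (rule continuous_on_compose2[OF F]) (auto intro!: continuous_intros)
  then have "(\<lambda>q. F (\<eta> + q)) contour_integrable_on circlepath 0 r"
    using assms by (intro contour_integrable_continuous_circlepath) auto
  from has_contour_integral_diff[OF has_contour_integral_integral[OF this]
    has_contour_integral_add[OF 
      has_contour_integral_lmul[OF has_contour_integral_circle_monomial[OF \<open>r > 0\<close>, of 1 0 0], of a]
      has_contour_integral_lmul[OF has_contour_integral_circle_monomial[OF \<open>r > 0\<close>, of 0 1 0], of b]]]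
  have *: "contour_integral (circlepath 0 r) (\<lambda>q. F (\<eta> + q) - (a * q + b * cnj q))
      = ?\<Phi> - b * (2 * of_real pi * \<i> * of_real r ^ 2)"
    by (intro contour_integral_unique) simp
  have "norm (contour_integral (circlepath 0 r) (\<lambda>q. F (\<eta> + q) - (a * q + b * cnj q))) \<le> 2 * pi * r * (\<delta> * r)"
    using assms by (intro norm_circle_integral_le[of _ _ c] continuous_intros Fq) (auto simp: algebra_simps)
  then have "norm (?\<Phi> - b * (2 * of_real pi * \<i> * of_real r ^ 2)) / (pi * r ^ 2) \<le> 2 * pi * r * (\<delta> * r) / (pi * r ^ 2)"
    unfolding * by (intro divide_right_mono) auto
  also have "\<dots> = 2 * \<delta>" using \<open>r > 0\<close> by (simp add: power2_eq_square)
  also have "norm (?\<Phi> - b * (2 * of_real pi * \<i> * of_real r ^ 2)) / (pi * r ^ 2)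
      = norm ((?\<Phi> - b * (2 * of_real pi * \<i> * of_real r ^ 2)) / (of_real pi * of_real r ^ 2))"
    by (simp add: norm_divide norm_mult norm_power)
  also have "(?\<Phi> - b * (2 * of_real pi * \<i> * of_real r ^ 2)) / (of_real pi * of_real r ^ 2)
      = ?\<Phi> / (of_real pi * of_real r ^ 2) - 2 * \<i> * b"
    using \<open>r > 0\<close> by (simp add: diff_divide_distrib)
  finally show ?thesis .
qed

section \<open>Continuous extensions and their disc averages\<close>

lemma ball_average_bound:
  fixes F :: "complex \<Rightarrow> complex"
  assumes F: "continuous_on UNIV F" and r: "r > 0"
    and bound: "\<And>w. w \<in> ball p r \<Longrightarrow> norm (F w - c) \<le> \<delta>"
  shows "norm ((LINT w:ball p r|lborel. F w) / (of_real pi * of_real r ^ 2) - c) \<le> \<delta>"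
proof -
  have meas: "measure lborel (ball p r) = pi * r\<^sup>2"
    using content_ball[of r p] unit_ball_vol_even[of 1] r by simp
  have fin: "emeasure lborel (ball p r) < \<infinity>"
    using emeasure_bounded_finite[of "ball p r"] by auto
  have int_cball: "set_integrable lborel (cball p r) G" if "continuous_on UNIV G" for G :: "complex \<Rightarrow> complex"
    unfolding set_integrable_def
    by (rule borel_integrable_compact) (auto intro: continuous_on_subset[OF that])
  have int: "set_integrable lborel (ball p r) G" if "continuous_on UNIV G" for G :: "complex \<Rightarrow> complex"
    by (rule set_integrable_subset[OF int_cball[OF that]]) auto
  have const: "(LINT w:ball p r|lborel. c) = of_real (pi * r\<^sup>2) * c"
    using fin by (simp add: set_lebesgue_integral_def meas scaleR_conv_of_real)
  have diff: "(LINT w:ball p r|lborel. F w) - of_real (pi * r\<^sup>2) * c = (LINT w:ball p r|lborel. F w - c)"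
    unfolding const[symmetric] by (intro set_integral_diff(2)[symmetric] int F continuous_intros)
  have "norm (LINT w:ball p r|lborel. F w - c) \<le> (LINT w|lborel. indicator (ball p r) w * \<delta>)"
    unfolding set_lebesgue_integral_def
  proof (rule Bochner_Integration.integral_norm_bound_integral)
    show "integrable lborel (\<lambda>w. indicator (ball p r) w *\<^sub>R (F w - c))"
      using int[OF continuous_on_diff[OF F continuous_on_const], of c] unfolding set_integrable_def .
    show "integrable lborel (\<lambda>w. indicator (ball p r) w * \<delta>)" using fin by auto
  qed (use bound in \<open>auto simp: indicator_def\<close>)
  also have "\<dots> = pi * r\<^sup>2 * \<delta>" by (simp add: meas)
  finally have "norm (LINT w:ball p r|lborel. F w - c) / (pi * r\<^sup>2) \<le> \<delta>"
    using r by (simp add: field_simps)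
  then have "norm ((LINT w:ball p r|lborel. F w) - of_real (pi * r\<^sup>2) * c) / (pi * r\<^sup>2) \<le> \<delta>"
    unfolding diff .
  also have "norm ((LINT w:ball p r|lborel. F w) - of_real (pi * r\<^sup>2) * c) / (pi * r\<^sup>2)
      = norm (((LINT w:ball p r|lborel. F w) - of_real (pi * r\<^sup>2) * c) / of_real (pi * r\<^sup>2))"
    by (simp add: norm_divide norm_mult norm_power)
  also have "((LINT w:ball p r|lborel. F w) - of_real (pi * r\<^sup>2) * c) / of_real (pi * r\<^sup>2)
      = (LINT w:ball p r|lborel. F w) / (of_real pi * of_real r ^ 2) - c"
    using r by (simp add: diff_divide_distrib)
  finally show ?thesis .
qed

lemma continuous_extension_compact_support:
  fixes f :: "complex \<Rightarrow> complex"
  assumes "compact S" "continuous_on S f"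
  obtains F B R where "continuous_on UNIV F" "\<And>x. x \<in> S \<Longrightarrow> F x = f x"
    "\<And>x. norm (F x) \<le> B" "\<And>x. norm x > R \<Longrightarrow> F x = 0" "R \<ge> 0"
proof -
  obtain R where R: "\<And>x. x \<in> S \<Longrightarrow> norm x \<le> R" "R > 0"
    using compact_imp_bounded[OF assms(1)] unfolding bounded_pos by blast
  obtain B where B: "\<And>x. x \<in> S \<Longrightarrow> norm (f x) \<le> B" "B > 0"
    using compact_imp_bounded[OF compact_continuous_image[OF assms(2,1)]] unfolding bounded_pos by auto
  obtain g where g: "continuous_on UNIV g" "\<And>x. x \<in> S \<Longrightarrow> g x = f x" "\<And>x. norm (g x) \<le> B"
    using Tietze[of S f UNIV B] assms compact_imp_closed[OF assms(1)] B by (auto simp: less_imp_le)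
  \<comment> \<open>The cutoff has values between 0 and 1, is 1 for \<open>norm x \<le> R\<close>
    and 0 from \<open>R + 1\<close> on, so the values on \<open>S\<close> and the bound
    \<open>B\<close> survive.\<close>
  define F where "F x = of_real (max 0 (min 1 (R + 1 - norm x))) * g x" for x
  show thesis
  proof
    show "continuous_on UNIV F" unfolding F_def using g(1) by (intro continuous_intros)
    show "F x = f x" if "x \<in> S" for x using R(1)[OF that] g(2)[OF that] by (simp add: F_def)
    show "norm (F x) \<le> B" for x
      using mult_mono[of "max 0 (min 1 (R + 1 - norm x))" 1 "norm (g x)" B] g(3)[of x] B(2)
      by (simp add: F_def norm_mult)
    show "F x = 0" if "norm x > R + 1" for x using that by (simp add: F_def)
    show "R + 1 \<ge> 0" using R(2) by simp
  qed
qed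

lemma ball_average_tendsto:
  fixes F :: "complex \<Rightarrow> complex"
  assumes F: "continuous_on UNIV F" and e: "e \<longlonglongrightarrow> 0" "\<And>n. e n > (0::real)"
  shows "(\<lambda>n. (LINT w:ball p (e n)|lborel. F w) / (of_real pi * of_real (e n) ^ 2)) \<longlonglongrightarrow> F p"
proof (rule LIMSEQ_I)
  fix \<delta> :: real assume "\<delta> > 0"
  have "isCont F p" using F by (simp add: continuous_on_eq_continuous_at)
  then obtain \<rho> where \<rho>: "\<rho> > 0" "\<And>w. dist w p < \<rho> \<Longrightarrow> dist (F w) (F p) < \<delta> / 2"
    using \<open>\<delta> > 0\<close> unfolding continuous_at_eps_delta by (meson half_gt_zero)
  obtain N where N: "\<And>n. n \<ge> N \<Longrightarrow> e n < \<rho>"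
    using order_tendstoD(2)[OF e(1) \<rho>(1)] unfolding eventually_sequentially by blast
  have "norm ((LINT w:ball p (e n)|lborel. F w) / (of_real pi * of_real (e n) ^ 2) - F p) < \<delta>" if "n \<ge> N" for n
  proof -
    have "norm ((LINT w:ball p (e n)|lborel. F w) / (of_real pi * of_real (e n) ^ 2) - F p) \<le> \<delta> / 2"
      using \<rho>(2) N[OF that]
      by (intro ball_average_bound[OF F e(2)]) (force simp: dist_norm norm_minus_commute less_imp_le)
    with \<open>\<delta> > 0\<close> show ?thesis by simp
  qed
  then show "\<exists>no. \<forall>n\<ge>no. norm ((LINT w:ball p (e n)|lborel. F w) / (of_real pi * of_real (e n) ^ 2) - F p) < \<delta>"
    by blast
qed

lemma path_integral_ball_average_tendsto:
  fixes F :: "complex \<Rightarrow> complex"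
  assumes vel: "has_velocity \<gamma> d C" and F: "continuous_on UNIV F" and F_bound: "\<And>w. norm (F w) \<le> B"
    and e: "e \<longlonglongrightarrow> 0" "\<And>n. e n > (0::real)"
  shows "(\<lambda>n. (LINT t|lborel. d t * (LINT w:ball (\<gamma> t) (e n)|lborel. F w)) / (of_real pi * of_real (e n) ^ 2))
     \<longlonglongrightarrow> contour_integral \<gamma> F"
proof -
  note v = has_velocityD[OF vel]
  note [measurable] = has_velocity_measurable_restrict[OF vel] v(2) borel_measurable_continuous_onI[OF F]
  define A where "A n p = (LINT w:ball p (e n)|lborel. F w) / (of_real pi * of_real (e n) ^ 2)" for n p
  have A_bound: "norm (A n p) \<le> B" for n p
    using ball_average_bound[OF F e(2), of p n 0 B] F_bound by (simp add: A_def)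
  have A_lim: "(\<lambda>n. A n p) \<longlonglongrightarrow> F p" for p
    unfolding A_def by (rule ball_average_tendsto[OF F e])
  \<comment> \<open>Expressing membership in the moving disc through \<open>dist\<close> exhibits
    the integrand as jointly measurable in \<open>p\<close> and \<open>w\<close>, whence
    \<open>A n\<close> is measurable.\<close>
  have A_eq: "A n p = (LINT w|lborel. (if dist p w < e n then F w else 0)) / (of_real pi * of_real (e n) ^ 2)" for n p
    unfolding A_def set_lebesgue_integral_def
    by (intro arg_cong2[where f = "(/)"] Bochner_Integration.integral_cong) (auto simp: indicator_def)
  have A_meas [measurable]: "A n \<in> borel_measurable borel" for n
    unfolding A_eq by measurable
  have C: "C \<ge> 0" using order_trans[OF norm_ge_zero v(3)] .
  have dA: "d t * G (\<gamma> t) = d t * G (indicator {0..1} t *\<^sub>R \<gamma> t)" for t and G :: "complex \<Rightarrow> complex"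
    using v(4)[of t] by (auto simp: indicator_def)
  have "(\<lambda>n. LINT t|lborel. d t * A n (\<gamma> t)) \<longlonglongrightarrow> (LINT t|lborel. d t * F (\<gamma> t))"
  proof (rule integral_dominated_convergence[where w = "\<lambda>t. C * B * indicator {0..1} t"])
    show "(\<lambda>t. d t * F (\<gamma> t)) \<in> borel_measurable lborel" unfolding dA[of _ F] by measurable
    show "(\<lambda>t. d t * A n (\<gamma> t)) \<in> borel_measurable lborel" for n unfolding dA[of _ "A n"] by measurable
    show "AE t in lborel. (\<lambda>n. d t * A n (\<gamma> t)) \<longlonglongrightarrow> d t * F (\<gamma> t)"
      by (intro AE_I2 tendsto_intros A_lim)
    show "AE t in lborel. norm (d t * A n (\<gamma> t)) \<le> C * B * indicator {0..1} t" for n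
    proof (rule AE_I2)
      fix t
      show "norm (d t * A n (\<gamma> t)) \<le> C * B * indicator {0..1} t"
        using v(3)[of t] v(4)[of t] A_bound[of n "\<gamma> t"] C
        by (cases "t \<in> {0..1}") (auto simp: norm_mult intro!: mult_mono)
    qed
  qed simp
  moreover have "(LINT t|lborel. d t * A n (\<gamma> t))
      = (LINT t|lborel. d t * (LINT w:ball (\<gamma> t) (e n)|lborel. F w)) / (of_real pi * of_real (e n) ^ 2)" for n
    unfolding A_def by simp
  moreover have "contour_integral \<gamma> F = (LINT t|lborel. d t * F (\<gamma> t))"
    by (rule has_velocity_contour_integral(1)[OF vel]) (rule continuous_on_subset[OF F], simp)
  ultimately show ?thesis by simp
qed

text \<open>The frontier is covered by curves of finite length, so its \<open>\<epsilon>\<close>-neighbourhood has area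
  \<open>O(\<epsilon>)\<close>; there the mean over a circle of radius \<open>\<epsilon>\<close> is only \<open>o(1/\<epsilon>)\<close>, which just suffices.
  Hence no differentiability of \<open>f\<close> up to the boundary is needed.\<close>

theorem Green_cycle:
  fixes f b :: "complex \<Rightarrow> complex"
  assumes "open U" "bounded U" "finite \<Gamma>"
    and smooth: "\<And>\<gamma>. \<gamma> \<in> \<Gamma> \<Longrightarrow> piecewise_smooth_path \<gamma>"
    and frontier: "(\<Union>\<gamma>\<in>\<Gamma>. path_image \<gamma>) = frontier U"
    and inside: "\<And>w. w \<in> U \<Longrightarrow> (\<Sum>\<gamma>\<in>\<Gamma>. winding_number \<gamma> w) = 1"
    and outside: "\<And>w. w \<notin> closure U \<Longrightarrow> (\<Sum>\<gamma>\<in>\<Gamma>. winding_number \<gamma> w) = 0"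
    and cont: "continuous_on (closure U) f"
    and deriv: "\<And>\<eta>. \<eta> \<in> U \<Longrightarrow> (f has_derivative (\<lambda>v. a \<eta> * v + b \<eta> * cnj v)) (at \<eta>)"
    and bound: "\<And>\<eta>. \<eta> \<in> U \<Longrightarrow> norm (a \<eta>) \<le> L" "\<And>\<eta>. \<eta> \<in> U \<Longrightarrow> norm (b \<eta>) \<le> L"
    and b_cont: "continuous_on U b"
  shows "boundary_integral \<Gamma> f = 2 * \<i> * (LINT \<eta>:U|lborel. b \<eta>)"
proof (cases "U = {}")
  case False
  then obtain \<eta>0 where "\<eta>0 \<in> U" by blast
  then have L: "L \<ge> 0" using bound(1) order_trans[OF norm_ge_zero] by blast
  have U [measurable]: "U \<in> sets borel" using \<open>open U\<close> by simp
  have U_fin: "emeasure lborel U < \<infinity>" using emeasure_bounded_finite[OF \<open>bounded U\<close>] by simp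
  obtain F B R where F: "continuous_on UNIV F" and Ff: "\<And>x. x \<in> closure U \<Longrightarrow> F x = f x"
    and F_bound: "\<And>x. norm (F x) \<le> B" and F_supp: "\<And>x. norm x > R \<Longrightarrow> F x = 0" and R: "R \<ge> 0"
    using continuous_extension_compact_support[OF _ cont] \<open>bounded U\<close> by (metis compact_closure)
  have F_meas [measurable]: "F \<in> borel_measurable borel"
    using borel_measurable_continuous_onI[OF F] .
  have "\<forall>\<gamma>\<in>\<Gamma>. \<exists>d C. has_velocity \<gamma> d C"
    using smooth piecewise_smooth_path_has_velocity by metis
  then obtain d C where vel: "\<And>\<gamma>. \<gamma> \<in> \<Gamma> \<Longrightarrow> has_velocity \<gamma> (d \<gamma>) (C \<gamma>)" by metis
  let ?P = "\<Union>\<gamma>\<in>\<Gamma>. path_image \<gamma>"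
  have P_null: "?P \<in> null_sets lborel"
    using path_image_null_set[OF vel] \<open>finite \<Gamma>\<close> by (intro null_sets_UN') (auto intro: countable_finite)
  \<comment> \<open>Off the curves the index integral is a winding number up to the factor, and such
    a point lies in \<open>U\<close> or outside its closure.\<close>
  have index: "AE w in lborel.
      (\<Sum>\<gamma>\<in>\<Gamma>. index_integral \<gamma> (d \<gamma>) w) = - (2 * of_real pi * \<i>) * indicator U w"
  proof (rule AE_I'[OF P_null], safe, rule ccontr)
    fix w assume *: "(\<Sum>\<gamma>\<in>\<Gamma>. index_integral \<gamma> (d \<gamma>) w) \<noteq> - (2 * of_real pi * \<i>) * indicator U w"
      and w: "w \<notin> ?P"
    have "(\<Sum>\<gamma>\<in>\<Gamma>. index_integral \<gamma> (d \<gamma>) w) = (\<Sum>\<gamma>\<in>\<Gamma>. - (2 * of_real pi * \<i>) * winding_number \<gamma> w)"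
      using has_velocity_winding_number[OF vel] w by (intro sum.cong) (auto simp: index_integral_def)
    also have "\<dots> = - (2 * of_real pi * \<i>) * (\<Sum>\<gamma>\<in>\<Gamma>. winding_number \<gamma> w)"
      by (simp only: sum_distrib_left)
    also have "(\<Sum>\<gamma>\<in>\<Gamma>. winding_number \<gamma> w) = indicator U w"
      using w inside[of w] outside[of w] \<open>open U\<close> unfolding frontier frontier_def
      by (auto simp: interior_open indicator_def)
    finally show False using * by simp
  qed
  \<comment> \<open>A sequence, as dominated convergence asks for, with values at most 1, as the
    tube bound asks for.\<close>
  define e where "e = (\<lambda>n. inverse (real (Suc n)))"
  have e: "e \<longlonglongrightarrow> 0" "\<And>n. e n > 0" "\<And>n. e n \<le> 1"
    unfolding e_def using LIMSEQ_inverse_real_of_nat by (auto simp: inverse_le_1_iff)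
  have "\<forall>n. \<exists>d C. has_velocity (circlepath 0 (e n)) d C"
    using piecewise_smooth_path_circlepath piecewise_smooth_path_has_velocity by metis
  then obtain q D where circ: "\<And>n. has_velocity (circlepath 0 (e n)) (q n) (D n)" by metis
  define \<Phi> where "\<Phi> n \<eta> = contour_integral (circlepath 0 (e n)) (\<lambda>v. F (\<eta> + v))" for n \<eta>
  have \<Phi>_eq: "\<Phi> n \<eta> = (LINT s|lborel. q n s * F (\<eta> + circlepath 0 (e n) s))" for n \<eta>
    unfolding \<Phi>_def
    by (intro has_velocity_contour_integral(1)[OF circ] continuous_on_compose2[OF F] continuous_intros) auto
  have \<Phi>_meas [measurable]: "\<Phi> n \<in> borel_measurable borel" for n
  proof -
    note [measurable] = has_velocity_measurable_restrict[OF circ] has_velocityD(2)[OF circ]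
    have "\<Phi> n = (\<lambda>\<eta>. LINT s|lborel. q n s * F (\<eta> + indicator {0..1} s *\<^sub>R circlepath 0 (e n) s))"
      unfolding \<Phi>_eq using has_velocityD(4)[OF circ]
      by (intro ext Bochner_Integration.integral_cong) (auto simp: indicator_def)
    then show ?thesis by simp
  qed
  \<comment> \<open>The averaged integrand on \<open>U\<close>: a difference quotient whose limit is
    \<open>2 * \<i> * b \<eta>\<close>.\<close>
  define \<psi> where "\<psi> n \<eta> = \<Phi> n \<eta> / (of_real pi * of_real (e n) ^ 2)" for n \<eta>
  have \<psi>_meas [measurable]: "\<psi> n \<in> borel_measurable borel" for n
    unfolding \<psi>_def by measurable
  have identity: "(\<Sum>\<gamma>\<in>\<Gamma>. LINT t|lborel. d \<gamma> t * (LINT w:ball (\<gamma> t) (e n)|lborel. F w))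
      / (of_real pi * of_real (e n) ^ 2) = (LINT \<eta>:U|lborel. \<psi> n \<eta>)" for n
    unfolding \<psi>_def \<Phi>_eq
    using cycle_integral_ball_average[OF F_meas F_bound F_supp R \<open>finite \<Gamma>\<close> vel circ e(2) U U_fin index]
    by simp
  have lhs: "(\<lambda>n. (LINT \<eta>:U|lborel. \<psi> n \<eta>)) \<longlonglongrightarrow> (\<Sum>\<gamma>\<in>\<Gamma>. contour_integral \<gamma> F)"
    unfolding identity[symmetric] sum_divide_distrib
    by (intro tendsto_sum path_integral_ball_average_tendsto[OF vel F F_bound e(1,2)])
  define T where "T n = (\<Union>\<gamma>\<in>\<Gamma>. {w. infdist w (path_image \<gamma>) \<le> e n})" for n
  have T_closed: "closed (T n)" for n
    unfolding T_def using \<open>finite \<Gamma>\<close>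
    by (intro closed_UN) (auto intro!: closed_Collect_le continuous_intros)
  then have T_meas [measurable]: "T n \<in> sets borel" for n by simp
  define K where "K = (\<Sum>\<gamma>\<in>\<Gamma>. 3 * pi * (C \<gamma> + 1)\<^sup>2)"
  have K: "K \<ge> 0" unfolding K_def by (intro sum_nonneg) auto
  have T_emeasure: "emeasure lborel (T n) \<le> ennreal (K * e n)" for n
  proof -
    have "emeasure lborel (T n) \<le> (\<Sum>\<gamma>\<in>\<Gamma>. emeasure lborel {w. infdist w (path_image \<gamma>) \<le> e n})"
      unfolding T_def using \<open>finite \<Gamma>\<close>
      by (intro emeasure_subadditive_finite)
        (auto intro!: borel_closed closed_Collect_le continuous_intros)
    also have "\<dots> \<le> (\<Sum>\<gamma>\<in>\<Gamma>. ennreal (3 * pi * (C \<gamma> + 1)\<^sup>2 * e n))"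
      by (intro sum_mono emeasure_tube_le[OF vel e(2,3)])
    also have "\<dots> = ennreal (K * e n)"
      using e(2)[of n] by (subst sum_ennreal) (auto simp: K_def sum_distrib_right)
    finally show ?thesis .
  qed
  \<comment> \<open>A connected set that meets \<open>U\<close> but is not contained in it meets the
    frontier; the meeting point would put \<open>\<eta>\<close> into the tube.\<close>
  have cball_U: "cball \<eta> (e n) \<subseteq> U" if "\<eta> \<in> U - T n" for \<eta> n
  proof (rule ccontr)
    assume "\<not> cball \<eta> (e n) \<subseteq> U"
    moreover have "\<eta> \<in> cball \<eta> (e n) \<inter> U" using that e(2)[of n] by simp
    ultimately have "cball \<eta> (e n) \<inter> frontier U \<noteq> {}"
      using connected_Int_frontier[OF connected_cball, of \<eta> "e n" U] by blast
    then obtain y \<gamma> where y: "dist \<eta> y \<le> e n" "\<gamma> \<in> \<Gamma>" "y \<in> path_image \<gamma>"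
      unfolding frontier[symmetric] by auto
    then have "infdist \<eta> (path_image \<gamma>) \<le> e n" using infdist_le order_trans by blast
    with y that show False by (auto simp: T_def)
  qed
  have F_deriv: "(F has_derivative (\<lambda>v. a \<eta> * v + b \<eta> * cnj v)) (at \<eta>)" if "\<eta> \<in> U" for \<eta>
  proof (rule has_derivative_transform_within_open[OF deriv[OF that] \<open>open U\<close> that])
    show "f x = F x" if "x \<in> U" for x using Ff[of x] closure_subset[of U] that by auto
  qed
  \<comment> \<open>Outside the tube the whole disc lies in \<open>U\<close>, so the mean value
    inequality with operator norm at most \<open>2 * L\<close> bounds the oscillation of
    \<open>F\<close>; the circle estimate with zero derivative doubles the constant.\<close>
  have \<psi>_bound: "norm (\<psi> n \<eta>) \<le> 4 * L" if "\<eta> \<in> U - T n" for n \<eta>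
  proof -
    have "norm (F (\<eta> + v) - F \<eta> - (0 * v + 0 * cnj v)) \<le> 2 * L * e n" if v: "norm v = e n" for v
    proof -
      have "norm (F (\<eta> + v) - F \<eta>) \<le> 2 * L * norm (\<eta> + v - \<eta>)"
      proof (rule differentiable_bound[of "cball \<eta> (e n)"])
        show "(F has_derivative (\<lambda>v. a x * v + b x * cnj v)) (at x within cball \<eta> (e n))"
          if "x \<in> cball \<eta> (e n)" for x
          using F_deriv cball_U[OF \<open>\<eta> \<in> U - T n\<close>] that by (blast intro: has_derivative_at_withinI)
        show "onorm (\<lambda>v. a x * v + b x * cnj v) \<le> 2 * L" if "x \<in> cball \<eta> (e n)" for x
        proof (rule onorm_bound)
          have "x \<in> U" using cball_U[OF \<open>\<eta> \<in> U - T n\<close>] that by blast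
          then have "norm (a x * v) \<le> L * norm v" "norm (b x * cnj v) \<le> L * norm v" for v
            using bound by (auto simp: norm_mult intro: mult_right_mono)
          then show "norm (a x * v + b x * cnj v) \<le> 2 * L * norm v" for v
            using norm_triangle_ineq[of "a x * v" "b x * cnj v"]
            by (smt (verit, best) mult_2 distrib_right)
        qed (use L in simp)
        show "\<eta> + v \<in> cball \<eta> (e n)" using v by (simp add: dist_norm)
      qed (use e(2)[of n] in auto)
      with v show ?thesis by simp
    qed
    from circle_integral_derivative_bound[OF F e(2) this] show ?thesis
      by (simp add: \<psi>_def \<Phi>_def)
  qed
  have \<psi>_lim: "(\<lambda>n. \<psi> n \<eta>) \<longlonglongrightarrow> 2 * \<i> * b \<eta>" if \<eta>: "\<eta> \<in> U" for \<eta>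
  proof (rule LIMSEQ_I)
    fix \<delta> :: real assume "\<delta> > 0"
    obtain \<rho> where \<rho>: "\<rho> > 0" "\<And>y. norm (y - \<eta>) < \<rho> \<Longrightarrow>
        norm (F y - F \<eta> - (a \<eta> * (y - \<eta>) + b \<eta> * cnj (y - \<eta>))) \<le> \<delta> / 4 * norm (y - \<eta>)"
      using F_deriv[OF \<eta>] \<open>\<delta> > 0\<close> unfolding has_derivative_at_alt
      by (meson divide_pos_pos zero_less_numeral)
    obtain N where N: "\<And>n. n \<ge> N \<Longrightarrow> e n < \<rho>"
      using order_tendstoD(2)[OF e(1) \<rho>(1)] unfolding eventually_sequentially by blast
    have "norm (\<psi> n \<eta> - 2 * \<i> * b \<eta>) < \<delta>" if "n \<ge> N" for n
    proof -
      have "norm (\<psi> n \<eta> - 2 * \<i> * b \<eta>) \<le> 2 * (\<delta> / 4)"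
        unfolding \<psi>_def \<Phi>_def
      proof (rule circle_integral_derivative_bound[OF F e(2)])
        show "norm (F (\<eta> + v) - F \<eta> - (a \<eta> * v + b \<eta> * cnj v)) \<le> \<delta> / 4 * e n" if "norm v = e n" for v
          using \<rho>(2)[of "\<eta> + v"] N[OF \<open>n \<ge> N\<close>] that by simp
      qed
      with \<open>\<delta> > 0\<close> show ?thesis by simp
    qed
    then show "\<exists>no. \<forall>n\<ge>no. norm (\<psi> n \<eta> - 2 * \<i> * b \<eta>) < \<delta>" by blast
  qed
  have b_meas: "(\<lambda>\<eta>. indicator U \<eta> *\<^sub>R b \<eta>) \<in> borel_measurable borel"
    by (rule borel_measurable_continuous_on_indicator[OF U b_cont])
  \<comment> \<open>\<open>g\<close> lives off the tube, where the quotients are dominated;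
    \<open>h\<close> lives in the tube, where no uniform bound is available but the area is
    small.\<close>
  define g where "g n = (\<lambda>\<eta>. indicator (U - T n) \<eta> *\<^sub>R \<psi> n \<eta>)" for n
  define h where "h n = (\<lambda>\<eta>. indicator (U \<inter> T n) \<eta> *\<^sub>R \<psi> n \<eta>)" for n
  have gh_meas [measurable]: "g n \<in> borel_measurable borel" "h n \<in> borel_measurable borel" for n
    unfolding g_def h_def by measurable
  have int_U: "integrable lborel (indicator U :: complex \<Rightarrow> real)" using U_fin by simp
  have g_bound: "norm (g n \<eta>) \<le> 4 * L * indicator U \<eta>" for n \<eta>
    using \<psi>_bound[of \<eta> n] L by (auto simp: g_def indicator_def)
  have g_int: "integrable lborel (g n)" for n
    by (rule Bochner_Integration.integrable_bound[OF integrable_mult_right[OF int_U, of "4 * L"]])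
      (use g_bound L in \<open>auto intro!: AE_I2\<close>)
  have "(\<lambda>n. LINT \<eta>|lborel. g n \<eta>) \<longlonglongrightarrow> (LINT \<eta>|lborel. 2 * \<i> * (indicator U \<eta> *\<^sub>R b \<eta>))"
  proof (rule integral_dominated_convergence[where w = "\<lambda>\<eta>. 4 * L * indicator U \<eta>"])
    show "(\<lambda>\<eta>. 2 * \<i> * (indicator U \<eta> *\<^sub>R b \<eta>)) \<in> borel_measurable lborel"
      using b_meas by (intro borel_measurable_times) auto
    show "AE \<eta> in lborel. (\<lambda>n. g n \<eta>) \<longlonglongrightarrow> 2 * \<i> * (indicator U \<eta> *\<^sub>R b \<eta>)"
    proof (rule AE_I2)
      fix \<eta>
      show "(\<lambda>n. g n \<eta>) \<longlonglongrightarrow> 2 * \<i> * (indicator U \<eta> *\<^sub>R b \<eta>)"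
      proof (cases "\<eta> \<in> U")
        case True
        \<comment> \<open>A fixed point of \<open>U\<close> has positive distance from the frontier
          and therefore leaves the shrinking tubes.\<close>
        obtain \<rho> where \<rho>: "\<rho> > 0" "ball \<eta> \<rho> \<subseteq> U" using \<open>open U\<close> True by (auto simp: open_contains_ball)
        have "\<forall>\<^sub>F n in sequentially. \<eta> \<notin> T n"
          using order_tendstoD(2)[OF e(1) \<rho>(1)]
        proof eventually_elim
          case (elim n)
          show ?case
          proof
            assume "\<eta> \<in> T n"
            then obtain \<gamma> where \<gamma>: "\<gamma> \<in> \<Gamma>" "infdist \<eta> (path_image \<gamma>) \<le> e n" by (auto simp: T_def)
            have "valid_path \<gamma>" by (rule has_velocity_imp_valid_path[OF vel[OF \<gamma>(1)]])
            then have "closed (path_image \<gamma>)" "path_image \<gamma> \<noteq> {}"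
              by (auto intro: closed_path_image valid_path_imp_path)
            then obtain y where y: "y \<in> path_image \<gamma>" "infdist \<eta> (path_image \<gamma>) = dist \<eta> y"
              by (rule infdist_attains_inf)
            with \<gamma> elim \<rho> have "y \<in> U" by auto
            moreover have "y \<in> frontier U" using y \<gamma> frontier by blast
            ultimately show False using \<open>open U\<close> by (simp add: frontier_def interior_open)
          qed
        qed
        then have "\<forall>\<^sub>F n in sequentially. \<psi> n \<eta> = g n \<eta>"
          by eventually_elim (simp add: g_def True)
        from Lim_transform_eventually[OF \<psi>_lim[OF True] this] True show ?thesis by simp
      qed (simp add: g_def)
    qed
    show "AE \<eta> in lborel. norm (g n \<eta>) \<le> 4 * L * indicator U \<eta>" for n
      using g_bound by (intro AE_I2)
  qed (use int_U in auto)
  then have g_lim: "(\<lambda>n. LINT \<eta>|lborel. g n \<eta>) \<longlonglongrightarrow> 2 * \<i> * (LINT \<eta>:U|lborel. b \<eta>)"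
    unfolding set_lebesgue_integral_def integral_mult_right_zero .
  \<comment> \<open>No derivative of \<open>F\<close> is used here, so the bound also holds in the
    tube; the price is the factor \<open>1 / e n\<close>.\<close>
  have \<psi>_osc: "norm (\<psi> n \<eta>) \<le> 2 * \<omega> / e n"
    if "\<And>v. norm v = e n \<Longrightarrow> norm (F (\<eta> + v) - F \<eta>) \<le> \<omega>" for n \<eta> \<omega>
    using circle_integral_derivative_bound[OF F e(2)[of n], of \<eta> "F \<eta>" 0 0 "\<omega> / e n"] that e(2)[of n]
    by (simp add: \<psi>_def \<Phi>_def)
  have h_int: "integrable lborel (h n)" for n
  proof -
    \<comment> \<open>The crude oscillation \<open>2 * B\<close> gives a bound that depends on
      \<open>n\<close>; it serves only for integrability of \<open>h n\<close>.\<close>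
    have "norm (F (\<eta> + v) - F \<eta>) \<le> 2 * B" for \<eta> v
      using norm_triangle_ineq4[of "F (\<eta> + v)" "F \<eta>"] F_bound[of \<eta>] F_bound[of "\<eta> + v"] by linarith
    then have "norm (\<psi> n \<eta>) \<le> 2 * (2 * B) / e n" for \<eta> by (intro \<psi>_osc)
    then obtain M where M: "\<And>\<eta>. norm (\<psi> n \<eta>) \<le> M" by blast
    then have "M \<ge> 0" using order_trans[OF norm_ge_zero] by blast
    with M show ?thesis
      by (intro Bochner_Integration.integrable_bound[OF integrable_mult_right[OF int_U, of M]] AE_I2)
         (auto simp: h_def indicator_def)
  qed
  have h_lim: "(\<lambda>n. LINT \<eta>|lborel. h n \<eta>) \<longlonglongrightarrow> 0"
  proof (rule LIMSEQ_I)
    fix \<delta> :: real assume "\<delta> > 0"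
    \<comment> \<open>The integral of \<open>h n\<close> is at most
      \<open>K * e n * (2 * \<omega> / e n)\<close>: the powers of \<open>e n\<close> cancel and
      leave \<open>2 * \<omega> * K\<close>. Dividing by \<open>K + 1\<close> avoids division by 0
      and makes this less than \<open>\<delta>\<close>.\<close>
    define \<omega> where "\<omega> = \<delta> / (2 * (K + 1))"
    have \<omega>: "\<omega> > 0" using \<open>\<delta> > 0\<close> K by (simp add: \<omega>_def)
    obtain M where M: "\<And>\<eta>. \<eta> \<in> U \<Longrightarrow> norm \<eta> \<le> M"
      using \<open>bounded U\<close> unfolding bounded_iff by blast
    \<comment> \<open>Circles of radius at most 1 around points of \<open>U\<close> stay in this
      compact disc.\<close>
    have "uniformly_continuous_on (cball 0 (M + 1)) F"
      by (intro compact_uniformly_continuous continuous_on_subset[OF F]) auto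
    then obtain \<rho> where \<rho>: "\<rho> > 0" "\<And>x y. x \<in> cball 0 (M + 1) \<Longrightarrow> y \<in> cball 0 (M + 1) \<Longrightarrow>
        dist y x < \<rho> \<Longrightarrow> dist (F y) (F x) < \<omega>"
      using \<omega> unfolding uniformly_continuous_on_def by metis
    obtain N where N: "\<And>n. n \<ge> N \<Longrightarrow> e n < \<rho>"
      using order_tendstoD(2)[OF e(1) \<rho>(1)] unfolding eventually_sequentially by blast
    have "norm (LINT \<eta>|lborel. h n \<eta>) < \<delta>" if "n \<ge> N" for n
    proof -
      have osc: "norm (F (\<eta> + v) - F \<eta>) \<le> \<omega>" if "\<eta> \<in> U" "norm v = e n" for \<eta> v
      proof -
        have "norm (\<eta> + v) \<le> M + 1"
          using norm_triangle_ineq[of \<eta> v] M[OF \<open>\<eta> \<in> U\<close>] that(2) e(3)[of n] by linarith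
        moreover have "norm \<eta> \<le> M + 1" using M[OF \<open>\<eta> \<in> U\<close>] by simp
        ultimately have mem: "\<eta> \<in> cball 0 (M + 1)" "\<eta> + v \<in> cball 0 (M + 1)"
          by (simp_all only: mem_cball_0)
        have "dist (F (\<eta> + v)) (F \<eta>) < \<omega>"
          using N[OF \<open>n \<ge> N\<close>] that(2) by (intro \<rho>(2)[OF mem]) (simp add: dist_norm)
        then show ?thesis by (simp add: dist_norm)
      qed
      have TU_fin: "emeasure lborel (U \<inter> T n) < \<infinity>"
        using emeasure_mono[of "U \<inter> T n" U lborel] U_fin by (auto intro: le_less_trans)
      have "emeasure lborel (U \<inter> T n) \<le> ennreal (K * e n)"
        using emeasure_mono[of "U \<inter> T n" "T n" lborel] T_emeasure[of n] by (auto intro: order_trans)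
      then have TU: "measure lborel (U \<inter> T n) \<le> K * e n"
        unfolding measure_def using K e(2)[of n] by (intro enn2real_leI) auto
      have "norm (LINT \<eta>|lborel. h n \<eta>) \<le> (LINT \<eta>|lborel. indicator (U \<inter> T n) \<eta> * (2 * \<omega> / e n))"
      proof (rule Bochner_Integration.integral_norm_bound_integral[OF h_int])
        show "integrable lborel (\<lambda>\<eta>. indicator (U \<inter> T n) \<eta> * (2 * \<omega> / e n))"
          using TU_fin by (intro integrable_mult_left) auto
        show "norm (h n \<eta>) \<le> indicator (U \<inter> T n) \<eta> * (2 * \<omega> / e n)" for \<eta>
          using \<psi>_osc[of n \<eta> \<omega>, OF osc] by (auto simp: h_def indicator_def)
      qed
      also have "\<dots> = measure lborel (U \<inter> T n) * (2 * \<omega> / e n)" by simp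
      also have "\<dots> \<le> K * e n * (2 * \<omega> / e n)"
        using TU \<omega> e(2)[of n] by (intro mult_right_mono) auto
      also have "\<dots> = 2 * \<omega> * (K + 1) - 2 * \<omega>" using e(2)[of n] by (simp add: algebra_simps)
      also have "2 * \<omega> * (K + 1) = \<delta>"
      proof -
        have "2 * (\<delta> / (2 * k)) * k = \<delta>" if "k > 0" for k using that by simp
        from this[of "K + 1"] show ?thesis using K unfolding \<omega>_def by simp
      qed
      also have "\<delta> - 2 * \<omega> < \<delta>" using \<omega> by simp
      finally show ?thesis .
    qed
    then show "\<exists>no. \<forall>n\<ge>no. norm ((LINT \<eta>|lborel. h n \<eta>) - 0) < \<delta>" by auto
  qed
  have split: "(LINT \<eta>:U|lborel. \<psi> n \<eta>) = (LINT \<eta>|lborel. g n \<eta>) + (LINT \<eta>|lborel. h n \<eta>)" for n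
  proof -
    have "(LINT \<eta>:U|lborel. \<psi> n \<eta>) = (LINT \<eta>|lborel. g n \<eta> + h n \<eta>)"
      unfolding set_lebesgue_integral_def
      by (intro Bochner_Integration.integral_cong) (auto simp: g_def h_def indicator_def)
    also have "\<dots> = (LINT \<eta>|lborel. g n \<eta>) + (LINT \<eta>|lborel. h n \<eta>)"
      by (rule Bochner_Integration.integral_add[OF g_int h_int])
    finally show ?thesis .
  qed
  have "(\<lambda>n. (LINT \<eta>:U|lborel. \<psi> n \<eta>)) \<longlonglongrightarrow> 2 * \<i> * (LINT \<eta>:U|lborel. b \<eta>) + 0"
    unfolding split by (intro tendsto_add g_lim h_lim)
  with lhs have "(\<Sum>\<gamma>\<in>\<Gamma>. contour_integral \<gamma> F) = 2 * \<i> * (LINT \<eta>:U|lborel. b \<eta>)"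
    using LIMSEQ_unique by fastforce
  moreover have "contour_integral \<gamma> F = contour_integral \<gamma> f" if "\<gamma> \<in> \<Gamma>" for \<gamma>
    using that frontier Ff by (intro contour_integral_cong) (auto simp: frontier_def)
  ultimately show ?thesis by (simp add: boundary_integral_def)
next
  \<comment> \<open>Treated apart because the sign of \<open>L\<close> was read off at a point of
    \<open>U\<close>. The frontier is empty, and since path images are nonempty there are no
    curves.\<close>
  case True
  then have "\<Gamma> = {}" using frontier by (auto simp: path_image_nonempty)
  with True show ?thesis by (simp add: boundary_integral_def set_lebesgue_integral_def)
qed

section \<open>Taylor expansion in Wirtinger derivatives\<close>

text \<open>The derivative in direction \<open>u\<close> is \<open>a * u + b * cnj u\<close>; the
  directions 1 and \<i> give both partial derivatives, from which \<open>a\<close> and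
  \<open>b\<close> are recovered.\<close>

lemma wirtinger_eqI:
  assumes "(f has_derivative (\<lambda>v. a * v + b * cnj v)) (at \<zeta>)"
  shows "wirtinger f \<zeta> = a" "wirtinger_bar f \<zeta> = b"
proof -
  have *: "((\<lambda>t::real. f (\<zeta> + u * of_real t)) has_vector_derivative a * u + b * cnj u) (at 0)" for u
  proof -
    have "((\<lambda>t::real. \<zeta> + u * of_real t) has_derivative (\<lambda>t. u * of_real t)) (at 0)"
      by (auto intro!: derivative_eq_intros)
    from has_derivative_compose[OF this, of f "\<lambda>v. a * v + b * cnj v"] assms
    have "((\<lambda>t::real. f (\<zeta> + u * of_real t)) has_derivative
        (\<lambda>t. a * (u * of_real t) + b * cnj (u * of_real t))) (at 0)" by simp
    then show ?thesis
      unfolding has_vector_derivative_def by (simp add: scaleR_conv_of_real algebra_simps)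
  qed
  have xi: "partial_xi f \<zeta> = a + b"
    unfolding partial_xi_def using *[of 1] by (intro vector_derivative_at) simp
  have eta: "partial_eta f \<zeta> = \<i> * a - \<i> * b"
    unfolding partial_eta_def using *[of \<i>] by (intro vector_derivative_at) (simp add: algebra_simps)
  show "wirtinger f \<zeta> = a" "wirtinger_bar f \<zeta> = b"
    unfolding wirtinger_def wirtinger_bar_def xi eta by (simp_all add: algebra_simps)
qed

text \<open>The smoothness class in the form used by the inductions: total derivatives, coefficients
  given by the operators themselves in place of existential witnesses, and recursion into both
  operators, so that words in them may be taken in any order.\<close>

primrec wirtinger_smooth :: "nat \<Rightarrow> complex set \<Rightarrow> (complex \<Rightarrow> complex) \<Rightarrow> bool" where
  "wirtinger_smooth 0 U f \<longleftrightarrow> continuous_on U f"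
| "wirtinger_smooth (Suc m) U f \<longleftrightarrow>
     (\<forall>\<zeta>\<in>U. (f has_derivative (\<lambda>v. wirtinger f \<zeta> * v + wirtinger_bar f \<zeta> * cnj v)) (at \<zeta>)) \<and>
     wirtinger_smooth m U (wirtinger f) \<and> wirtinger_smooth m U (wirtinger_bar f)"

lemma wirtinger_cong:
  assumes "open U" "\<And>x. x \<in> U \<Longrightarrow> f x = g x" "x \<in> U"
  shows "wirtinger f x = wirtinger g x" "wirtinger_bar f x = wirtinger_bar g x"
proof -
  have "vector_derivative (\<lambda>t::real. f (x + u * of_real t)) (at 0)
      = vector_derivative (\<lambda>t::real. g (x + u * of_real t)) (at 0)" for u
  proof (rule vector_derivative_cong_eq)
    have "open ((\<lambda>t::real. x + u * of_real t) -` U)"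
      by (intro open_vimage assms(1) continuous_intros)
    then have "\<forall>\<^sub>F t in nhds 0. t \<in> (\<lambda>t::real. x + u * of_real t) -` U"
      using assms(3) by (intro eventually_nhds_in_open) auto
    then have "\<forall>\<^sub>F t in nhds (0::real). x + u * of_real t \<in> U" by simp
    then show "\<forall>\<^sub>F t in nhds (0::real). t \<in> UNIV \<longrightarrow> f (x + u * of_real t) = g (x + u * of_real t)"
      by eventually_elim (auto intro: assms(2))
  qed auto
  from this[of 1] this[of \<i>] show "wirtinger f x = wirtinger g x" "wirtinger_bar f x = wirtinger_bar g x"
    by (simp_all add: wirtinger_def wirtinger_bar_def partial_xi_def partial_eta_def)
qed

lemma wirtinger_smooth_cong:
  assumes "open U" "\<And>x. x \<in> U \<Longrightarrow> f x = g x" "wirtinger_smooth m U f"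
  shows "wirtinger_smooth m U g"
  using assms(2,3)
proof (induction m arbitrary: f g)
  case 0
  then show ?case using continuous_on_eq by auto
next
  case (Suc m)
  have eq: "wirtinger f x = wirtinger g x" "wirtinger_bar f x = wirtinger_bar g x" if "x \<in> U" for x
    using wirtinger_cong[OF assms(1) Suc.prems(1) that] by auto
  have "(g has_derivative (\<lambda>v. wirtinger g \<zeta> * v + wirtinger_bar g \<zeta> * cnj v)) (at \<zeta>)" if "\<zeta> \<in> U" for \<zeta>
  proof -
    have "(f has_derivative (\<lambda>v. wirtinger f \<zeta> * v + wirtinger_bar f \<zeta> * cnj v)) (at \<zeta>)"
      using Suc.prems(2) that by simp
    then show ?thesis
      unfolding eq[OF that, symmetric]
      by (rule has_derivative_transform_within_open[OF _ assms(1) that Suc.prems(1)])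
  qed
  moreover have "wirtinger_smooth m U (wirtinger g)"
    by (rule Suc.IH[of "wirtinger f"]) (use eq Suc.prems(2) in simp_all)
  moreover have "wirtinger_smooth m U (wirtinger_bar g)"
    by (rule Suc.IH[of "wirtinger_bar f"]) (use eq Suc.prems(2) in simp_all)
  ultimately show ?case by simp
qed

lemma wirtinger_smooth_imp_continuous:
  assumes "wirtinger_smooth m U f" shows "continuous_on U f"
proof (cases m)
  case (Suc n)
  with assms show ?thesis
    by (auto intro!: continuous_at_imp_continuous_on has_derivative_continuous)
qed (use assms in simp)

lemma wirtinger_smooth_SucD: "wirtinger_smooth (Suc m) U f \<Longrightarrow> wirtinger_smooth m U f"
proof (induction m arbitrary: f)
  case 0
  then show ?case using wirtinger_smooth_imp_continuous by fastforce
next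
  case (Suc m)
  have "wirtinger_smooth (Suc m) U (wirtinger f)" "wirtinger_smooth (Suc m) U (wirtinger_bar f)"
    using Suc.prems unfolding wirtinger_smooth.simps(2)[of "Suc m"] by blast+
  then have "wirtinger_smooth m U (wirtinger f)" "wirtinger_smooth m U (wirtinger_bar f)"
    by (simp_all only: Suc.IH)
  then show ?case
    using Suc.prems unfolding wirtinger_smooth.simps(2)[of "Suc m"] wirtinger_smooth.simps(2)[of m] by blast
qed

lemma wirtinger_smooth_mono:
  assumes "wirtinger_smooth m U f" "k \<le> m"
  shows "wirtinger_smooth k U f"
  using assms(2,1)
proof (induction rule: dec_induct)
  case (step n)
  then show ?case using wirtinger_smooth_SucD by blast
qed

lemma wirtinger_smooth_linear_combination:
  assumes "open U" "wirtinger_smooth m U f" "wirtinger_smooth m U g"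
  shows "wirtinger_smooth m U (\<lambda>x. c * f x + d * g x)"
  using assms(2,3)
proof (induction m arbitrary: f g)
  case 0
  then show ?case by (auto intro!: continuous_intros)
next
  case (Suc m)
  let ?h = "\<lambda>x. c * f x + d * g x"
  have D: "(?h has_derivative (\<lambda>v. (c * wirtinger f \<zeta> + d * wirtinger g \<zeta>) * v
      + (c * wirtinger_bar f \<zeta> + d * wirtinger_bar g \<zeta>) * cnj v)) (at \<zeta>)" if "\<zeta> \<in> U" for \<zeta>
  proof -
    have "(?h has_derivative (\<lambda>v. c * (wirtinger f \<zeta> * v + wirtinger_bar f \<zeta> * cnj v)
        + d * (wirtinger g \<zeta> * v + wirtinger_bar g \<zeta> * cnj v))) (at \<zeta>)"
      using Suc.prems that by (intro has_derivative_add has_derivative_mult_right) auto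
    then show ?thesis by (simp add: algebra_simps)
  qed
  have eq: "wirtinger ?h \<zeta> = c * wirtinger f \<zeta> + d * wirtinger g \<zeta>"
    "wirtinger_bar ?h \<zeta> = c * wirtinger_bar f \<zeta> + d * wirtinger_bar g \<zeta>" if "\<zeta> \<in> U" for \<zeta>
    using wirtinger_eqI[OF D[OF that]] by auto
  have "wirtinger_smooth m U (wirtinger ?h)"
    by (rule wirtinger_smooth_cong[OF assms(1) _ Suc.IH[of "wirtinger f" "wirtinger g"]])
      (use Suc.prems eq in auto)
  moreover have "wirtinger_smooth m U (wirtinger_bar ?h)"
    by (rule wirtinger_smooth_cong[OF assms(1) _ Suc.IH[of "wirtinger_bar f" "wirtinger_bar g"]])
      (use Suc.prems eq in auto)
  ultimately show ?case using D eq by simp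
qed

section \<open>From continuous partial derivatives to the total derivative\<close>

lemma has_derivative_continuous_partials:
  fixes f g h :: "complex \<Rightarrow> complex"
  assumes "open U" "z \<in> U" and g: "continuous_on U g" and h: "continuous_on U h"
    and xi: "\<And>\<zeta>. \<zeta> \<in> U \<Longrightarrow> ((\<lambda>t::real. f (\<zeta> + of_real t)) has_vector_derivative g \<zeta>) (at 0)"
    and eta: "\<And>\<zeta>. \<zeta> \<in> U \<Longrightarrow> ((\<lambda>t::real. f (\<zeta> + \<i> * of_real t)) has_vector_derivative h \<zeta>) (at 0)"
  shows "(f has_derivative (\<lambda>v. (g z - \<i> * h z) / 2 * v + (g z + \<i> * h z) / 2 * cnj v)) (at z)"
proof -
  \<comment> \<open>The hypotheses speak of parameter 0 only; moving the base point gives the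
    derivative at every parameter of the line.\<close>
  have shift: "((\<lambda>t::real. f (\<zeta> + u * of_real t)) has_vector_derivative k (\<zeta> + u * of_real s)) (at s)"
    if "\<And>\<zeta>. \<zeta> \<in> U \<Longrightarrow> ((\<lambda>t::real. f (\<zeta> + u * of_real t)) has_vector_derivative k \<zeta>) (at 0)"
      "\<zeta> + u * of_real s \<in> U" for \<zeta> u s and k :: "complex \<Rightarrow> complex"
  proof -
    have "((\<lambda>t::real. t - s) has_vector_derivative 1) (at s)"
      by (auto intro!: derivative_eq_intros)
    moreover have "((\<lambda>t::real. f ((\<zeta> + u * of_real s) + u * of_real t)) has_vector_derivative k (\<zeta> + u * of_real s)) (at (s - s))"
      using that(1)[OF that(2)] by simp
    ultimately have "((\<lambda>t::real. f ((\<zeta> + u * of_real s) + u * of_real t)) \<circ> (\<lambda>t. t - s) has_vector_derivative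
        1 *\<^sub>R k (\<zeta> + u * of_real s)) (at s)"
      by (rule vector_diff_chain_at)
    then show ?thesis by (simp add: o_def algebra_simps)
  qed
  \<comment> \<open>Mean value inequality after subtracting the linear function with slope
    \<open>c\<close>: if the derivative stays within \<open>\<delta>\<close> of \<open>c\<close>,
    the increment is linear up to \<open>\<delta>\<close> times the length.\<close>
  have step: "norm (f (\<zeta> + u * of_real x) - f \<zeta> - x *\<^sub>R c) \<le> \<bar>x\<bar> * \<delta>"
    if D: "\<And>\<zeta>. \<zeta> \<in> U \<Longrightarrow> ((\<lambda>t::real. f (\<zeta> + u * of_real t)) has_vector_derivative k \<zeta>) (at 0)"
      and k: "\<And>t. t \<in> closed_segment 0 x \<Longrightarrow> \<zeta> + u * of_real t \<in> U \<and> norm (k (\<zeta> + u * of_real t) - c) \<le> \<delta>"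
    for \<zeta> u x c \<delta> and k :: "complex \<Rightarrow> complex"
  proof -
    have "norm ((f (\<zeta> + u * of_real x) - x *\<^sub>R c) - (f (\<zeta> + u * of_real 0) - 0 *\<^sub>R c)) \<le> \<delta> * norm (x - 0)"
    proof (rule differentiable_bound[of "closed_segment 0 x"])
      fix t assume t: "t \<in> closed_segment 0 x"
      have "((\<lambda>t. f (\<zeta> + u * of_real t) - t *\<^sub>R c) has_vector_derivative (k (\<zeta> + u * of_real t) - 1 *\<^sub>R c)) (at t)"
        by (rule has_vector_derivative_diff[OF shift[OF D]]) (use k[OF t] in \<open>auto intro!: derivative_eq_intros\<close>)
      then show "((\<lambda>t. f (\<zeta> + u * of_real t) - t *\<^sub>R c) has_derivative (\<lambda>s. s *\<^sub>R (k (\<zeta> + u * of_real t) - c)))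
          (at t within closed_segment 0 x)"
        unfolding has_vector_derivative_def by (auto intro: has_derivative_at_withinI)
      show "onorm (\<lambda>s. s *\<^sub>R (k (\<zeta> + u * of_real t) - c)) \<le> \<delta>"
        using k[OF t] order_trans[OF norm_ge_zero conjunct2[OF k[OF t]]]
        by (intro onorm_bound) (auto simp: mult.commute[of \<delta>] intro!: mult_left_mono)
    qed auto
    then show ?thesis by (simp add: algebra_simps)
  qed
  have lin: "(g z - \<i> * h z) / 2 * v + (g z + \<i> * h z) / 2 * cnj v = Re v *\<^sub>R g z + Im v *\<^sub>R h z" for v
    by (simp add: complex_eq_iff algebra_simps add_divide_distrib diff_divide_distrib)
  show ?thesis
    unfolding has_derivative_at_alt
  proof (intro conjI allI impI)
    show "bounded_linear (\<lambda>v. (g z - \<i> * h z) / 2 * v + (g z + \<i> * h z) / 2 * cnj v)"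
      by (intro bounded_linear_add bounded_linear_mult_right bounded_linear_const_mult bounded_linear_cnj)
    fix e :: real assume "e > 0"
    have "isCont g z" "isCont h z" using g h \<open>open U\<close> \<open>z \<in> U\<close> by (auto simp: continuous_on_eq_continuous_at)
    then have lim: "\<exists>r>0. \<forall>x. dist x z < r \<longrightarrow> dist (g x) (g z) < e / 2"
        "\<exists>r>0. \<forall>x. dist x z < r \<longrightarrow> dist (h x) (h z) < e / 2"
      using \<open>e > 0\<close> half_gt_zero[of e] unfolding continuous_at_eps_delta by blast+
    obtain r1 where r1: "r1 > 0" "\<And>x. dist x z < r1 \<Longrightarrow> dist (g x) (g z) < e / 2"
      using lim(1) by blast
    obtain r2 where r2: "r2 > 0" "\<And>x. dist x z < r2 \<Longrightarrow> dist (h x) (h z) < e / 2"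
      using lim(2) by blast
    obtain r3 where r3: "r3 > 0" "ball z r3 \<subseteq> U" using \<open>open U\<close> \<open>z \<in> U\<close> by (auto simp: open_contains_ball)
    define r where "r = min r1 (min r2 r3)"
    have r: "r > 0" using r1 r2 r3 by (simp add: r_def)
    have near: "x \<in> U \<and> norm (g x - g z) \<le> e / 2 \<and> norm (h x - h z) \<le> e / 2" if "norm (x - z) < r" for x
    proof -
      have "dist x z < r1" "dist x z < r2" "x \<in> ball z r3"
        using that by (auto simp: r_def dist_norm norm_minus_commute)
      then show ?thesis using r1(2)[of x] r2(2)[of x] r3(2) by (auto simp: dist_norm)
    qed
    show "\<exists>d>0. \<forall>y. norm (y - z) < d \<longrightarrow> norm (f y - f z - ((g z - \<i> * h z) / 2 * (y - z)
        + (g z + \<i> * h z) / 2 * cnj (y - z))) \<le> e * norm (y - z)"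
    proof (intro exI[of _ r] conjI allI impI r)
      fix y assume y: "norm (y - z) < r"
      define x1 where "x1 = Re (y - z)"
      define x2 where "x2 = Im (y - z)"
      have y_eq: "y = z + 1 * of_real x1 + \<i> * of_real x2"
        by (simp add: x1_def x2_def complex_eq_iff)
      have abs: "\<bar>x1\<bar> \<le> norm (y - z)" "\<bar>x2\<bar> \<le> norm (y - z)"
        unfolding x1_def x2_def by (rule abs_Re_le_cmod abs_Im_le_cmod)+
      have seg: "\<bar>t\<bar> \<le> \<bar>x\<bar>" if "t \<in> closed_segment 0 x" for t x :: real
        using that by (auto simp: closed_segment_eq_real_ivl split: if_splits)
      \<comment> \<open>The increment is taken along a horizontal segment from \<open>z\<close> and
        then along a vertical one. Points of both segments are no farther from \<open>z\<close> than
        \<open>y\<close>, so \<open>near\<close> applies throughout.\<close>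
      have 1: "norm (f (z + 1 * of_real x1) - f z - x1 *\<^sub>R g z) \<le> \<bar>x1\<bar> * (e / 2)"
      proof (rule step)
        fix t assume "t \<in> closed_segment 0 x1"
        then have "norm (z + 1 * of_real t - z) < r" using seg[of t x1] abs y by simp
        from near[OF this] show "z + 1 * of_real t \<in> U \<and> norm (g (z + 1 * of_real t) - g z) \<le> e / 2" by blast
      qed (use xi in simp)
      have 2: "norm (f (z + 1 * of_real x1 + \<i> * of_real x2) - f (z + 1 * of_real x1) - x2 *\<^sub>R h z) \<le> \<bar>x2\<bar> * (e / 2)"
      proof (rule step[OF eta])
        fix t assume t: "t \<in> closed_segment 0 x2"
        have "norm (z + 1 * of_real x1 + \<i> * of_real t - z) = sqrt (x1\<^sup>2 + t\<^sup>2)"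
          by (simp add: cmod_def)
        also have "\<dots> \<le> sqrt (x1\<^sup>2 + x2\<^sup>2)"
          using seg[OF t] by (auto intro!: real_sqrt_le_mono simp: abs_le_square_iff)
        also have "\<dots> = norm (y - z)" by (simp add: cmod_def x1_def x2_def)
        finally have "norm (z + 1 * of_real x1 + \<i> * of_real t - z) < r" using y by simp
        from near[OF this] show "z + 1 * of_real x1 + \<i> * of_real t \<in> U \<and>
            norm (h (z + 1 * of_real x1 + \<i> * of_real t) - h z) \<le> e / 2" by blast
      qed
      have "norm (f y - f z - (Re (y - z) *\<^sub>R g z + Im (y - z) *\<^sub>R h z))
          \<le> \<bar>x1\<bar> * (e / 2) + \<bar>x2\<bar> * (e / 2)"
        using norm_triangle_mono[OF 1 2] unfolding y_eq[symmetric] x1_def[symmetric] x2_def[symmetric]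
        by (simp add: algebra_simps)
      also have "\<dots> \<le> norm (y - z) * (e / 2) + norm (y - z) * (e / 2)"
        using abs \<open>e > 0\<close> by (intro add_mono mult_right_mono) auto
      also have "\<dots> = e * norm (y - z)" by simp
      finally show "norm (f y - f z - ((g z - \<i> * h z) / 2 * (y - z)
        + (g z + \<i> * h z) / 2 * cnj (y - z))) \<le> e * norm (y - z)" unfolding lin .
    qed
  qed
qed

text \<open>On \<open>\<Omega>\<close> the Wirtinger derivatives are linear combinations of the two
  extensions, which belong to the class one order lower; locality on the open set transfers their
  smoothness.\<close>

lemma C_on_closure_imp_wirtinger_smooth:
  assumes "open \<Omega>" "C_on_closure m \<Omega> f"
  shows "wirtinger_smooth m \<Omega> f"
  using assms(2)
proof (induction m arbitrary: f)
  case 0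
  then show ?case using continuous_on_subset[OF _ closure_subset, of \<Omega> f] by simp
next
  case (Suc m)
  then obtain g h where gh: "C_on_closure m \<Omega> g" "C_on_closure m \<Omega> h"
    and D: "\<And>\<zeta>. \<zeta> \<in> \<Omega> \<Longrightarrow> ((\<lambda>t::real. f (\<zeta> + of_real t)) has_vector_derivative g \<zeta>) (at 0)"
      "\<And>\<zeta>. \<zeta> \<in> \<Omega> \<Longrightarrow> ((\<lambda>t::real. f (\<zeta> + \<i> * of_real t)) has_vector_derivative h \<zeta>) (at 0)"
    by auto
  note sm = Suc.IH[OF gh(1)] Suc.IH[OF gh(2)]
  have deriv: "(f has_derivative (\<lambda>v. (g z - \<i> * h z) / 2 * v + (g z + \<i> * h z) / 2 * cnj v)) (at z)"
    if "z \<in> \<Omega>" for z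
    using wirtinger_smooth_imp_continuous[OF sm(1)] wirtinger_smooth_imp_continuous[OF sm(2)] D
    by (intro has_derivative_continuous_partials[OF assms(1) that])
  have eq: "wirtinger f z = (g z - \<i> * h z) / 2" "wirtinger_bar f z = (g z + \<i> * h z) / 2" if "z \<in> \<Omega>" for z
    using wirtinger_eqI[OF deriv[OF that]] by auto
  have "wirtinger_smooth m \<Omega> (wirtinger f)"
    by (rule wirtinger_smooth_cong[OF assms(1) _
        wirtinger_smooth_linear_combination[OF assms(1) sm, of "1/2" "- \<i> / 2"]]) (simp add: eq field_simps)
  moreover have "wirtinger_smooth m \<Omega> (wirtinger_bar f)"
    by (rule wirtinger_smooth_cong[OF assms(1) _
        wirtinger_smooth_linear_combination[OF assms(1) sm, of "1/2" "\<i> / 2"]]) (simp add: eq field_simps)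
  moreover have "(f has_derivative (\<lambda>v. wirtinger f z * v + wirtinger_bar f z * cnj v)) (at z)"
    if "z \<in> \<Omega>" for z
    unfolding eq[OF that] by (rule deriv[OF that])
  ultimately show ?case by simp
qed

section \<open>Symmetry of second derivatives\<close>

text \<open>The second difference is an increment, in the parameter along \<open>v\<close>, of the
  first difference along \<open>u\<close>. The derivative of that first difference is a difference
  of values of \<open>G\<close> at points near \<open>z\<close>, equal to
  \<open>t *\<^sub>R L u\<close> up to o(t) because \<open>G\<close> is differentiable at
  \<open>z\<close>.\<close>

lemma second_difference_bound:
  fixes f G :: "complex \<Rightarrow> complex"
  assumes "open U" "z \<in> U" "\<delta> > 0"
    and G: "\<And>y. y \<in> U \<Longrightarrow> ((\<lambda>s::real. f (y + s *\<^sub>R v)) has_vector_derivative G y) (at 0)"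
    and L: "(G has_derivative L) (at z)"
  shows "\<forall>\<^sub>F t in at_right 0.
    norm (f (z + t *\<^sub>R u + t *\<^sub>R v) - f (z + t *\<^sub>R u) - f (z + t *\<^sub>R v) + f z - t\<^sup>2 *\<^sub>R L u) \<le> \<delta> * t\<^sup>2"
proof -
  \<comment> \<open>Both evaluation points are within \<open>t * (norm u + norm v)\<close> of
    \<open>z\<close> and each contributes an error, hence the factor 2; adding 1 keeps
    \<open>M\<close> positive.\<close>
  define M where "M = 2 * (norm u + norm v) + 1"
  have M: "M > 0" by (auto simp: M_def intro: add_nonneg_pos)
  define \<epsilon> where "\<epsilon> = \<delta> / M"
  have \<epsilon>: "\<epsilon> > 0" using M \<open>\<delta> > 0\<close> by (simp add: \<epsilon>_def)
  obtain r1 where r1: "r1 > 0" "\<And>y. norm (y - z) < r1 \<Longrightarrow> norm (G y - G z - L (y - z)) \<le> \<epsilon> * norm (y - z)"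
    using L \<epsilon> unfolding has_derivative_at_alt by blast
  have lin: "bounded_linear L" using L by (rule has_derivative_bounded_linear)
  obtain r2 where r2: "r2 > 0" "ball z r2 \<subseteq> U" using assms(1,2) by (auto simp: open_contains_ball)
  define r where "r = min r1 r2"
  have r: "r > 0" using r1 r2 by (simp add: r_def)
  have "norm (f (z + t *\<^sub>R u + t *\<^sub>R v) - f (z + t *\<^sub>R u) - f (z + t *\<^sub>R v) + f z - t\<^sup>2 *\<^sub>R L u) \<le> \<delta> * t\<^sup>2"
    if t: "0 < t" "t < r / M" for t :: real
  proof -
    have tM: "t * M < r" using t M by (simp add: field_simps)
    have small: "norm (t *\<^sub>R u) + norm (t *\<^sub>R v) < r"
    proof -
      have "norm (t *\<^sub>R u) + norm (t *\<^sub>R v) = t * (norm u + norm v)" using t by (simp add: algebra_simps)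
      also have "\<dots> \<le> t * M" using t by (intro mult_left_mono) (auto simp: M_def)
      finally show ?thesis using tM by simp
    qed
    have D: "((\<lambda>s. f (y + s *\<^sub>R v)) has_vector_derivative G (y + s *\<^sub>R v)) (at s)"
      if "y + s *\<^sub>R v \<in> U" for y and s :: real
    proof -
      have "((\<lambda>t::real. t - s) has_vector_derivative 1) (at s)"
        by (auto intro!: derivative_eq_intros)
      moreover have "((\<lambda>t::real. f ((y + s *\<^sub>R v) + t *\<^sub>R v)) has_vector_derivative G (y + s *\<^sub>R v)) (at (s - s))"
        using G[OF that] by simp
      ultimately have "((\<lambda>t::real. f ((y + s *\<^sub>R v) + t *\<^sub>R v)) \<circ> (\<lambda>t. t - s) has_vector_derivative
          1 *\<^sub>R G (y + s *\<^sub>R v)) (at s)"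
        by (rule vector_diff_chain_at)
      then show ?thesis by (simp add: o_def algebra_simps)
    qed
    define \<phi> where "\<phi> s = f ((z + t *\<^sub>R u) + s *\<^sub>R v) - f (z + s *\<^sub>R v) - s *\<^sub>R (t *\<^sub>R L u)" for s
    have near: "w \<in> U \<and> norm (G w - G z - L (w - z)) \<le> \<epsilon> * norm (w - z)" if "norm (w - z) < r" for w
      using that r1(2)[of w] r2(2) by (auto simp: r_def dist_norm norm_minus_commute)
    have "norm (\<phi> t - \<phi> 0) \<le> (\<delta> * t) * norm (t - 0)"
    proof (rule differentiable_bound[of "{0..t}"])
      fix s assume s: "s \<in> {0..t}"
      have sv: "norm (s *\<^sub>R v) \<le> norm (t *\<^sub>R v)" using s by (auto intro: mult_right_mono)
      define w1 where "w1 = (z + t *\<^sub>R u) + s *\<^sub>R v"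
      define w2 where "w2 = z + s *\<^sub>R v"
      have n1: "norm (w1 - z) \<le> t * (norm u + norm v)"
        using norm_triangle_ineq[of "t *\<^sub>R u" "s *\<^sub>R v"] sv t by (simp add: w1_def algebra_simps)
      have n2: "norm (w2 - z) \<le> t * (norm u + norm v)"
        using sv t by (auto simp: w2_def algebra_simps intro: add_increasing)
      have "t * (norm u + norm v) < r" using small t by (simp add: algebra_simps)
      with n1 n2 have w: "norm (w1 - z) < r" "norm (w2 - z) < r" by auto
      have "(\<phi> has_vector_derivative G w1 - G w2 - 1 *\<^sub>R (t *\<^sub>R L u)) (at s)"
        unfolding \<phi>_def
        by (intro has_vector_derivative_diff) 
          (use D[of "z + t *\<^sub>R u" s] D[of z s] near w in \<open>auto simp: w1_def w2_def intro!: derivative_eq_intros\<close>)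
      then show "(\<phi> has_derivative (\<lambda>h. h *\<^sub>R (G w1 - G w2 - t *\<^sub>R L u))) (at s within {0..t})"
        unfolding has_vector_derivative_def by (auto intro: has_derivative_at_withinI)
      have w12: "w1 - z = (w2 - z) + t *\<^sub>R u" by (simp add: w1_def w2_def)
      have "L (w1 - z) = L (w2 - z) + t *\<^sub>R L u"
        unfolding w12 linear_add[OF bounded_linear.linear[OF lin]]
          linear_scale[OF bounded_linear.linear[OF lin]] ..
      then have eq: "G w1 - G w2 - t *\<^sub>R L u = (G w1 - G z - L (w1 - z)) - (G w2 - G z - L (w2 - z))"
        by simp
      have "norm (G w1 - G w2 - t *\<^sub>R L u) \<le> \<epsilon> * norm (w1 - z) + \<epsilon> * norm (w2 - z)"
        unfolding eq
        using near[OF w(1), THEN conjunct2] near[OF w(2), THEN conjunct2] norm_triangle_ineq4[of "G w1 - G z - L (w1 - z)" "G w2 - G z - L (w2 - z)"]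
        by linarith
      also have "\<dots> \<le> \<epsilon> * (t * (norm u + norm v)) + \<epsilon> * (t * (norm u + norm v))"
        using n1 n2 \<epsilon> by (intro add_mono mult_left_mono) auto
      also have "\<dots> = \<epsilon> * t * (2 * (norm u + norm v))" by (simp add: algebra_simps)
      also have "\<dots> \<le> \<epsilon> * t * M" using \<epsilon> t by (intro mult_left_mono) (auto simp: M_def)
      also have "\<dots> = \<delta> * t" using M by (simp add: \<epsilon>_def)
      finally have "norm (G w1 - G w2 - t *\<^sub>R L u) \<le> \<delta> * t" .
      then show "onorm (\<lambda>h. h *\<^sub>R (G w1 - G w2 - t *\<^sub>R L u)) \<le> \<delta> * t"
        using t \<open>\<delta> > 0\<close>
        by (intro onorm_bound) (auto simp: mult.commute[of "\<delta> * t"] intro!: mult_left_mono)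
    qed (use t in auto)
    then show ?thesis
      using t by (simp add: \<phi>_def algebra_simps power2_eq_square)
  qed
  moreover have "\<forall>\<^sub>F t in at_right 0. 0 < t \<and> t < r / M"
    using r M by (auto simp: eventually_at_right_field intro!: exI[of _ "r / M"])
  ultimately show ?thesis by (auto elim: eventually_mono)
qed

text \<open>The second difference is symmetric in \<open>u\<close> and \<open>v\<close>, and after
  division by t^2 it tends to both \<open>L u\<close> and \<open>K v\<close>.\<close>

lemma symmetric_second_difference:
  fixes f :: "complex \<Rightarrow> complex"
  assumes "open U" "z \<in> U"
    and G: "\<And>y. y \<in> U \<Longrightarrow> ((\<lambda>s::real. f (y + s *\<^sub>R v)) has_vector_derivative G y) (at 0)"
    and L: "(G has_derivative L) (at z)"
    and H: "\<And>y. y \<in> U \<Longrightarrow> ((\<lambda>s::real. f (y + s *\<^sub>R u)) has_vector_derivative H y) (at 0)"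
    and K: "(H has_derivative K) (at z)"
  shows "L u = K v"
proof (rule ccontr)
  assume "L u \<noteq> K v"
  \<comment> \<open>With a third of the distance, two errors of size \<open>\<delta>\<close> cannot
    add up to \<open>3 * \<delta>\<close>.\<close>
  define \<delta> where "\<delta> = norm (L u - K v) / 3"
  have \<delta>: "\<delta> > 0" using \<open>L u \<noteq> K v\<close> by (simp add: \<delta>_def)
  have "\<forall>\<^sub>F t::real in at_right 0. t > 0" by (rule eventually_at_right_less)
  moreover have "\<forall>\<^sub>F t in at_right 0. norm (f (z + t *\<^sub>R u + t *\<^sub>R v) - f (z + t *\<^sub>R u)
      - f (z + t *\<^sub>R v) + f z - t\<^sup>2 *\<^sub>R L u) \<le> \<delta> * t\<^sup>2"
    by (rule second_difference_bound[OF assms(1,2) \<delta> G L])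
  moreover have "\<forall>\<^sub>F t in at_right 0. norm (f (z + t *\<^sub>R v + t *\<^sub>R u) - f (z + t *\<^sub>R v)
      - f (z + t *\<^sub>R u) + f z - t\<^sup>2 *\<^sub>R K v) \<le> \<delta> * t\<^sup>2"
    by (rule second_difference_bound[OF assms(1,2) \<delta> H K])
  ultimately have "\<forall>\<^sub>F t::real in at_right 0. False"
  proof eventually_elim
    case (elim t)
    define A where "A = f (z + t *\<^sub>R u + t *\<^sub>R v) - f (z + t *\<^sub>R u) - f (z + t *\<^sub>R v) + f z"
    have "norm (A - t\<^sup>2 *\<^sub>R L u) \<le> \<delta> * t\<^sup>2" "norm (A - t\<^sup>2 *\<^sub>R K v) \<le> \<delta> * t\<^sup>2"
      using elim(2,3) by (auto simp: A_def algebra_simps)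
    then have "norm (t\<^sup>2 *\<^sub>R L u - t\<^sup>2 *\<^sub>R K v) \<le> 2 * \<delta> * t\<^sup>2"
      using norm_triangle_ineq4[of "A - t\<^sup>2 *\<^sub>R K v" "A - t\<^sup>2 *\<^sub>R L u"] by simp
    then have "t\<^sup>2 * (3 * \<delta>) \<le> t\<^sup>2 * (2 * \<delta>)"
      unfolding scaleR_diff_right[symmetric] by (simp add: \<delta>_def mult.commute)
    with elim(1) \<delta> show ?case by simp
  qed
  then show False by simp
qed

lemma wirtinger_commute:
  assumes "open U" "z \<in> U" "wirtinger_smooth 2 U f"
  shows "wirtinger_bar (wirtinger f) z = wirtinger (wirtinger_bar f) z"
proof -
  let ?a = "wirtinger f" and ?b = "wirtinger_bar f"
  have sm: "wirtinger_smooth (Suc 1) U f" using assms(3) by (simp add: numeral_2_eq_2)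
  have dir: "((\<lambda>s::real. f (y + s *\<^sub>R v)) has_vector_derivative ?a y * v + ?b y * cnj v) (at 0)"
    if "y \<in> U" for y v
  proof -
    have "((\<lambda>s::real. y + s *\<^sub>R v) has_derivative (\<lambda>s. s *\<^sub>R v)) (at 0)"
      by (auto intro!: derivative_eq_intros)
    from has_derivative_compose[OF this, of f "\<lambda>v. ?a y * v + ?b y * cnj v"] sm that
    have "((\<lambda>s::real. f (y + s *\<^sub>R v)) has_derivative (\<lambda>s. ?a y * (s *\<^sub>R v) + ?b y * cnj (s *\<^sub>R v))) (at 0)"
      by simp
    then show ?thesis unfolding has_vector_derivative_def by (simp add: algebra_simps)
  qed
  have Da: "(?a has_derivative (\<lambda>w. wirtinger ?a z * w + wirtinger_bar ?a z * cnj w)) (at z)"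
    and Db: "(?b has_derivative (\<lambda>w. wirtinger ?b z * w + wirtinger_bar ?b z * cnj w)) (at z)"
    using sm assms(2) by simp_all
  have D: "((\<lambda>y. ?a y * v + ?b y * cnj v) has_derivative
      (\<lambda>w. (wirtinger ?a z * w + wirtinger_bar ?a z * cnj w) * v
         + (wirtinger ?b z * w + wirtinger_bar ?b z * cnj w) * cnj v)) (at z)" for v
    by (intro has_derivative_add has_derivative_mult_left Da Db)
  \<comment> \<open>Symmetry for the directions 1 and \<i>. The pure second derivatives cancel, and
    the mixed ones remain with factor 2 \<i>.\<close>
  have "(wirtinger ?a z * 1 + wirtinger_bar ?a z * cnj 1) * \<i>
         + (wirtinger ?b z * 1 + wirtinger_bar ?b z * cnj 1) * cnj \<i>
     = (wirtinger ?a z * \<i> + wirtinger_bar ?a z * cnj \<i>) * 1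
         + (wirtinger ?b z * \<i> + wirtinger_bar ?b z * cnj \<i>) * cnj 1"
    by (rule symmetric_second_difference[OF assms(1,2) dir D dir D])
  then have "2 * \<i> * (wirtinger_bar ?a z - wirtinger ?b z) = 0"
    by (simp add: algebra_simps)
  then show ?thesis by simp
qed

lemma wirtinger_funpow_cong:
  assumes "open U" "\<And>x. x \<in> U \<Longrightarrow> f x = g x" "x \<in> U"
  shows "(wirtinger ^^ j) f x = (wirtinger ^^ j) g x" "(wirtinger_bar ^^ j) f x = (wirtinger_bar ^^ j) g x"
proof -
  have "\<forall>x\<in>U. (wirtinger ^^ j) f x = (wirtinger ^^ j) g x \<and> (wirtinger_bar ^^ j) f x = (wirtinger_bar ^^ j) g x"
  proof (induction j)
    case (Suc j)
    then show ?case
      using wirtinger_cong(1)[OF assms(1), of "(wirtinger ^^ j) f" "(wirtinger ^^ j) g"]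
        wirtinger_cong(2)[OF assms(1), of "(wirtinger_bar ^^ j) f" "(wirtinger_bar ^^ j) g"]
      by auto
  qed (use assms(2) in simp)
  then show "(wirtinger ^^ j) f x = (wirtinger ^^ j) g x" "(wirtinger_bar ^^ j) f x = (wirtinger_bar ^^ j) g x"
    using assms(3) by auto
qed

lemma wirtinger_smooth_bar_funpow:
  "wirtinger_smooth (m + k) U f \<Longrightarrow> wirtinger_smooth m U ((wirtinger_bar ^^ k) f)"
proof (induction k arbitrary: m)
  case (Suc k)
  then have "wirtinger_smooth (Suc m + k) U f" by simp
  from Suc.IH[OF this] show ?case by simp
qed simp

text \<open>In a Taylor coefficient of \<open>wirtinger f\<close> the operator
  \<open>wirtinger\<close> acts first, whereas the coefficients of \<open>f\<close> apply the
  conjugate operators first; this brings it to the right place.\<close>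

lemma wirtinger_bar_funpow_wirtinger:
  assumes "open U" "wirtinger_smooth (Suc k) U f" "x \<in> U"
  shows "(wirtinger_bar ^^ k) (wirtinger f) x = wirtinger ((wirtinger_bar ^^ k) f) x"
  using assms(2,3)
proof (induction k arbitrary: x)
  case (Suc k)
  have "wirtinger_smooth (2 + k) U f" using Suc.prems(1) by (simp add: numeral_2_eq_2)
  then have sm: "wirtinger_smooth 2 U ((wirtinger_bar ^^ k) f)" by (rule wirtinger_smooth_bar_funpow)
  have IH: "(wirtinger_bar ^^ k) (wirtinger f) y = wirtinger ((wirtinger_bar ^^ k) f) y" if "y \<in> U" for y
    using Suc.IH[OF wirtinger_smooth_SucD[OF Suc.prems(1)] that] .
  have "(wirtinger_bar ^^ Suc k) (wirtinger f) x = wirtinger_bar (wirtinger ((wirtinger_bar ^^ k) f)) x"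
    using wirtinger_cong(2)[OF assms(1) IH Suc.prems(2)] by simp
  also have "\<dots> = wirtinger ((wirtinger_bar ^^ Suc k) f) x"
    using wirtinger_commute[OF assms(1) Suc.prems(2) sm] by simp
  finally show ?case .
qed simp

section \<open>The Taylor polynomial and its remainder\<close>

definition wirtinger_coeff :: "(complex \<Rightarrow> complex) \<Rightarrow> complex \<Rightarrow> nat \<Rightarrow> nat \<Rightarrow> complex" where
  "wirtinger_coeff f z j k = (wirtinger ^^ j) ((wirtinger_bar ^^ k) f) z / (fact j * fact k)"

definition wirtinger_taylor :: "nat \<Rightarrow> (complex \<Rightarrow> complex) \<Rightarrow> complex \<Rightarrow> complex \<Rightarrow> complex" where
  "wirtinger_taylor m f z w = (\<Sum>j\<le>m. \<Sum>k\<le>m - j. wirtinger_coeff f z j k * (w ^ j * cnj w ^ k))"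

lemma wirtinger_coeff_bar:
  "wirtinger_coeff (wirtinger_bar f) z j k = wirtinger_coeff f z j (Suc k) * of_nat (Suc k)"
  unfolding wirtinger_coeff_def by (simp add: funpow_swap1 field_simps del: of_nat_Suc)

lemma wirtinger_coeff_wirtinger:
  assumes "open U" "z \<in> U" "wirtinger_smooth (Suc k) U f"
  shows "wirtinger_coeff (wirtinger f) z j k = wirtinger_coeff f z (Suc j) k * of_nat (Suc j)"
proof -
  have "(wirtinger ^^ j) ((wirtinger_bar ^^ k) (wirtinger f)) z
      = (wirtinger ^^ j) (wirtinger ((wirtinger_bar ^^ k) f)) z"
    by (rule wirtinger_funpow_cong(1)[OF assms(1) _ assms(2)])
      (rule wirtinger_bar_funpow_wirtinger[OF assms(1,3)])
  also have "\<dots> = (wirtinger ^^ Suc j) ((wirtinger_bar ^^ k) f) z" by (simp add: funpow_swap1)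
  finally show ?thesis unfolding wirtinger_coeff_def by (simp add: field_simps del: of_nat_Suc funpow.simps)
qed

text \<open>Termwise differentiation shifts one index of the coefficients, so the two Wirtinger
  derivatives of the polynomial are the Taylor polynomials of the two derivatives of
  \<open>f\<close>, one degree lower.\<close>

lemma wirtinger_taylor_has_derivative:
  assumes "open U" "z \<in> U" "wirtinger_smooth (Suc m) U f"
  shows "(wirtinger_taylor (Suc m) f z has_derivative
    (\<lambda>v. wirtinger_taylor m (wirtinger f) z w * v + wirtinger_taylor m (wirtinger_bar f) z w * cnj v)) (at w)"
proof -
  let ?c = "wirtinger_coeff f z"
  \<comment> \<open>For \<open>j = 0\<close> or \<open>k = 0\<close> the truncated exponent is
    harmless, being multiplied by 0.\<close>
  have mono: "((\<lambda>w. w ^ j * cnj w ^ k) has_derivative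
     (\<lambda>v. (of_nat j * w ^ (j - 1) * cnj w ^ k) * v + (of_nat k * w ^ j * cnj w ^ (k - 1)) * cnj v)) (at w)" for j k
    by (auto intro!: derivative_eq_intros simp: algebra_simps)
  have "((\<lambda>w. \<Sum>j\<le>Suc m. \<Sum>k\<le>Suc m - j. ?c j k * (w ^ j * cnj w ^ k)) has_derivative
     (\<lambda>v. \<Sum>j\<le>Suc m. \<Sum>k\<le>Suc m - j. ?c j k * ((of_nat j * w ^ (j - 1) * cnj w ^ k) * v
        + (of_nat k * w ^ j * cnj w ^ (k - 1)) * cnj v))) (at w)"
    by (intro has_derivative_sum has_derivative_mult_right mono)
  moreover have "wirtinger_taylor (Suc m) f z = (\<lambda>w. \<Sum>j\<le>Suc m. \<Sum>k\<le>Suc m - j. ?c j k * (w ^ j * cnj w ^ k))"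
    by (rule ext) (simp only: wirtinger_taylor_def)
  moreover have "(\<lambda>v. \<Sum>j\<le>Suc m. \<Sum>k\<le>Suc m - j. ?c j k * ((of_nat j * w ^ (j - 1) * cnj w ^ k) * v
        + (of_nat k * w ^ j * cnj w ^ (k - 1)) * cnj v))
     = (\<lambda>v. wirtinger_taylor m (wirtinger f) z w * v + wirtinger_taylor m (wirtinger_bar f) z w * cnj v)"
  proof (rule ext)
    fix v
    have 1: "(\<Sum>j\<le>Suc m. \<Sum>k\<le>Suc m - j. ?c j k * (of_nat j * w ^ (j - 1) * cnj w ^ k))
        = wirtinger_taylor m (wirtinger f) z w"
    proof -
      have "(\<Sum>j\<le>Suc m. \<Sum>k\<le>Suc m - j. ?c j k * (of_nat j * w ^ (j - 1) * cnj w ^ k))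
          = (\<Sum>j\<le>m. \<Sum>k\<le>m - j. ?c (Suc j) k * (of_nat (Suc j) * w ^ j * cnj w ^ k))"
        by (subst sum.atMost_Suc_shift) (simp del: of_nat_Suc)
      also have "\<dots> = wirtinger_taylor m (wirtinger f) z w"
        unfolding wirtinger_taylor_def
      proof (intro sum.cong refl)
        fix j k assume "j \<in> {..m}" "k \<in> {..m - j}"
        then have "wirtinger_smooth (Suc k) U f" by (intro wirtinger_smooth_mono[OF assms(3)]) auto
        from wirtinger_coeff_wirtinger[OF assms(1,2) this]
        show "?c (Suc j) k * (of_nat (Suc j) * w ^ j * cnj w ^ k)
          = wirtinger_coeff (wirtinger f) z j k * (w ^ j * cnj w ^ k)" by (simp add: mult_ac)
      qed
      finally show ?thesis .
    qed
    have 2: "(\<Sum>j\<le>Suc m. \<Sum>k\<le>Suc m - j. ?c j k * (of_nat k * w ^ j * cnj w ^ (k - 1)))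
        = wirtinger_taylor m (wirtinger_bar f) z w"
    proof -
      \<comment> \<open>The row \<open>j = Suc m\<close> contains only \<open>k = 0\<close> and
        vanishes by its factor \<open>k\<close>; the remaining rows can then be shifted in
        \<open>k\<close>.\<close>
      have "(\<Sum>j\<le>Suc m. \<Sum>k\<le>Suc m - j. ?c j k * (of_nat k * w ^ j * cnj w ^ (k - 1)))
          = (\<Sum>j\<le>m. \<Sum>k\<le>Suc m - j. ?c j k * (of_nat k * w ^ j * cnj w ^ (k - 1)))"
        by simp
      also have "\<dots> = (\<Sum>j\<le>m. \<Sum>k\<le>m - j. wirtinger_coeff (wirtinger_bar f) z j k * (w ^ j * cnj w ^ k))"
      proof (rule sum.cong[OF refl])
        fix j assume "j \<in> {..m}"
        then have "Suc m - j = Suc (m - j)" by auto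
        then have "(\<Sum>k\<le>Suc m - j. ?c j k * (of_nat k * w ^ j * cnj w ^ (k - 1)))
            = (\<Sum>k\<le>m - j. ?c j (Suc k) * (of_nat (Suc k) * w ^ j * cnj w ^ k))"
          by (simp only:) (subst sum.atMost_Suc_shift, simp del: of_nat_Suc)
        then show "(\<Sum>k\<le>Suc m - j. ?c j k * (of_nat k * w ^ j * cnj w ^ (k - 1)))
            = (\<Sum>k\<le>m - j. wirtinger_coeff (wirtinger_bar f) z j k * (w ^ j * cnj w ^ k))"
          unfolding wirtinger_coeff_bar by (simp add: mult_ac del: of_nat_Suc)
      qed
      finally show ?thesis unfolding wirtinger_taylor_def .
    qed
    show "(\<Sum>j\<le>Suc m. \<Sum>k\<le>Suc m - j. ?c j k * ((of_nat j * w ^ (j - 1) * cnj w ^ k) * v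
        + (of_nat k * w ^ j * cnj w ^ (k - 1)) * cnj v))
      = wirtinger_taylor m (wirtinger f) z w * v + wirtinger_taylor m (wirtinger_bar f) z w * cnj v"
      unfolding 1[symmetric] 2[symmetric] sum_distrib_right sum.distrib[symmetric]
      by (intro sum.cong refl) (simp only: distrib_left mult.assoc)
  qed
  ultimately show ?thesis by simp
qed

lemma wirtinger_taylor_0: "wirtinger_taylor m f z 0 = f z"
proof -
  have "(\<Sum>k\<le>m - j. wirtinger_coeff f z j k * (0 ^ j * cnj 0 ^ k)) = (if j = 0 then f z else 0)" for j
  proof -
    have "(\<Sum>k\<le>m - j. wirtinger_coeff f z j k * (0 ^ j * cnj 0 ^ k))
      = (\<Sum>k\<le>m - j. if k = 0 then (if j = 0 then f z else 0) else 0)"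
      by (intro sum.cong) (auto simp: wirtinger_coeff_def power_0_left)
    then show ?thesis by simp
  qed
  then show ?thesis unfolding wirtinger_taylor_def by simp
qed

text \<open>Induction through the derivatives: the error vanishes at 0, and its two derivative
  coefficients are the errors for \<open>wirtinger f\<close> and \<open>wirtinger_bar f\<close>. The
  mean value inequality on the disc of radius \<open>norm w\<close> gains the missing power.\<close>

theorem wirtinger_taylor_remainder:
  assumes "open U" "z \<in> U" "wirtinger_smooth m U f" "\<delta> > 0"
  shows "\<exists>\<rho>>0. \<forall>w. norm w < \<rho> \<longrightarrow> norm (f (z + w) - wirtinger_taylor m f z w) \<le> \<delta> * norm w ^ m"
  using assms(3,4)
proof (induction m arbitrary: f \<delta>)
  case 0
  have "isCont f z" using 0 assms(1,2) by (auto simp: continuous_on_eq_continuous_at)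
  then obtain \<rho> where "\<rho> > 0" "\<And>x. dist x z < \<rho> \<Longrightarrow> dist (f x) (f z) < \<delta>"
    using 0(2) unfolding continuous_at_eps_delta by blast
  then show ?case
    by (intro exI[of _ \<rho>]) (auto simp: wirtinger_taylor_def wirtinger_coeff_def dist_norm less_imp_le)
next
  case (Suc m)
  \<comment> \<open>Each of the two derivatives gets half, since the operator norm is at most the
    sum of the moduli of the coefficients.\<close>
  have "\<delta> / 2 > 0" using Suc.prems by simp
  obtain r1 where r1: "r1 > 0" "\<And>w. norm w < r1 \<Longrightarrow>
      norm (wirtinger f (z + w) - wirtinger_taylor m (wirtinger f) z w) \<le> \<delta> / 2 * norm w ^ m"
    using Suc.IH[of "wirtinger f", OF _ \<open>\<delta> / 2 > 0\<close>] Suc.prems(1) by auto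
  obtain r2 where r2: "r2 > 0" "\<And>w. norm w < r2 \<Longrightarrow>
      norm (wirtinger_bar f (z + w) - wirtinger_taylor m (wirtinger_bar f) z w) \<le> \<delta> / 2 * norm w ^ m"
    using Suc.IH[of "wirtinger_bar f", OF _ \<open>\<delta> / 2 > 0\<close>] Suc.prems(1) by auto
  obtain r3 where r3: "r3 > 0" "ball z r3 \<subseteq> U" using assms(1,2) by (auto simp: open_contains_ball)
  define \<rho> where "\<rho> = min r1 (min r2 r3)"
  have \<rho>: "\<rho> > 0" using r1 r2 r3 by (simp add: \<rho>_def)
  define A where "A w = wirtinger f (z + w) - wirtinger_taylor m (wirtinger f) z w" for w
  define B where "B w = wirtinger_bar f (z + w) - wirtinger_taylor m (wirtinger_bar f) z w" for w
  define E where "E w = f (z + w) - wirtinger_taylor (Suc m) f z w" for w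
  have "norm (E w) \<le> \<delta> * norm w ^ Suc m" if w: "norm w < \<rho>" for w
  proof -
    have "norm (E w - E 0) \<le> (\<delta> * norm w ^ m) * norm (w - 0)"
    proof (rule differentiable_bound[of "cball 0 (norm w)"])
      fix x :: complex assume "x \<in> cball 0 (norm w)"
      then have x: "norm x \<le> norm w" by simp
      then have xU: "z + x \<in> U" using w r3(2) by (auto simp: \<rho>_def dist_norm)
      have "((\<lambda>x. f (z + x)) has_derivative (\<lambda>v. wirtinger f (z + x) * v + wirtinger_bar f (z + x) * cnj v)) (at x)"
        by (rule has_derivative_compose[of "\<lambda>x. z + x" "\<lambda>v. v"])
          (use Suc.prems(1) xU in \<open>auto intro!: derivative_eq_intros\<close>)
      then have "((\<lambda>x. f (z + x) - wirtinger_taylor (Suc m) f z x) has_derivative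
         (\<lambda>v. (wirtinger f (z + x) * v + wirtinger_bar f (z + x) * cnj v)
          - (wirtinger_taylor m (wirtinger f) z x * v + wirtinger_taylor m (wirtinger_bar f) z x * cnj v))) (at x)"
        by (intro has_derivative_diff wirtinger_taylor_has_derivative[OF assms(1,2) Suc.prems(1)])
      then have "(E has_derivative (\<lambda>v. A x * v + B x * cnj v)) (at x)"
        unfolding E_def A_def B_def by (simp add: algebra_simps)
      then show "(E has_derivative (\<lambda>v. A x * v + B x * cnj v)) (at x within cball 0 (norm w))"
        by (rule has_derivative_at_withinI)
      have "norm (A x) \<le> \<delta> / 2 * norm x ^ m" "norm (B x) \<le> \<delta> / 2 * norm x ^ m"
        unfolding A_def B_def using r1(2)[of x] r2(2)[of x] x w by (auto simp: \<rho>_def)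
      moreover have "\<delta> / 2 * norm x ^ m \<le> \<delta> / 2 * norm w ^ m"
        using Suc.prems(2) x by (intro mult_left_mono power_mono) auto
      ultimately have AB: "norm (A x) + norm (B x) \<le> \<delta> * norm w ^ m" by simp
      show "onorm (\<lambda>v. A x * v + B x * cnj v) \<le> \<delta> * norm w ^ m"
      proof (rule onorm_bound)
        show "norm (A x * v + B x * cnj v) \<le> \<delta> * norm w ^ m * norm v" for v
        proof -
          have "norm (A x * v + B x * cnj v) \<le> (norm (A x) + norm (B x)) * norm v"
            using norm_triangle_ineq[of "A x * v" "B x * cnj v"] by (simp add: norm_mult algebra_simps)
          also have "\<dots> \<le> \<delta> * norm w ^ m * norm v" using AB by (intro mult_right_mono) auto
          finally show ?thesis .
        qed
      qed (use Suc.prems(2) in simp)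
    qed auto
    moreover have "E 0 = 0" by (simp add: E_def wirtinger_taylor_0)
    ultimately show ?thesis by (simp add: mult_ac)
  qed
  with \<rho> show ?case unfolding E_def by blast
qed

section \<open>Expansion around the excised disc\<close>

text \<open>The surviving terms lie on the diagonal \<open>j = n - 1 + k\<close>. The degree
  condition \<open>j + k \<le> m\<close> there reads \<open>2 * k \<le> m + 1 - n\<close>, which is
  the origin of the upper limit of the sum.\<close>

lemma circle_integral_wirtinger_taylor:
  assumes "r > 0" "1 \<le> n" "n \<le> m + 1"
  shows "((\<lambda>w. wirtinger_taylor m f z w / w ^ n) has_contour_integral
     2 * of_real pi * \<i> * (\<Sum>k\<le>(m + 1 - n) div 2. wirtinger_coeff f z (n - 1 + k) k * of_real r ^ (2 * k)))
     (circlepath 0 r)"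
proof -
  let ?c = "wirtinger_coeff f z"
  define g where "g j k = ?c j k * (if j + 1 = k + n then 2 * of_real pi * \<i> * of_real r ^ (2 * k) else 0)" for j k
  have "((\<lambda>w. \<Sum>j\<le>m. \<Sum>k\<le>m - j. ?c j k * (w ^ j * cnj w ^ k / w ^ n)) has_contour_integral
      (\<Sum>j\<le>m. \<Sum>k\<le>m - j. g j k)) (circlepath 0 r)"
    unfolding g_def
    by (intro has_contour_integral_sum has_contour_integral_lmul has_contour_integral_circle_monomial assms(1)) auto
  also have "(\<lambda>w. \<Sum>j\<le>m. \<Sum>k\<le>m - j. ?c j k * (w ^ j * cnj w ^ k / w ^ n)) = (\<lambda>w. wirtinger_taylor m f z w / w ^ n)"
    by (simp add: wirtinger_taylor_def sum_divide_distrib)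
  also have "(\<Sum>j\<le>m. \<Sum>k\<le>m - j. g j k)
      = 2 * of_real pi * \<i> * (\<Sum>k\<le>(m + 1 - n) div 2. ?c (n - 1 + k) k * of_real r ^ (2 * k))"
  proof -
    have "(\<Sum>j\<le>m. \<Sum>k\<le>m - j. g j k) = (\<Sum>(j, k)\<in>(SIGMA j:{..m}. {..m - j}). g j k)"
      by (rule sum.Sigma) auto
    also have "\<dots> = (\<Sum>(j, k)\<in>(\<lambda>k. (n - 1 + k, k)) ` {..(m + 1 - n) div 2}. g j k)"
    proof (rule sum.mono_neutral_right)
      show "\<forall>x\<in>(SIGMA j:{..m}. {..m - j}) - (\<lambda>k. (n - 1 + k, k)) ` {..(m + 1 - n) div 2}. (case x of (j, k) \<Rightarrow> g j k) = 0"
      proof (safe, rule ccontr)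
        fix j k assume jk: "j \<le> m" "k \<le> m - j" "(j, k) \<notin> (\<lambda>k. (n - 1 + k, k)) ` {..(m + 1 - n) div 2}"
          and "g j k \<noteq> 0"
        then have "j + 1 = k + n" by (auto simp: g_def split: if_splits)
        with jk assms have "j = n - 1 + k" "k \<le> (m + 1 - n) div 2" by auto
        with jk(3) show False by blast
      qed
      show "(\<lambda>k. (n - 1 + k, k)) ` {..(m + 1 - n) div 2} \<subseteq> (SIGMA j:{..m}. {..m - j})"
        using assms by auto
    qed auto
    also have "\<dots> = (\<Sum>k\<le>(m + 1 - n) div 2. g (n - 1 + k) k)"
      by (subst sum.reindex) (auto intro: inj_onI)
    also have "\<dots> = 2 * of_real pi * \<i> * (\<Sum>k\<le>(m + 1 - n) div 2. ?c (n - 1 + k) k * of_real r ^ (2 * k))"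
      unfolding sum_distrib_left using assms by (intro sum.cong) (auto simp: g_def)
    finally show ?thesis .
  qed
  finally show ?thesis .
qed

text \<open>The Taylor error \<open>\<delta> * r ^ m\<close> is divided by \<open>r ^ n\<close> and
  multiplied by the length 2 pi r; the prefactor removes 2 pi.\<close>

lemma circle_integral_expansion:
  assumes "open U" "z \<in> U" "wirtinger_smooth m U f" "1 \<le> n" "n \<le> m + 1" "\<delta> > 0"
  shows "\<forall>\<^sub>F r in at_right 0.
    norm (1 / (2 * of_real pi * \<i>) * contour_integral (circlepath z r) (\<lambda>\<zeta>. f \<zeta> / (\<zeta> - z) ^ n)
      - (\<Sum>k\<le>(m + 1 - n) div 2. wirtinger_coeff f z (n - 1 + k) k * of_real r ^ (2 * k)))
    \<le> \<delta> * r ^ (m + 1 - n)"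
proof -
  obtain r1 where r1: "r1 > 0" "\<And>w. norm w < r1 \<Longrightarrow>
      norm (f (z + w) - wirtinger_taylor m f z w) \<le> \<delta> * norm w ^ m"
    using wirtinger_taylor_remainder[OF assms(1-3,6)] by blast
  obtain r2 where r2: "r2 > 0" "ball z r2 \<subseteq> U" using assms(1,2) by (auto simp: open_contains_ball)
  have f_cont: "continuous_on U f" by (rule wirtinger_smooth_imp_continuous[OF assms(3)])
  have "norm (1 / (2 * of_real pi * \<i>) * contour_integral (circlepath z r) (\<lambda>\<zeta>. f \<zeta> / (\<zeta> - z) ^ n)
      - (\<Sum>k\<le>(m + 1 - n) div 2. wirtinger_coeff f z (n - 1 + k) k * of_real r ^ (2 * k)))
    \<le> \<delta> * r ^ (m + 1 - n)" if r: "0 < r" "r < min r1 r2" for r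
  proof -
    let ?S = "\<Sum>k\<le>(m + 1 - n) div 2. wirtinger_coeff f z (n - 1 + k) k * of_real r ^ (2 * k)"
    have circ: "circlepath z r = (+) z \<circ> circlepath 0 r" by (auto simp: circlepath)
    have "continuous_on (sphere z r) (\<lambda>\<zeta>. f \<zeta> / (\<zeta> - z) ^ n)"
      using r r2 by (intro continuous_intros continuous_on_subset[OF f_cont]) (auto simp: subset_iff)
    then have "((\<lambda>\<zeta>. f \<zeta> / (\<zeta> - z) ^ n) has_contour_integral
        contour_integral (circlepath z r) (\<lambda>\<zeta>. f \<zeta> / (\<zeta> - z) ^ n)) (circlepath z r)"
      using r by (intro has_contour_integral_integral contour_integrable_continuous_circlepath) auto
    then have "((\<lambda>w. f (w + z) / (w + z - z) ^ n) has_contour_integral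
        contour_integral (circlepath z r) (\<lambda>\<zeta>. f \<zeta> / (\<zeta> - z) ^ n)) (circlepath 0 r)"
      by (subst (asm) (2) circ) (simp only: has_contour_integral_translate)
    from has_contour_integral_diff[OF this circle_integral_wirtinger_taylor[OF r(1) assms(4,5), of f z]]
    have "norm (contour_integral (circlepath z r) (\<lambda>\<zeta>. f \<zeta> / (\<zeta> - z) ^ n) - 2 * of_real pi * \<i> * ?S)
        \<le> (\<delta> * r ^ m / r ^ n) * (2 * pi * r)"
    proof (rule has_contour_integral_bound_circlepath)
      fix w :: complex assume "norm (w - 0) = r"
      then have w: "norm w = r" by simp
      have "norm (f (w + z) / (w + z - z) ^ n - wirtinger_taylor m f z w / w ^ n)
          = norm (f (z + w) - wirtinger_taylor m f z w) / r ^ n"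
        using w by (simp add: norm_divide norm_power add.commute flip: diff_divide_distrib)
      also have "\<dots> \<le> \<delta> * r ^ m / r ^ n"
        using r1(2)[of w] w r by (intro divide_right_mono) auto
      finally show "norm (f (w + z) / (w + z - z) ^ n - wirtinger_taylor m f z w / w ^ n) \<le> \<delta> * r ^ m / r ^ n" .
    qed (use r assms(6) in auto)
    then have "norm (contour_integral (circlepath z r) (\<lambda>\<zeta>. f \<zeta> / (\<zeta> - z) ^ n) - 2 * of_real pi * \<i> * ?S) / (2 * pi)
        \<le> \<delta> * (r ^ (m + 1) / r ^ n)"
      by (simp add: field_simps)
    also have "r ^ (m + 1) / r ^ n = r ^ (m + 1 - n)" using r assms(5) by (simp add: power_diff)
    also have "norm (contour_integral (circlepath z r) (\<lambda>\<zeta>. f \<zeta> / (\<zeta> - z) ^ n) - 2 * of_real pi * \<i> * ?S) / (2 * pi)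
       = norm ((contour_integral (circlepath z r) (\<lambda>\<zeta>. f \<zeta> / (\<zeta> - z) ^ n) - 2 * of_real pi * \<i> * ?S) / (2 * of_real pi * \<i>))"
      by (simp add: norm_divide norm_mult)
    also have "(contour_integral (circlepath z r) (\<lambda>\<zeta>. f \<zeta> / (\<zeta> - z) ^ n) - 2 * of_real pi * \<i> * ?S) / (2 * of_real pi * \<i>)
       = 1 / (2 * of_real pi * \<i>) * contour_integral (circlepath z r) (\<lambda>\<zeta>. f \<zeta> / (\<zeta> - z) ^ n) - ?S"
      by (simp add: diff_divide_distrib)
    finally show ?thesis .
  qed
  moreover have "\<forall>\<^sub>F r in at_right 0. 0 < r \<and> r < min r1 r2"
    using r1(1) r2(1) by (auto simp: eventually_at_right_field intro!: exI[of _ "min r1 r2"])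
  ultimately show ?thesis by (auto elim: eventually_mono)
qed

text \<open>The bounding circle returns in the closure: its points lie in the open set
  \<open>U\<close> and are limits of points outside the disc. In particular the closure stays away
  from the pole \<open>z\<close>.\<close>

lemma closure_Diff_cball:
  fixes z :: complex
  assumes "cball z r \<subseteq> U" "open U" "r > 0"
  shows "closure (U - cball z r) = closure U - ball z r"
proof (intro equalityI subsetI)
  fix w assume w: "w \<in> closure (U - cball z r)"
  have "U - cball z r \<subseteq> - ball z r" by auto
  then have "closure (U - cball z r) \<subseteq> - ball z r" by (intro closure_minimal) auto
  moreover have "closure (U - cball z r) \<subseteq> closure U" by (intro closure_mono) auto
  ultimately show "w \<in> closure U - ball z r" using w by auto
next
  fix w assume w: "w \<in> closure U - ball z r"
  show "w \<in> closure (U - cball z r)"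
  proof (cases "w \<in> cball z r")
    case True
    then have "w \<in> U" using assms(1) by auto
    have "w \<in> closure (- cball z r)"
      using w assms(3) by (simp add: closure_complement)
    then have "w \<in> closure (U \<inter> - cball z r)"
      using open_Int_closure_subset[OF assms(2), of "- cball z r"] \<open>w \<in> U\<close> by blast
    then show ?thesis by (simp add: Diff_eq)
  next
    case False
    then have "w \<in> closure (- cball z r \<inter> U)"
      using open_Int_closure_subset[of "- cball z r" U] w by blast
    then show ?thesis by (simp add: Diff_eq Int_commute)
  qed
qed

lemma piecewise_smooth_path_reversepath_circlepath:
  "piecewise_smooth_path (reversepath (circlepath z r))"
proof -
  define \<gamma>' where "\<gamma>' t = - (2 * pi * \<i> * r * exp (2 * of_real pi * \<i> * of_real (1 - t)))" for t :: real
  have "continuous_on {0..1} \<gamma>'" unfolding \<gamma>'_def by (intro continuous_intros)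
  moreover have "(reversepath (circlepath z r) has_vector_derivative \<gamma>' t) (at t within {0..1})" for t
  proof -
    have "((\<lambda>t::real. 1 - t) has_vector_derivative -1) (at t)"
      by (auto intro!: derivative_eq_intros)
    from vector_diff_chain_at[OF this has_vector_derivative_circlepath]
    have "(reversepath (circlepath z r) has_vector_derivative \<gamma>' t) (at t)"
      by (simp add: reversepath_def \<gamma>'_def o_def)
    then show ?thesis by (rule has_vector_derivative_at_within)
  qed
  ultimately have "\<exists>\<gamma>'. continuous_on {0..1} \<gamma>' \<and>
     (\<forall>t\<in>{0..1}. (reversepath (circlepath z r) has_vector_derivative \<gamma>' t) (at t within {0..1}))" by blast
  then show ?thesis
    unfolding piecewise_smooth_path_def
    by (intro conjI exI[of _ "[0, 1]"]) (auto simp: less_Suc_eq valid_path_imp_path)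
qed

text \<open>The continuous extensions of the partial derivatives are bounded on the compact closure
  and agree with the partial derivatives inside.\<close>

lemma C_on_closure_bounded:
  assumes "bounded \<Omega>" "C_on_closure (Suc m) \<Omega> f"
  obtains L where "\<And>\<zeta>. \<zeta> \<in> \<Omega> \<Longrightarrow> norm (f \<zeta>) \<le> L" "\<And>\<zeta>. \<zeta> \<in> \<Omega> \<Longrightarrow> norm (wirtinger f \<zeta>) \<le> L"
    "\<And>\<zeta>. \<zeta> \<in> \<Omega> \<Longrightarrow> norm (wirtinger_bar f \<zeta>) \<le> L"
proof -
  have bd: "\<exists>B. \<forall>\<zeta>\<in>\<Omega>. norm (k \<zeta>) \<le> B" if "continuous_on (closure \<Omega>) k" for k :: "complex \<Rightarrow> complex"
  proof -
    have "bounded (k ` closure \<Omega>)"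
      using assms(1) by (intro compact_imp_bounded compact_continuous_image that) (simp add: compact_closure)
    then show ?thesis unfolding bounded_iff using closure_subset[of \<Omega>] by blast
  qed
  obtain g h where gh: "C_on_closure m \<Omega> g" "C_on_closure m \<Omega> h"
    and D: "\<And>\<zeta>. \<zeta> \<in> \<Omega> \<Longrightarrow> ((\<lambda>t::real. f (\<zeta> + of_real t)) has_vector_derivative g \<zeta>) (at 0)"
      "\<And>\<zeta>. \<zeta> \<in> \<Omega> \<Longrightarrow> ((\<lambda>t::real. f (\<zeta> + \<i> * of_real t)) has_vector_derivative h \<zeta>) (at 0)"
    using assms(2) by auto
  have C0: "continuous_on (closure \<Omega>) k" if "C_on_closure m \<Omega> k" for k using that by (cases m) auto
  obtain B1 where B1: "\<And>\<zeta>. \<zeta> \<in> \<Omega> \<Longrightarrow> norm (g \<zeta>) \<le> B1" using bd[OF C0[OF gh(1)]] by blast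
  obtain B2 where B2: "\<And>\<zeta>. \<zeta> \<in> \<Omega> \<Longrightarrow> norm (h \<zeta>) \<le> B2" using bd[OF C0[OF gh(2)]] by blast
  obtain B3 where B3: "\<And>\<zeta>. \<zeta> \<in> \<Omega> \<Longrightarrow> norm (f \<zeta>) \<le> B3" using bd[of f] assms(2) by auto
  have p: "partial_xi f \<zeta> = g \<zeta>" "partial_eta f \<zeta> = h \<zeta>" if "\<zeta> \<in> \<Omega>" for \<zeta>
    unfolding partial_xi_def partial_eta_def using D that by (auto intro: vector_derivative_at)
  have w: "norm (wirtinger f \<zeta>) \<le> max B3 (B1 + B2)" "norm (wirtinger_bar f \<zeta>) \<le> max B3 (B1 + B2)"
    if "\<zeta> \<in> \<Omega>" for \<zeta>
  proof -
    have "norm (g \<zeta>) + norm (h \<zeta>) \<le> B1 + B2" using B1[OF that] B2[OF that] by simp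
    moreover have "norm (g \<zeta> - \<i> * h \<zeta>) \<le> norm (g \<zeta>) + norm (h \<zeta>)" "norm (g \<zeta> + \<i> * h \<zeta>) \<le> norm (g \<zeta>) + norm (h \<zeta>)"
      using norm_triangle_ineq4[of "g \<zeta>" "\<i> * h \<zeta>"] norm_triangle_ineq[of "g \<zeta>" "\<i> * h \<zeta>"] by (auto simp: norm_mult)
    moreover have "norm (wirtinger f \<zeta>) = norm (g \<zeta> - \<i> * h \<zeta>) / 2" "norm (wirtinger_bar f \<zeta>) = norm (g \<zeta> + \<i> * h \<zeta>) / 2"
      by (simp_all add: wirtinger_def wirtinger_bar_def p[OF that] norm_divide)
    ultimately show "norm (wirtinger f \<zeta>) \<le> max B3 (B1 + B2)" "norm (wirtinger_bar f \<zeta>) \<le> max B3 (B1 + B2)"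
      using norm_ge_zero[of "g \<zeta> - \<i> * h \<zeta>"] norm_ge_zero[of "g \<zeta> + \<i> * h \<zeta>"] by linarith+
  qed
  show thesis
    by (rule that[of "max B3 (B1 + B2)"]) (use B3 w in \<open>auto intro: max.coboundedI1\<close>)
qed

text \<open>The cycle for Green's formula is \<Gamma> together with the reversed circle: inside the
  disc the winding numbers 1 and -1 cancel, while outside the disc the circle contributes 0.\<close>

lemma Cauchy_Pompeiu_outside_disc:
  fixes \<phi> :: "complex \<Rightarrow> complex"
  assumes "open \<Omega>" "bounded \<Omega>" and bdry: "positively_oriented_boundary \<Omega> \<Gamma>"
    and smooth: "C_on_closure (Suc m) \<Omega> \<phi>" and r: "r > 0" "cball z r \<subseteq> \<Omega>"
  shows "boundary_integral \<Gamma> (\<lambda>\<zeta>. \<phi> \<zeta> / (\<zeta> - z) ^ n)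
      + wedge_integral (\<Omega> - ball z r) (\<lambda>\<zeta>. wirtinger_bar \<phi> \<zeta> / (\<zeta> - z) ^ n)
    = contour_integral (circlepath z r) (\<lambda>\<zeta>. \<phi> \<zeta> / (\<zeta> - z) ^ n)"
proof -
  let ?f = "\<lambda>\<zeta>. \<phi> \<zeta> / (\<zeta> - z) ^ n"
  let ?circ = "reversepath (circlepath z r)"
  \<comment> \<open>The closed disc is removed so that \<open>U\<close> is open; the circle by which
    this differs from the statement is a null set.\<close>
  define U where "U = \<Omega> - cball z r"
  have U: "open U" "bounded U" "U \<subseteq> \<Omega>" unfolding U_def using assms(1,2) by (auto intro: open_Diff bounded_subset)
  have clU: "closure U = closure \<Omega> - ball z r"
    unfolding U_def by (rule closure_Diff_cball[OF r(2) assms(1) r(1)])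
  have \<Gamma>: "finite \<Gamma>" "\<And>\<gamma>. \<gamma> \<in> \<Gamma> \<Longrightarrow> piecewise_smooth_path \<gamma>"
    "(\<Union>\<gamma>\<in>\<Gamma>. path_image \<gamma>) = frontier \<Omega>"
    "\<And>w. w \<in> \<Omega> \<Longrightarrow> (\<Sum>\<gamma>\<in>\<Gamma>. winding_number \<gamma> w) = 1"
    "\<And>w. w \<notin> closure \<Omega> \<Longrightarrow> (\<Sum>\<gamma>\<in>\<Gamma>. winding_number \<gamma> w) = 0"
    using bdry unfolding positively_oriented_boundary_def by auto
  have image: "path_image ?circ = sphere z r" using r(1) by simp
  have frontier_\<Omega>: "frontier \<Omega> = closure \<Omega> - \<Omega>" using assms(1) by (simp add: frontier_def interior_open)
  \<comment> \<open>The cycle is a set of paths, so the new circle counts only if it is not already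
    a member.\<close>
  have circ_notin: "?circ \<notin> \<Gamma>"
  proof
    assume "?circ \<in> \<Gamma>"
    then have "sphere z r \<subseteq> frontier \<Omega>" using image \<Gamma>(3) by blast
    moreover have "z + of_real r \<in> sphere z r" using r(1) by (simp add: dist_norm)
    ultimately show False using r(2) frontier_\<Omega> sphere_cball[of z r] by blast
  qed
  have frontier_U: "(\<Union>\<gamma>\<in>insert ?circ \<Gamma>. path_image \<gamma>) = frontier U"
  proof -
    have "frontier U = closure U - U" using U(1) by (simp add: frontier_def interior_open)
    also have "\<dots> = (closure \<Omega> - \<Omega>) \<union> sphere z r"
      unfolding clU unfolding U_def using r(2) closure_subset[of \<Omega>] by (auto simp: subset_iff)
    finally show ?thesis using \<Gamma>(3) frontier_\<Omega> image by auto
  qed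
  have winding_circ: "winding_number ?circ w = - (if dist w z < r then 1 else 0)" if "dist w z \<noteq> r" for w
  proof -
    have notin: "w \<notin> path_image (circlepath z r)" using that r(1) by (auto simp: dist_commute)
    have "winding_number (circlepath z r) w = (if dist w z < r then 1 else 0)"
      by (rule winding_number_circlepath_off_sphere[OF r(1) that])
    then show ?thesis using winding_number_reversepath[of "circlepath z r" w] notin
      by (simp add: valid_path_imp_path)
  qed
  have sum_insert: "(\<Sum>\<gamma>\<in>insert ?circ \<Gamma>. k \<gamma>) = k ?circ + (\<Sum>\<gamma>\<in>\<Gamma>. k \<gamma>)" for k :: "_ \<Rightarrow> complex"
    using \<Gamma>(1) circ_notin by simp
  have inside: "(\<Sum>\<gamma>\<in>insert ?circ \<Gamma>. winding_number \<gamma> w) = 1" if "w \<in> U" for w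
    unfolding sum_insert using that winding_circ[of w] \<Gamma>(4)[of w] by (auto simp: U_def dist_commute)
  have outside: "(\<Sum>\<gamma>\<in>insert ?circ \<Gamma>. winding_number \<gamma> w) = 0" if "w \<notin> closure U" for w
  proof (cases "w \<in> ball z r")
    case True
    then have "w \<in> \<Omega>" using r(2) by auto
    with True show ?thesis unfolding sum_insert using winding_circ[of w] \<Gamma>(4) by (auto simp: dist_commute)
  next
    case False
    with that have "w \<notin> closure \<Omega>" unfolding clU by simp
    moreover from this have "w \<notin> cball z r" using r(2) closure_subset[of \<Omega>] by blast
    ultimately show ?thesis unfolding sum_insert using winding_circ[of w] \<Gamma>(5) by (auto simp: dist_commute)
  qed
  have ws: "wirtinger_smooth (Suc m) \<Omega> \<phi>"
    by (rule C_on_closure_imp_wirtinger_smooth[OF assms(1) smooth])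
  define h where "h \<eta> = 1 / (\<eta> - z) ^ n" for \<eta>
  define h' where "h' \<eta> = - (of_nat n * (\<eta> - z) ^ (n - 1)) / ((\<eta> - z) ^ n)\<^sup>2" for \<eta>
  have nz: "\<eta> \<noteq> z" if "\<eta> \<in> closure U" for \<eta> using that r(1) unfolding clU by auto
  have cont_h: "continuous_on (closure U) h" "continuous_on (closure U) h'"
    unfolding h_def h'_def using nz by (auto intro!: continuous_intros)
  have clU_compact: "compact (closure U)" using U(2) by (simp add: compact_closure)
  obtain H where H: "\<And>\<eta>. \<eta> \<in> closure U \<Longrightarrow> norm (h \<eta>) \<le> H"
    using compact_imp_bounded[OF compact_continuous_image[OF cont_h(1) clU_compact]] unfolding bounded_iff by auto
  obtain H' where H': "\<And>\<eta>. \<eta> \<in> closure U \<Longrightarrow> norm (h' \<eta>) \<le> H'"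
    using compact_imp_bounded[OF compact_continuous_image[OF cont_h(2) clU_compact]] unfolding bounded_iff by auto
  obtain L where L: "\<And>\<zeta>. \<zeta> \<in> \<Omega> \<Longrightarrow> norm (\<phi> \<zeta>) \<le> L" "\<And>\<zeta>. \<zeta> \<in> \<Omega> \<Longrightarrow> norm (wirtinger \<phi> \<zeta>) \<le> L"
    "\<And>\<zeta>. \<zeta> \<in> \<Omega> \<Longrightarrow> norm (wirtinger_bar \<phi> \<zeta>) \<le> L"
    using C_on_closure_bounded[OF assms(2) smooth] by blast
  define a where "a \<eta> = \<phi> \<eta> * h' \<eta> + wirtinger \<phi> \<eta> * h \<eta>" for \<eta>
  define b where "b \<eta> = wirtinger_bar \<phi> \<eta> * h \<eta>" for \<eta>
  have deriv: "(?f has_derivative (\<lambda>v. a \<eta> * v + b \<eta> * cnj v)) (at \<eta>)" if "\<eta> \<in> U" for \<eta>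
  proof -
    have "\<eta> \<noteq> z" using nz that closure_subset[of U] by auto
    then have "(h has_field_derivative h' \<eta>) (at \<eta>)"
      unfolding h_def h'_def by (auto intro!: derivative_eq_intros simp: power2_eq_square)
    then have "(h has_derivative (\<lambda>v. h' \<eta> * v)) (at \<eta>)" by (simp add: has_field_derivative_def)
    moreover have "(\<phi> has_derivative (\<lambda>v. wirtinger \<phi> \<eta> * v + wirtinger_bar \<phi> \<eta> * cnj v)) (at \<eta>)"
      using ws that U(3) by auto
    ultimately have "((\<lambda>\<eta>. \<phi> \<eta> * h \<eta>) has_derivative
        (\<lambda>v. \<phi> \<eta> * (h' \<eta> * v) + (wirtinger \<phi> \<eta> * v + wirtinger_bar \<phi> \<eta> * cnj v) * h \<eta>)) (at \<eta>)"
      by (intro has_derivative_mult)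
    then show ?thesis by (simp add: h_def a_def b_def algebra_simps)
  qed
  have LH: "L \<ge> 0" "H \<ge> 0" "H' \<ge> 0" if "\<eta> \<in> U" for \<eta>
    using that L(1)[of \<eta>] H[of \<eta>] H'[of \<eta>] U(3) closure_subset[of U] norm_ge_zero order_trans by blast+
  have bound: "norm (a \<eta>) \<le> L * H' + L * H" "norm (b \<eta>) \<le> L * H' + L * H" if "\<eta> \<in> U" for \<eta>
  proof -
    have \<eta>: "\<eta> \<in> \<Omega>" "\<eta> \<in> closure U" using that U(3) closure_subset[of U] by auto
    have 1: "norm (\<phi> \<eta> * h' \<eta>) \<le> L * H'" "norm (wirtinger \<phi> \<eta> * h \<eta>) \<le> L * H" "norm (wirtinger_bar \<phi> \<eta> * h \<eta>) \<le> L * H"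
      unfolding norm_mult using L[OF \<eta>(1)] H[OF \<eta>(2)] H'[OF \<eta>(2)] LH[OF that] by (auto intro!: mult_mono)
    show "norm (a \<eta>) \<le> L * H' + L * H" unfolding a_def by (rule norm_triangle_mono[OF 1(1,2)])
    show "norm (b \<eta>) \<le> L * H' + L * H" unfolding b_def using 1(3) LH[OF that] by (simp add: add_increasing)
  qed
  have bar_cont: "continuous_on \<Omega> (wirtinger_bar \<phi>)"
    using ws by (auto intro: wirtinger_smooth_imp_continuous)
  have b_cont: "continuous_on U b"
    unfolding b_def using continuous_on_subset[OF bar_cont U(3)] continuous_on_subset[OF cont_h(1) closure_subset]
    by (intro continuous_on_mult)
  have f_cont: "continuous_on (closure U) ?f"
    using smooth nz unfolding clU by (auto intro!: continuous_intros intro: continuous_on_subset)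
  have "boundary_integral (insert ?circ \<Gamma>) ?f = 2 * \<i> * (LINT \<eta>:U|lborel. b \<eta>)"
    by (rule Green_cycle[OF U(1,2) _ _ frontier_U inside outside f_cont deriv bound b_cont])
      (use \<Gamma>(1,2) piecewise_smooth_path_reversepath_circlepath in auto)
  moreover have "boundary_integral (insert ?circ \<Gamma>) ?f
      = - contour_integral (circlepath z r) ?f + boundary_integral \<Gamma> ?f"
    unfolding boundary_integral_def sum_insert by (simp add: contour_integral_reversepath)
  \<comment> \<open>The factor -2 \<i> of the wedge integral is opposite to the one in Green's
    formula, so the two area terms cancel and only the circle integral remains.\<close>
  moreover have "wedge_integral (\<Omega> - ball z r) (\<lambda>\<zeta>. wirtinger_bar \<phi> \<zeta> / (\<zeta> - z) ^ n)
      = - 2 * \<i> * (LINT \<eta>:U|lborel. b \<eta>)"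
  proof -
    have sphere_null: "sphere z r \<in> null_sets lborel"
      using negligible_sphere[of z r] by (simp add: negligible_iff_null_sets null_sets_completion_iff)
    have b_eq: "(\<lambda>\<zeta>. wirtinger_bar \<phi> \<zeta> / (\<zeta> - z) ^ n) = b" by (auto simp: b_def h_def)
    have "continuous_on (\<Omega> - ball z r) b"
      unfolding b_def using bar_cont cont_h(1) closure_subset[of \<Omega>]
      by (intro continuous_on_mult) (auto intro: continuous_on_subset simp: clU)
    then have "(LINT \<eta>:\<Omega> - ball z r|lborel. b \<eta>) = (LINT \<eta>:U|lborel. b \<eta>)"
      using b_cont U(1) assms(1)
    proof (intro set_integral_cong_set)
      show "AE \<eta> in lborel. \<eta> \<in> U \<longleftrightarrow> \<eta> \<in> \<Omega> - ball z r"
        by (rule AE_I'[OF sphere_null]) (auto simp: U_def)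
    qed (auto simp: set_borel_measurable_def intro!: borel_measurable_continuous_on_indicator)
    then show ?thesis unfolding wedge_integral_def b_eq by simp
  qed
  ultimately show ?thesis by (simp add: algebra_simps)
qed

theorem proposition3p2:
  fixes \<Omega> :: "complex set" and \<Gamma> :: "(real \<Rightarrow> complex) set"
    and \<phi> :: "complex \<Rightarrow> complex" and z :: complex and m n :: nat
  assumes "open \<Omega>" and "connected \<Omega>" and "bounded \<Omega>"
    and "positively_oriented_boundary \<Omega> \<Gamma>"
    and "m \<ge> 1" and "C_on_closure m \<Omega> \<phi>"
    and "z \<in> \<Omega>"
    and "1 \<le> n" and "n \<le> m + 1"
  shows "(\<lambda>r::real.
      1 / fact (n - 1) * (wirtinger ^^ (n - 1)) \<phi> z
      - (1 / (2 * of_real pi * \<i>) * boundary_integral \<Gamma> (\<lambda>\<zeta>. \<phi> \<zeta> / (\<zeta> - z) ^ n)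
         + 1 / (2 * of_real pi * \<i>) *
             wedge_integral (\<Omega> - ball z r) (\<lambda>\<zeta>. wirtinger_bar \<phi> \<zeta> / (\<zeta> - z) ^ n)
         - (\<Sum>k = 1..(m + 1 - n) div 2.
              (wirtinger ^^ (n - 1 + k)) ((wirtinger_bar ^^ k) \<phi>) z
                / (fact (n - 1 + k) * fact k) * of_real r ^ (2 * k))))
    \<in> o[at_right 0](\<lambda>r. of_real r ^ (m + 1 - n))"
proof (rule landau_o.smallI)
  fix \<delta> :: real assume "\<delta> > 0"
  obtain m' where m': "m = Suc m'" using assms(5) by (cases m) auto
  \<comment> \<open>For \<open>r < r0\<close> the closed disc of radius \<open>r\<close> lies in
    \<Omega>.\<close>
  obtain r0 where r0: "r0 > 0" "ball z r0 \<subseteq> \<Omega>" using assms(1,7) by (auto simp: open_contains_ball)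
  have smooth: "wirtinger_smooth m \<Omega> \<phi>"
    by (rule C_on_closure_imp_wirtinger_smooth[OF assms(1,6)])
  have "\<forall>\<^sub>F r in at_right 0. 0 < r \<and> r < r0"
    using r0(1) by (auto simp: eventually_at_right_field intro!: exI[of _ r0])
  with circle_integral_expansion[OF assms(1,7) smooth assms(8,9) \<open>\<delta> > 0\<close>]
  show "\<forall>\<^sub>F r::real in at_right 0. norm (1 / fact (n - 1) * (wirtinger ^^ (n - 1)) \<phi> z
      - (1 / (2 * of_real pi * \<i>) * boundary_integral \<Gamma> (\<lambda>\<zeta>. \<phi> \<zeta> / (\<zeta> - z) ^ n)
         + 1 / (2 * of_real pi * \<i>) *
             wedge_integral (\<Omega> - ball z r) (\<lambda>\<zeta>. wirtinger_bar \<phi> \<zeta> / (\<zeta> - z) ^ n)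
         - (\<Sum>k = 1..(m + 1 - n) div 2.
              (wirtinger ^^ (n - 1 + k)) ((wirtinger_bar ^^ k) \<phi>) z
                / (fact (n - 1 + k) * fact k) * of_real r ^ (2 * k))))
    \<le> \<delta> * norm (of_real r ^ (m + 1 - n) :: complex)"
  proof eventually_elim
    case (elim r)
    let ?I = "contour_integral (circlepath z r) (\<lambda>\<zeta>. \<phi> \<zeta> / (\<zeta> - z) ^ n)"
    let ?B = "boundary_integral \<Gamma> (\<lambda>\<zeta>. \<phi> \<zeta> / (\<zeta> - z) ^ n)"
    let ?W = "wedge_integral (\<Omega> - ball z r) (\<lambda>\<zeta>. wirtinger_bar \<phi> \<zeta> / (\<zeta> - z) ^ n)"
    let ?c = "\<lambda>k. wirtinger_coeff \<phi> z (n - 1 + k) k * of_real r ^ (2 * k)"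
    let ?K = "(m + 1 - n) div 2"
    have cball: "cball z r \<subseteq> \<Omega>" using elim(2) r0(2) by (auto simp: subset_iff)
    have BW: "?B + ?W = ?I"
      using Cauchy_Pompeiu_outside_disc[OF assms(1,3,4) assms(6)[unfolded m'] _ cball] elim(2) by simp
    \<comment> \<open>The term \<open>k = 0\<close> of the circle expansion is the left side of the
      asserted formula, so the quantity to be estimated is minus the error of that
      expansion.\<close>
    have sum: "(\<Sum>k\<le>?K. ?c k) = ?c 0 + (\<Sum>k = 1..?K. ?c k)"
      by (simp add: atMost_atLeast0 sum.atLeast_Suc_atMost)
    have c0: "1 / fact (n - 1) * (wirtinger ^^ (n - 1)) \<phi> z = ?c 0" by (simp add: wirtinger_coeff_def)
    have ck: "(\<Sum>k = 1..?K. (wirtinger ^^ (n - 1 + k)) ((wirtinger_bar ^^ k) \<phi>) z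
                / (fact (n - 1 + k) * fact k) * of_real r ^ (2 * k)) = (\<Sum>k = 1..?K. ?c k)"
      by (simp only: wirtinger_coeff_def)
    have "?c 0 - (1 / (2 * of_real pi * \<i>) * ?B + 1 / (2 * of_real pi * \<i>) * ?W - (\<Sum>k = 1..?K. ?c k))
        = - (1 / (2 * of_real pi * \<i>) * (?B + ?W) - (\<Sum>k\<le>?K. ?c k))"
      unfolding sum by (simp only: distrib_left) (simp add: algebra_simps)
    then show ?case
      unfolding c0 ck using elim unfolding BW by (simp add: norm_minus_commute norm_power)
  qed
qed

end
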